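(* There exist universal constants $C_5, C_6>0$ such that the following holds. Let $n\ge 1$, $p\ge 1$, $m\ge n$ and $2\le s\le np$ be integers, and let $\Phi$ be the random $m\times np$ multichannel circulant matrix defined in the context. Then \[ \mathbb{E}\,\|I-\Phi^*\Phi\|_s \;\le\; \sqrt{\frac{C_5\, s\,\log^2 s\,\log^2(mp)\,\log(np)}{m}} \] whenever $m\ge C_6\, s\,\log^2 s\,\log^2(mp)\,\log(np)$.
   Context: Probe signals: for $i=1,\dots,p$ and $t=1,\dots,m$, the entries $\phi_i(t)$ are independent Gaussian random variables with mean $0$ and variance $1/m$. For each $i$, $\Phi_i$ is the $m\times n$ matrix with entries $\Phi_i(r,c)=\phi_i\big(((n+r-c-1)\bmod m)+1\big)$ for $1\le r\le m$, $1\le c\le n$. Equivalently, $\Phi_i$ consists of the first $n$ columns of the $m\times m$ circulant matrix whose first row is $(\phi_i(n),\phi_i(n-1),\dots,\phi_i(1),\phi_i(m),\dots,\phi_i(n+1))$. The matrix $\Phi=[\Phi_1\ \Phi_2\ \cdots\ \Phi_p]$ is $m\times np$, obtained by concatenating the $\Phi_i$ side by side. For an $N\times N$ matrix $A$ and an integer $s\ge1$, define \[ \|A\|_s=\sup\{|y^*Ax| : \Gamma\subset\{1,\dots,N\},\ |\Gamma|\le s,\ x,y \text{ supported on }\Gamma,\ \|x\|_2=\|y\|_2=1\}. \] Here $^*$ denotes the (conjugate) transpose, and $I$ is the $np\times np$ identity matrix. *)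

theory Defs
  imports "HOL-Probability.Probability"
begin

text \<open>Probe signals are modelled as a function phi :: nat * nat => real, phi (i,t) = phi_i(t),
  for 1 <= i <= p, 1 <= t <= m.  Law: i.i.d. N(0, 1/m), i.e. standard deviation 1/sqrt m.\<close>

definition probe_measure :: "nat \<Rightarrow> nat \<Rightarrow> (nat \<times> nat \<Rightarrow> real) measure" where
  "probe_measure m p =
     PiM ({1..p} \<times> {1..m}) (\<lambda>_. density lborel (normal_density 0 (1 / sqrt (real m))))"

text \<open>Entry (r, col) of Phi = [Phi_1 ... Phi_p], 1 <= r <= m, 1 <= col <= n*p;
  column col belongs to block i = (col-1) div n + 1, local column c = (col-1) mod n + 1,
  and Phi_i(r,c) = phi_i(((n + r - c - 1) mod m) + 1).\<close>

definition Phi_entry :: "nat \<Rightarrow> nat \<Rightarrow> (nat \<times> nat \<Rightarrow> real) \<Rightarrow> nat \<Rightarrow> nat \<Rightarrow> real" where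
  "Phi_entry n m phi r col =
     (let i = (col - 1) div n + 1; c = (col - 1) mod n + 1
      in phi (i, nat ((int n + int r - int c - 1) mod int m) + 1))"

definition snorm :: "nat \<Rightarrow> nat \<Rightarrow> (nat \<Rightarrow> nat \<Rightarrow> real) \<Rightarrow> real" where
  "snorm N s A = Sup {\<bar>\<Sum>j\<in>{1..N}. \<Sum>k\<in>{1..N}. y j * A j k * x k\<bar> | \<Gamma> x y.
       \<Gamma> \<subseteq> {1..N} \<and> card \<Gamma> \<le> s \<and>
       (\<forall>j. j \<notin> \<Gamma> \<longrightarrow> x j = 0) \<and> (\<forall>j. j \<notin> \<Gamma> \<longrightarrow> y j = 0) \<and>
       sqrt (\<Sum>j\<in>\<Gamma>. (x j)\<^sup>2) = 1 \<and> sqrt (\<Sum>j\<in>\<Gamma>. (y j)\<^sup>2) = 1}"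

definition gram_dev :: "nat \<Rightarrow> nat \<Rightarrow> (nat \<times> nat \<Rightarrow> real) \<Rightarrow> nat \<Rightarrow> nat \<Rightarrow> real" where
  "gram_dev n m phi j k =
     (if j = k then 1 else 0) - (\<Sum>r\<in>{1..m}. Phi_entry n m phi r j * Phi_entry n m phi r k)"

end

theory Submission
  imports Defs
begin

text \<open>
  For a sparse unit vector \<open>u\<close>, the vector \<open>\<Phi> u\<close> is linear in the probe variables, so
  \<open>\<parallel>\<Phi> u\<parallel>\<^sup>2 - \<parallel>u\<parallel>\<^sup>2\<close> is a centred Gaussian chaos of order two. Its supremum over \<open>u\<close>
  reduces to a maximum \<open>D\<close> over a finite grid of log-cardinality \<open>O(s log np)\<close>. Subtracting an
  independent copy \<open>g'\<close> of the probe \<open>g\<close> and rotating \<open>(g, g')\<close> by 45 degrees turns the chaos into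
  twice the decoupled form \<open>\<langle>\<Phi>(h) u, \<Phi>(h') u\<rangle>\<close> with independent Gaussian \<open>h, h'\<close>.

  The decoupled form is bounded by chaining. Conditionally on one of the two probes, an increment is
  a Gaussian linear form whose standard deviation is at most \<open>m\<^sup>-\<^sup>1\<^sup>/\<^sup>2\<close> times
  \<open>max\<^sub>\<omega> \<parallel>(u - v)^(\<omega>)\<parallel>\<^sub>2\<close> (Fourier transforms on \<open>\<int>/m\<close>) times \<open>(1 + D)\<^sup>1\<^sup>/\<^sup>2\<close>. Since
  \<open>\<parallel>u\<parallel>\<^sub>1 \<le> s\<^sup>1\<^sup>/\<^sup>2\<close>, Maurey's method approximates \<open>u\<close> at scale \<open>s\<^sup>1\<^sup>/\<^sup>2 2\<^sup>-\<^sup>j\<close> using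
  \<open>O(4\<^sup>j log m)\<close> signed unit vectors, so every one of the \<open>O(log s)\<close> scales contributes the same
  amount, of order \<open>(s log m log(np) / m)\<^sup>1\<^sup>/\<^sup>2 (1 + D)\<^sup>1\<^sup>/\<^sup>2\<close>. The resulting inequality
  \<open>E D \<le> \<alpha> (1 + E D / 2)\<close> with \<open>\<alpha> \<le> 1\<close> gives \<open>E D \<le> 2 \<alpha>\<close>.
\<close>

section \<open>Gaussian vectors\<close>

text \<open>The obstacle is that the decoupled chaos is Gaussian only conditionally, and its
  conditional variance contains the norm of \<Phi>(h) v, hence the very quantity D that is to be
  bounded. The root is therefore linearised, sqrt (1 + D) <= 1 + D / 2, which keeps the recursion
  affine in E D. The lower bound on m is what gives \<alpha> <= 1, and E D must be known to be
  finite before it can be absorbed.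

  Origin of the logarithms: log m pays for the m frequencies that Maurey's method controls at once,
  log(np) for the choice of each signed unit vector, and log s is the number of scales, squared
  because the scales are summed outside the root. The constants are 12291840 = 16 * 220 * 9 * 388
  and 786677760 = 64 * 12291840.

  Expectations are nonnegative extended integrals. The random quantities that are computed with are
  maxima over finite sets, and \<open>snorm\<close> is only compared pointwise with such a maximum,
  so the measurability of a supremum over a continuum never arises.\<close>

definition gauss :: "real \<Rightarrow> real measure" where
  "gauss \<sigma> = density lborel (normal_density 0 \<sigma>)"

lemma sets_gauss[simp, measurable_cong]: "sets (gauss \<sigma>) = sets borel"
  by (simp add: gauss_def)

lemma space_gauss[simp]: "space (gauss \<sigma>) = UNIV"
  by (simp add: gauss_def)

lemma prob_space_gauss: "0 < \<sigma> \<Longrightarrow> prob_space (gauss \<sigma>)"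
  unfolding gauss_def by (rule prob_space_normal_density)

lemma nn_integral_gauss:
  "f \<in> borel_measurable borel \<Longrightarrow>
    (\<integral>\<^sup>+x. f x \<partial>gauss \<sigma>) = (\<integral>\<^sup>+x. ennreal (normal_density 0 \<sigma> x) * f x \<partial>lborel)"
  unfolding gauss_def by (rule nn_integral_density) auto

text \<open>Completing the square: translation by \<open>a * \<sigma>\<^sup>2\<close> absorbs the
  linear exponent.\<close>

lemma nn_integral_gauss_exp:
  assumes "0 < \<sigma>"
  shows "(\<integral>\<^sup>+x. ennreal (exp (a * x)) \<partial>gauss \<sigma>) = ennreal (exp (a\<^sup>2 * \<sigma>\<^sup>2 / 2))"
proof -
  interpret prob_space "gauss \<sigma>" using assms by (rule prob_space_gauss)
  have shift: "normal_density 0 \<sigma> (a * \<sigma>\<^sup>2 + x) * exp (a * (a * \<sigma>\<^sup>2 + x)) =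
      exp (a\<^sup>2 * \<sigma>\<^sup>2 / 2) * normal_density 0 \<sigma> x" for x
  proof -
    have "- (a * \<sigma>\<^sup>2 + x)\<^sup>2 / (2 * \<sigma>\<^sup>2) + a * (a * \<sigma>\<^sup>2 + x) = a\<^sup>2 * \<sigma>\<^sup>2 / 2 + - x\<^sup>2 / (2 * \<sigma>\<^sup>2)"
      using assms by (simp add: field_simps power2_eq_square)
    then show ?thesis
      by (simp add: normal_density_def mult_exp_exp[symmetric] exp_add[symmetric])
  qed
  have "(\<integral>\<^sup>+x. ennreal (exp (a * x)) \<partial>gauss \<sigma>) =
      (\<integral>\<^sup>+x. ennreal (normal_density 0 \<sigma> x * exp (a * x)) \<partial>lborel)"
    by (subst nn_integral_gauss) (auto simp: ennreal_mult)
  also have "\<dots> = (\<integral>\<^sup>+x. ennreal (normal_density 0 \<sigma> (a * \<sigma>\<^sup>2 + x) * exp (a * (a * \<sigma>\<^sup>2 + x))) \<partial>lborel)"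
    by (subst nn_integral_real_affine[where c = 1 and t = "a * \<sigma>\<^sup>2"]) auto
  also have "\<dots> = ennreal (exp (a\<^sup>2 * \<sigma>\<^sup>2 / 2)) * (\<integral>\<^sup>+x. ennreal (normal_density 0 \<sigma> x) * 1 \<partial>lborel)"
    by (subst nn_integral_cmult[symmetric]) (auto simp: shift ennreal_mult)
  also have "(\<integral>\<^sup>+x. ennreal (normal_density 0 \<sigma> x) * 1 \<partial>lborel) = 1"
    using emeasure_space_1 by (subst nn_integral_gauss[symmetric]) auto
  finally show ?thesis by simp
qed

text \<open>The joint density depends only on x^2 + y^2 and the rotation preserves area. The
  substitution is made one coordinate at a time, and the two scale factors sqrt 2 and 1 / sqrt 2
  cancel.\<close>

lemma gauss_rotation:
  assumes "0 < \<sigma>"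
  shows "distr (gauss \<sigma> \<Otimes>\<^sub>M gauss \<sigma>) (gauss \<sigma> \<Otimes>\<^sub>M gauss \<sigma>)
      (\<lambda>(x, y). ((x - y) / sqrt 2, (x + y) / sqrt 2)) = gauss \<sigma> \<Otimes>\<^sub>M gauss \<sigma>"
    (is "distr ?M ?M ?R = ?M")
proof -
  interpret g: prob_space "gauss \<sigma>" using assms by (rule prob_space_gauss)
  define d where "d = (\<lambda>x. ennreal (normal_density 0 \<sigma> x))"
  have [measurable]: "d \<in> borel_measurable borel" by (simp add: d_def)
  have R[measurable]: "?R \<in> measurable ?M ?M" by simp
  have two: "(\<integral>\<^sup>+z. f z \<partial>?M) = (\<integral>\<^sup>+x. \<integral>\<^sup>+y. d x * d y * f (x, y) \<partial>lborel \<partial>lborel)"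
    if [measurable]: "f \<in> borel_measurable (borel \<Otimes>\<^sub>M borel)" for f
  proof -
    have "(\<integral>\<^sup>+z. f z \<partial>?M) = (\<integral>\<^sup>+x. \<integral>\<^sup>+y. f (x, y) \<partial>gauss \<sigma> \<partial>gauss \<sigma>)"
      by (rule g.nn_integral_fst[symmetric]) measurable
    also have "\<dots> = (\<integral>\<^sup>+x. \<integral>\<^sup>+y. d y * f (x, y) \<partial>lborel \<partial>gauss \<sigma>)"
      by (intro nn_integral_cong) (simp add: nn_integral_gauss d_def)
    also have "\<dots> = (\<integral>\<^sup>+x. d x * (\<integral>\<^sup>+y. d y * f (x, y) \<partial>lborel) \<partial>lborel)"
      by (subst nn_integral_gauss) (auto simp: d_def)
    also have "\<dots> = (\<integral>\<^sup>+x. \<integral>\<^sup>+y. d x * d y * f (x, y) \<partial>lborel \<partial>lborel)"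
      by (intro nn_integral_cong) (simp add: nn_integral_cmult[symmetric] mult.assoc)
    finally show ?thesis .
  qed
  have dd: "d ((a + b) / sqrt 2) * d ((b - a) / sqrt 2) = d a * d b" for a b
  proof -
    have "((a + b) / sqrt 2)\<^sup>2 + ((b - a) / sqrt 2)\<^sup>2 = a\<^sup>2 + b\<^sup>2"
      by (simp add: power_divide field_simps power2_eq_square)
    then have "- ((a + b) / sqrt 2)\<^sup>2 / (2 * \<sigma>\<^sup>2) + - ((b - a) / sqrt 2)\<^sup>2 / (2 * \<sigma>\<^sup>2) =
        - a\<^sup>2 / (2 * \<sigma>\<^sup>2) + - b\<^sup>2 / (2 * \<sigma>\<^sup>2)"
      by (simp only: add_divide_distrib[symmetric] minus_add_distrib[symmetric])
    then have "exp (- ((a + b) / sqrt 2)\<^sup>2 / (2 * \<sigma>\<^sup>2)) * exp (- ((b - a) / sqrt 2)\<^sup>2 / (2 * \<sigma>\<^sup>2)) =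
        exp (- a\<^sup>2 / (2 * \<sigma>\<^sup>2)) * exp (- b\<^sup>2 / (2 * \<sigma>\<^sup>2))"
      by (simp only: exp_add[symmetric])
    then show ?thesis
      unfolding d_def by (simp add: ennreal_mult[symmetric] normal_density_def)
  qed
  have inv: "(\<integral>\<^sup>+z. f (?R z) \<partial>?M) = (\<integral>\<^sup>+z. f z \<partial>?M)"
    if [measurable]: "f \<in> borel_measurable (borel \<Otimes>\<^sub>M borel)" for f
  proof -
    have "(\<integral>\<^sup>+z. f (?R z) \<partial>?M) =
        (\<integral>\<^sup>+x. \<integral>\<^sup>+y. d x * d y * f ((x - y) / sqrt 2, (x + y) / sqrt 2) \<partial>lborel \<partial>lborel)"
      by (subst two) auto
    also have "\<dots> = (\<integral>\<^sup>+y. \<integral>\<^sup>+x. d x * d y * f ((x - y) / sqrt 2, (x + y) / sqrt 2) \<partial>lborel \<partial>lborel)"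
      by (rule lborel_pair.Fubini') simp
    \<comment> \<open>With y fixed, x = y + sqrt 2 * a makes a the first rotated coordinate. After
      exchanging the integrals, y = (b - a) / sqrt 2 with a fixed makes b the second one.\<close>
    also have "\<dots> = (\<integral>\<^sup>+y. ennreal (sqrt 2) *
        (\<integral>\<^sup>+a. d (y + sqrt 2 * a) * d y * f (a, (2 * y + sqrt 2 * a) / sqrt 2) \<partial>lborel) \<partial>lborel)"
    proof (intro nn_integral_cong)
      fix y :: real
      show "(\<integral>\<^sup>+x. d x * d y * f ((x - y) / sqrt 2, (x + y) / sqrt 2) \<partial>lborel) = ennreal (sqrt 2) *
        (\<integral>\<^sup>+a. d (y + sqrt 2 * a) * d y * f (a, (2 * y + sqrt 2 * a) / sqrt 2) \<partial>lborel)"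
        by (subst nn_integral_real_affine[where c = "sqrt 2" and t = y]) (auto simp: algebra_simps)
    qed
    also have "\<dots> = ennreal (sqrt 2) * (\<integral>\<^sup>+y. \<integral>\<^sup>+a. d (y + sqrt 2 * a) * d y *
         f (a, (2 * y + sqrt 2 * a) / sqrt 2) \<partial>lborel \<partial>lborel)"
      by (rule nn_integral_cmult) simp
    also have "(\<integral>\<^sup>+y. \<integral>\<^sup>+a. d (y + sqrt 2 * a) * d y * f (a, (2 * y + sqrt 2 * a) / sqrt 2) \<partial>lborel \<partial>lborel) =
        (\<integral>\<^sup>+a. \<integral>\<^sup>+y. d (y + sqrt 2 * a) * d y * f (a, (2 * y + sqrt 2 * a) / sqrt 2) \<partial>lborel \<partial>lborel)"
      by (rule lborel_pair.Fubini') simp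
    also have "\<dots> = (\<integral>\<^sup>+a. ennreal (1 / sqrt 2) * (\<integral>\<^sup>+b. d a * d b * f (a, b) \<partial>lborel) \<partial>lborel)"
    proof (intro nn_integral_cong)
      fix a :: real
      have "(\<integral>\<^sup>+y. d (y + sqrt 2 * a) * d y * f (a, (2 * y + sqrt 2 * a) / sqrt 2) \<partial>lborel) =
          ennreal (1 / sqrt 2) * (\<integral>\<^sup>+b. d ((a + b) / sqrt 2) * d ((b - a) / sqrt 2) * f (a, b) \<partial>lborel)"
      proof (subst nn_integral_real_affine[where c = "1 / sqrt 2" and t = "- a / sqrt 2"], goal_cases)
        case 3
        have e1: "(b - a) / sqrt 2 + sqrt 2 * a = (a + b) / sqrt 2" for b
          by (simp add: field_simps)
        have e2: "- a / sqrt 2 + 1 / sqrt 2 * b = (b - a) / sqrt 2" for b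
          by (simp add: field_simps)
        have e3: "(2 * ((b - a) / sqrt 2) + sqrt 2 * a) / sqrt 2 = b" for b
          by (simp add: field_simps)
        have "(\<integral>\<^sup>+ x. d (- a / sqrt 2 + 1 / sqrt 2 * x + sqrt 2 * a) * d (- a / sqrt 2 + 1 / sqrt 2 * x) *
            f (a, (2 * (- a / sqrt 2 + 1 / sqrt 2 * x) + sqrt 2 * a) / sqrt 2) \<partial>lborel) =
          (\<integral>\<^sup>+b. d ((a + b) / sqrt 2) * d ((b - a) / sqrt 2) * f (a, b) \<partial>lborel)"
          unfolding e2 e3 e1 ..
        then show ?case by (simp add: abs_of_pos)
      qed auto
      then show "(\<integral>\<^sup>+y. d (y + sqrt 2 * a) * d y * f (a, (2 * y + sqrt 2 * a) / sqrt 2) \<partial>lborel) =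
          ennreal (1 / sqrt 2) * (\<integral>\<^sup>+b. d a * d b * f (a, b) \<partial>lborel)"
        by (simp only: dd)
    qed
    also have "\<dots> = ennreal (1 / sqrt 2) * (\<integral>\<^sup>+a. \<integral>\<^sup>+b. d a * d b * f (a, b) \<partial>lborel \<partial>lborel)"
      by (rule nn_integral_cmult) simp
    also have "ennreal (sqrt 2) * \<dots> = (\<integral>\<^sup>+a. \<integral>\<^sup>+b. d a * d b * f (a, b) \<partial>lborel \<partial>lborel)"
      by (simp add: mult.assoc[symmetric] ennreal_mult[symmetric])
    also have "\<dots> = (\<integral>\<^sup>+z. f z \<partial>?M)" by (subst two) auto
    finally show ?thesis .
  qed
  show ?thesis
  proof (rule measure_eqI)
    fix A assume "A \<in> sets (distr ?M ?M ?R)"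
    then have A[measurable]: "A \<in> sets ?M" by simp
    have "sets ?M = sets (borel \<Otimes>\<^sub>M borel)" by (intro sets_pair_measure_cong) auto
    with A have A'[measurable]: "A \<in> sets (borel \<Otimes>\<^sub>M borel)" by simp
    have "emeasure (distr ?M ?M ?R) A = (\<integral>\<^sup>+z. indicator A z \<partial>distr ?M ?M ?R)"
      by (rule nn_integral_indicator[symmetric]) simp
    also have "\<dots> = (\<integral>\<^sup>+z. indicator A (?R z) \<partial>?M)"
      by (rule nn_integral_distr) auto
    also have "\<dots> = (\<integral>\<^sup>+z. indicator A z \<partial>?M)"
      by (rule inv) simp
    also have "\<dots> = emeasure ?M A" by (rule nn_integral_indicator) simp
    finally show "emeasure (distr ?M ?M ?R) A = emeasure ?M A" .
  qed simp
qed

section \<open>Rotation invariance for pairs of Gaussian vectors\<close>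

definition gauss_vec :: "real \<Rightarrow> 'a set \<Rightarrow> ('a \<Rightarrow> real) measure" where
  "gauss_vec \<sigma> I = (\<Pi>\<^sub>M i\<in>I. gauss \<sigma>)"

lemma sets_gauss_vec[measurable_cong]: "sets (gauss_vec \<sigma> I) = sets (\<Pi>\<^sub>M i\<in>I. borel)"
  unfolding gauss_vec_def by (intro sets_PiM_cong) auto

lemma space_gauss_vec: "space (gauss_vec \<sigma> I) = (\<Pi>\<^sub>E i\<in>I. UNIV)"
  by (simp add: gauss_vec_def space_PiM)

lemma prob_space_gauss_vec: "0 < \<sigma> \<Longrightarrow> prob_space (gauss_vec \<sigma> I)"
  unfolding gauss_vec_def by (intro prob_space_PiM prob_space_gauss)

lemma gauss_vec_component: "i \<in> I \<Longrightarrow> (\<lambda>g. g i) \<in> borel_measurable (gauss_vec \<sigma> I)"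
  by simp

lemma indicator_slice_measurable:
  "A \<in> sets (M \<Otimes>\<^sub>M N) \<Longrightarrow> y \<in> space N \<Longrightarrow>
    (\<lambda>x. indicator A (x, y) :: ennreal) \<in> borel_measurable M"
  by (rule measurable_compose[OF measurable_Pair2' borel_measurable_indicator])

lemma (in sigma_finite_measure) nn_integral_slice_measurable:
  assumes "A \<in> sets (M \<Otimes>\<^sub>M N)"
  shows "(\<lambda>y. \<integral>\<^sup>+x. indicator A (x, y) \<partial>M :: ennreal) \<in> borel_measurable N"
proof -
  have "(\<lambda>z. indicator A (snd z, fst z) :: ennreal) \<in> borel_measurable (N \<Otimes>\<^sub>M M)"
    using measurable_compose[OF measurable_pair_swap' borel_measurable_indicator[OF assms]]
    by (simp add: split_beta')
  from borel_measurable_nn_integral_fst[OF this] show ?thesis by simp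
qed

text \<open>Zipping two independent vectors yields independent pairs, so that a rotation can act
  coordinate by coordinate. It suffices to compare measures on boxes, where the integral factorises
  once for each vector.\<close>

lemma gauss_vec_pair:
  assumes "0 < \<sigma>" "finite I"
  shows "distr (gauss_vec \<sigma> I \<Otimes>\<^sub>M gauss_vec \<sigma> I) (\<Pi>\<^sub>M i\<in>I. gauss \<sigma> \<Otimes>\<^sub>M gauss \<sigma>)
      (\<lambda>z. \<lambda>i\<in>I. (fst z i, snd z i)) = (\<Pi>\<^sub>M i\<in>I. gauss \<sigma> \<Otimes>\<^sub>M gauss \<sigma>)"
    (is "distr ?G ?P ?T = ?P")
proof -
  interpret g: prob_space "gauss \<sigma>" using assms(1) by (rule prob_space_gauss)
  interpret G: prob_space "gauss_vec \<sigma> I" using assms(1) by (rule prob_space_gauss_vec)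
  interpret gg: pair_prob_space "gauss \<sigma>" "gauss \<sigma>" ..
  interpret GG: pair_prob_space "gauss_vec \<sigma> I" "gauss_vec \<sigma> I" ..
  interpret S: product_sigma_finite "\<lambda>_::'a. gauss \<sigma>" ..
  interpret P: product_sigma_finite "\<lambda>_::'a. gauss \<sigma> \<Otimes>\<^sub>M gauss \<sigma>" ..
  have T[measurable]: "?T \<in> measurable ?G ?P"
    by (intro measurable_restrict) measurable
  show ?thesis
  proof (rule P.PiM_eqI)
    fix A :: "'a \<Rightarrow> (real \<times> real) set"
    assume A: "\<And>i. i \<in> I \<Longrightarrow> A i \<in> sets (gauss \<sigma> \<Otimes>\<^sub>M gauss \<sigma>)"
    have Pi[measurable]: "Pi\<^sub>E I A \<in> sets ?P" using A assms(2) by (intro sets_PiM_I_finite) auto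
    have m: "(\<lambda>x. indicator (A i) (x, y) :: ennreal) \<in> borel_measurable (gauss \<sigma>)"
      if "i \<in> I" for i y
      by (rule indicator_slice_measurable[OF A[OF that]]) simp
    have m2: "(\<lambda>y. \<integral>\<^sup>+x. indicator (A i) (x, y) \<partial>gauss \<sigma>) \<in> borel_measurable (gauss \<sigma>)"
      if "i \<in> I" for i
      by (rule g.nn_integral_slice_measurable[OF A[OF that]])
    have m3: "(\<lambda>z. \<Prod>i\<in>I. indicator (A i) (fst z i, snd z i) :: ennreal) \<in> borel_measurable ?G"
    proof (rule borel_measurable_prod_ennreal)
      fix i assume i: "i \<in> I"
      have "(\<lambda>z. (fst z i, snd z i)) \<in> measurable ?G (gauss \<sigma> \<Otimes>\<^sub>M gauss \<sigma>)"
        using i by measurable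
      from measurable_compose[OF this borel_measurable_indicator[OF A[OF i]]]
      show "(\<lambda>z. indicator (A i) (fst z i, snd z i) :: ennreal) \<in> borel_measurable ?G" .
    qed
    have "emeasure (distr ?G ?P ?T) (Pi\<^sub>E I A) = (\<integral>\<^sup>+z. indicator (Pi\<^sub>E I A) z \<partial>distr ?G ?P ?T)"
      by (rule nn_integral_indicator[symmetric]) simp
    also have "\<dots> = (\<integral>\<^sup>+z. indicator (Pi\<^sub>E I A) (?T z) \<partial>?G)"
      by (rule nn_integral_distr) auto
    also have "\<dots> = (\<integral>\<^sup>+z. (\<Prod>i\<in>I. indicator (A i) (fst z i, snd z i)) \<partial>?G)"
    proof (intro nn_integral_cong)
      fix z
      have "(\<Prod>i\<in>I. indicator (A i) (fst z i, snd z i) :: ennreal) =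
          (if \<forall>i\<in>I. (fst z i, snd z i) \<in> A i then 1 else 0)"
        using assms(2) by (auto simp: indicator_def)
      then show "indicator (Pi\<^sub>E I A) (?T z) = (\<Prod>i\<in>I. indicator (A i) (fst z i, snd z i) :: ennreal)"
        by (auto simp: indicator_def PiE_iff)
    qed
    also have "\<dots> = (\<integral>\<^sup>+y. \<integral>\<^sup>+x. (\<Prod>i\<in>I. indicator (A i) (x i, y i)) \<partial>gauss_vec \<sigma> I \<partial>gauss_vec \<sigma> I)"
      by (subst GG.nn_integral_snd[symmetric, OF m3]) simp
    also have "\<dots> = (\<integral>\<^sup>+y. (\<Prod>i\<in>I. \<integral>\<^sup>+x. indicator (A i) (x, y i) \<partial>gauss \<sigma>) \<partial>gauss_vec \<sigma> I)"
    proof (intro nn_integral_cong)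
      fix y
      show "(\<integral>\<^sup>+x. (\<Prod>i\<in>I. indicator (A i) (x i, y i)) \<partial>gauss_vec \<sigma> I) =
          (\<Prod>i\<in>I. \<integral>\<^sup>+x. indicator (A i) (x, y i) \<partial>gauss \<sigma> :: ennreal)"
        unfolding gauss_vec_def
        by (rule S.product_nn_integral_prod[OF assms(2), where f = "\<lambda>i x. indicator (A i) (x, y i)"])
          (rule m)
    qed
    also have "\<dots> = (\<Prod>i\<in>I. \<integral>\<^sup>+y. \<integral>\<^sup>+x. indicator (A i) (x, y) \<partial>gauss \<sigma> \<partial>gauss \<sigma>)"
      unfolding gauss_vec_def
      by (rule S.product_nn_integral_prod[OF assms(2), where
            f = "\<lambda>i y. \<integral>\<^sup>+x. indicator (A i) (x, y) \<partial>gauss \<sigma>"]) (rule m2)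
    also have "\<dots> = (\<Prod>i\<in>I. emeasure (gauss \<sigma> \<Otimes>\<^sub>M gauss \<sigma>) (A i))"
    proof (rule prod.cong[OF refl])
      fix i assume i: "i \<in> I"
      have "(\<integral>\<^sup>+y. \<integral>\<^sup>+x. indicator (A i) (x, y) \<partial>gauss \<sigma> \<partial>gauss \<sigma>) =
          (\<integral>\<^sup>+z. indicator (A i) z \<partial>(gauss \<sigma> \<Otimes>\<^sub>M gauss \<sigma>))"
        by (rule gg.nn_integral_snd[where f = "indicator (A i)", simplified split_beta, simplified]) (use A i in auto)
      then show "(\<integral>\<^sup>+y. \<integral>\<^sup>+x. indicator (A i) (x, y) \<partial>gauss \<sigma> \<partial>gauss \<sigma>) =
          emeasure (gauss \<sigma> \<Otimes>\<^sub>M gauss \<sigma>) (A i)"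
        using A i by simp
    qed
    finally show "emeasure (distr ?G ?P ?T) (Pi\<^sub>E I A) = (\<Prod>i\<in>I. emeasure (gauss \<sigma> \<Otimes>\<^sub>M gauss \<sigma>) (A i))" .
  qed (use assms in auto)
qed

text \<open>Zip the vectors, rotate every pair, unzip. The arguments of \<open>F\<close> are
  restricted to \<open>I\<close> because the product space consists of extensional
  functions.\<close>

lemma gauss_vec_rotation:
  assumes "0 < \<sigma>" "finite I"
    and F[measurable]: "F \<in> borel_measurable (gauss_vec \<sigma> I \<Otimes>\<^sub>M gauss_vec \<sigma> I)"
  shows "(\<integral>\<^sup>+z. F (\<lambda>i\<in>I. (fst z i - snd z i) / sqrt 2, \<lambda>i\<in>I. (fst z i + snd z i) / sqrt 2)
        \<partial>(gauss_vec \<sigma> I \<Otimes>\<^sub>M gauss_vec \<sigma> I)) =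
      (\<integral>\<^sup>+z. F z \<partial>(gauss_vec \<sigma> I \<Otimes>\<^sub>M gauss_vec \<sigma> I))"
proof -
  let ?G = "gauss_vec \<sigma> I \<Otimes>\<^sub>M gauss_vec \<sigma> I"
  let ?P = "\<Pi>\<^sub>M i\<in>I. gauss \<sigma> \<Otimes>\<^sub>M gauss \<sigma>"
  let ?T = "\<lambda>z::('a \<Rightarrow> real) \<times> ('a \<Rightarrow> real). \<lambda>i\<in>I. (fst z i, snd z i)"
  let ?U = "\<lambda>w::'a \<Rightarrow> real \<times> real. (\<lambda>i\<in>I. fst (w i), \<lambda>i\<in>I. snd (w i))"
  let ?r = "\<lambda>(x::real, y). ((x - y) / sqrt 2, (x + y) / sqrt 2)"
  interpret g: prob_space "gauss \<sigma>" using assms(1) by (rule prob_space_gauss)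
  interpret gg: pair_prob_space "gauss \<sigma>" "gauss \<sigma>" ..
  have T[measurable]: "?T \<in> measurable ?G ?P"
    by (intro measurable_restrict) measurable
  have U[measurable]: "?U \<in> measurable ?P ?G"
    unfolding gauss_vec_def by (intro measurable_Pair measurable_restrict) measurable
  have r[measurable]: "?r \<in> measurable (gauss \<sigma> \<Otimes>\<^sub>M gauss \<sigma>) (gauss \<sigma> \<Otimes>\<^sub>M gauss \<sigma>)"
    by measurable
  have rc[measurable]: "compose I ?r \<in> measurable ?P ?P"
    unfolding compose_def by (intro measurable_restrict) measurable
  have UT: "?U (?T z) = z" if "z \<in> space ?G" for z
    using that by (cases z) (auto simp: space_pair_measure space_gauss_vec PiE_iff extensional_def fun_eq_iff)
  have P: "distr ?P ?P (compose I ?r) = ?P"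
    using distr_PiM_finite_prob_space'[of I "\<lambda>_. gauss \<sigma> \<Otimes>\<^sub>M gauss \<sigma>" "\<lambda>_. gauss \<sigma> \<Otimes>\<^sub>M gauss \<sigma>" ?r]
    by (simp add: assms gg.prob_space_axioms gauss_rotation)
  have "(\<integral>\<^sup>+z. F z \<partial>?G) = (\<integral>\<^sup>+z. F (?U (?T z)) \<partial>?G)"
    by (intro nn_integral_cong) (simp only: UT)
  also have "\<dots> = (\<integral>\<^sup>+w. F (?U w) \<partial>distr ?G ?P ?T)"
    by (subst nn_integral_distr) auto
  also have "\<dots> = (\<integral>\<^sup>+w. F (?U w) \<partial>distr ?P ?P (compose I ?r))"
    by (simp only: gauss_vec_pair[OF assms(1,2)] P)
  also have "\<dots> = (\<integral>\<^sup>+w. F (?U (compose I ?r w)) \<partial>?P)"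
    by (subst nn_integral_distr) auto
  also have "\<dots> = (\<integral>\<^sup>+w. F (?U (compose I ?r w)) \<partial>distr ?G ?P ?T)"
    by (simp only: gauss_vec_pair[OF assms(1,2)])
  also have "\<dots> = (\<integral>\<^sup>+z. F (?U (compose I ?r (?T z))) \<partial>?G)"
    by (subst nn_integral_distr) auto
  also have "\<dots> = (\<integral>\<^sup>+z. F (\<lambda>i\<in>I. (fst z i - snd z i) / sqrt 2, \<lambda>i\<in>I. (fst z i + snd z i) / sqrt 2) \<partial>?G)"
  proof (intro nn_integral_cong)
    fix z
    have "?U (compose I ?r (?T z)) =
        (\<lambda>i\<in>I. (fst z i - snd z i) / sqrt 2, \<lambda>i\<in>I. (fst z i + snd z i) / sqrt 2)"
      by (auto simp: compose_def fun_eq_iff)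
    then show "F (?U (compose I ?r (?T z))) =
        F (\<lambda>i\<in>I. (fst z i - snd z i) / sqrt 2, \<lambda>i\<in>I. (fst z i + snd z i) / sqrt 2)" by simp
  qed
  finally show ?thesis ..
qed

section \<open>Moments and maxima of Gaussian linear forms\<close>

lemma nn_integral_gauss_vec_exp:
  assumes "0 < \<sigma>" "finite I"
  shows "(\<integral>\<^sup>+g. ennreal (exp (\<Sum>x\<in>I. a x * g x)) \<partial>gauss_vec \<sigma> I) =
    ennreal (exp (\<sigma>\<^sup>2 * (\<Sum>x\<in>I. (a x)\<^sup>2) / 2))"
proof -
  interpret g: prob_space "gauss \<sigma>" using assms(1) by (rule prob_space_gauss)
  interpret S: product_sigma_finite "\<lambda>_::'a. gauss \<sigma>" ..
  have "(\<integral>\<^sup>+g. ennreal (exp (\<Sum>x\<in>I. a x * g x)) \<partial>gauss_vec \<sigma> I) =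
      (\<integral>\<^sup>+g. (\<Prod>x\<in>I. ennreal (exp (a x * g x))) \<partial>gauss_vec \<sigma> I)"
    by (simp add: exp_sum[OF assms(2)] prod_ennreal)
  also have "\<dots> = (\<Prod>x\<in>I. \<integral>\<^sup>+t. ennreal (exp (a x * t)) \<partial>gauss \<sigma>)"
    unfolding gauss_vec_def
    by (rule S.product_nn_integral_prod[OF assms(2), where f = "\<lambda>x t. ennreal (exp (a x * t))"]) simp
  also have "\<dots> = ennreal (\<Prod>x\<in>I. exp ((a x)\<^sup>2 * \<sigma>\<^sup>2 / 2))"
    by (simp add: nn_integral_gauss_exp[OF assms(1)] prod_ennreal)
  also have "(\<Prod>x\<in>I. exp ((a x)\<^sup>2 * \<sigma>\<^sup>2 / 2)) = exp (\<sigma>\<^sup>2 * (\<Sum>x\<in>I. (a x)\<^sup>2) / 2)"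
    by (simp add: exp_sum[OF assms(2), symmetric] sum_distrib_left sum_divide_distrib mult.commute)
  finally show ?thesis .
qed

lemma gauss_moments:
  assumes "0 < \<sigma>"
  shows "integrable (gauss \<sigma>) (\<lambda>t. t)" "(\<integral>t. t \<partial>gauss \<sigma>) = 0"
    "integrable (gauss \<sigma>) (\<lambda>t. t\<^sup>2)" "(\<integral>t. t\<^sup>2 \<partial>gauss \<sigma>) = \<sigma>\<^sup>2"
proof -
  have 1: "has_bochner_integral lborel (\<lambda>x. normal_density 0 \<sigma> x * x) 0"
    using normal_moment_nz_1[OF assms, of 0] .
  have 2: "has_bochner_integral lborel (\<lambda>x. normal_density 0 \<sigma> x * x\<^sup>2) (\<sigma>\<^sup>2)"
    using normal_moment_even[OF assms, of 0 1] assms by (simp add: field_simps power2_eq_square)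
  show "integrable (gauss \<sigma>) (\<lambda>t. t)" "(\<integral>t. t \<partial>gauss \<sigma>) = 0"
    "integrable (gauss \<sigma>) (\<lambda>t. t\<^sup>2)" "(\<integral>t. t\<^sup>2 \<partial>gauss \<sigma>) = \<sigma>\<^sup>2"
    using has_bochner_integral_integrable[of lborel] 1 2
    by (auto simp: gauss_def integrable_density integral_density has_bochner_integral_iff)
qed

lemma gauss_vec_product_moment:
  assumes "0 < \<sigma>" "finite I" "x \<in> I" "y \<in> I"
  shows "integrable (gauss_vec \<sigma> I) (\<lambda>g. g x * g y)"
    and "(\<integral>g. g x * g y \<partial>gauss_vec \<sigma> I) = (if x = y then \<sigma>\<^sup>2 else 0)"
proof -
  interpret g: prob_space "gauss \<sigma>" using assms(1) by (rule prob_space_gauss)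
  interpret S: product_sigma_finite "\<lambda>_::'a. gauss \<sigma>" ..
  \<comment> \<open>Written as a product over all coordinates, with factor 1 away from
    \<open>x\<close> and \<open>y\<close>, the moment factorises; the diagonal case gives t * t in a
    single coordinate.\<close>
  define f where "f = (\<lambda>i (t::real). (if i = x then t else 1) * (if i = y then t else 1))"
  have eq: "g x * g y = (\<Prod>i\<in>I. f i (g i))" for g
    using assms by (simp add: f_def prod.distrib prod.delta)
  have int: "integrable (gauss \<sigma>) (f i)" for i
    using gauss_moments[OF assms(1)] by (cases "i = x"; cases "i = y") (auto simp: f_def power2_eq_square)
  show "integrable (gauss_vec \<sigma> I) (\<lambda>g. g x * g y)"
    unfolding eq gauss_vec_def by (rule S.product_integrable_prod[OF assms(2) int])
  have "(\<integral>g. g x * g y \<partial>gauss_vec \<sigma> I) = (\<Prod>i\<in>I. \<integral>t. f i t \<partial>gauss \<sigma>)"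
    unfolding eq gauss_vec_def by (rule S.product_integral_prod[OF assms(2) int])
  also have "\<dots> = (if x = y then \<sigma>\<^sup>2 else 0)"
  proof (cases "x = y")
    case True
    have "(\<integral>t. f i t \<partial>gauss \<sigma>) = (if i = x then \<sigma>\<^sup>2 else 1)" for i
      using gauss_moments[OF assms(1)] g.prob_space True by (auto simp: f_def power2_eq_square)
    then show ?thesis using assms True by (simp add: prod.delta)
  next
    case False
    then have "(\<integral>t. f x t \<partial>gauss \<sigma>) = 0"
      using gauss_moments[OF assms(1)] by (simp add: f_def)
    then show ?thesis using assms False by (auto intro!: prod_zero)
  qed
  finally show "(\<integral>g. g x * g y \<partial>gauss_vec \<sigma> I) = (if x = y then \<sigma>\<^sup>2 else 0)" .
qed

lemma gauss_vec_square:
  assumes "0 < \<sigma>" "finite I"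
  shows "integrable (gauss_vec \<sigma> I) (\<lambda>g. (\<Sum>x\<in>I. a x * g x)\<^sup>2)"
    and "(\<integral>g. (\<Sum>x\<in>I. a x * g x)\<^sup>2 \<partial>gauss_vec \<sigma> I) = \<sigma>\<^sup>2 * (\<Sum>x\<in>I. (a x)\<^sup>2)"
proof -
  have eq: "(\<Sum>x\<in>I. a x * g x)\<^sup>2 = (\<Sum>x\<in>I. \<Sum>y\<in>I. a x * a y * (g x * g y))" for g
    by (simp add: power2_eq_square sum_product mult_ac)
  note M = gauss_vec_product_moment[OF assms]
  show "integrable (gauss_vec \<sigma> I) (\<lambda>g. (\<Sum>x\<in>I. a x * g x)\<^sup>2)"
    unfolding eq by (intro Bochner_Integration.integrable_sum integrable_mult_right M)
  have "(\<integral>g. (\<Sum>x\<in>I. a x * g x)\<^sup>2 \<partial>gauss_vec \<sigma> I) =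
      (\<Sum>x\<in>I. \<Sum>y\<in>I. a x * a y * (\<integral>g. g x * g y \<partial>gauss_vec \<sigma> I))"
    unfolding eq
    by (subst Bochner_Integration.integral_sum;
        (intro Bochner_Integration.integrable_sum integrable_mult_right M)?)
       (auto intro!: sum.cong Bochner_Integration.integral_sum[THEN trans] integrable_mult_right M)
  also have "\<dots> = (\<Sum>x\<in>I. \<Sum>y\<in>I. if x = y then a x * a y * \<sigma>\<^sup>2 else 0)"
    by (intro sum.cong refl) (simp add: M)
  also have "\<dots> = \<sigma>\<^sup>2 * (\<Sum>x\<in>I. (a x)\<^sup>2)"
    using assms(2) by (simp add: sum.delta sum_distrib_left power2_eq_square mult_ac)
  finally show "(\<integral>g. (\<Sum>x\<in>I. a x * g x)\<^sup>2 \<partial>gauss_vec \<sigma> I) = \<sigma>\<^sup>2 * (\<Sum>x\<in>I. (a x)\<^sup>2)" .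
qed

lemma gauss_vec_linear_measurable:
  "(\<lambda>g. \<Sum>x\<in>I. a x * g x) \<in> borel_measurable (gauss_vec \<sigma> I)"
  by (intro borel_measurable_sum borel_measurable_times borel_measurable_const gauss_vec_component)

text \<open>The maximum is dominated by a constant plus a sum of exponentials over \<open>J\<close>
  and both signs. The forms may thus be arbitrarily dependent, and only the logarithm of their
  number enters.\<close>

lemma gauss_vec_maximal:
  assumes "0 < \<sigma>" "finite I" "finite J" "J \<noteq> {}" "0 \<le> \<rho>" "1 \<le> B"
    and card: "ln (2 * real (card J)) \<le> B"
    and a: "\<And>j. j \<in> J \<Longrightarrow> (\<Sum>x\<in>I. (a j x)\<^sup>2) \<le> \<rho>\<^sup>2"
  shows "(\<integral>\<^sup>+g. ennreal (Max ((\<lambda>j. \<bar>\<Sum>x\<in>I. a j x * g x\<bar>) ` J)) \<partial>gauss_vec \<sigma> I) \<le>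
    ennreal (\<sigma> * \<rho> * sqrt (2 * B))"
proof (cases "\<rho> = 0")
  case True
  have "a j x = 0" if "j \<in> J" "x \<in> I" for j x
  proof -
    have "(\<Sum>x\<in>I. (a j x)\<^sup>2) = 0"
      using a[OF that(1)] True by (simp add: sum_nonneg order_antisym)
    then show ?thesis using that assms(2) by (simp add: sum_nonneg_eq_0_iff)
  qed
  then have "(\<lambda>j. \<bar>\<Sum>x\<in>I. a j x * g x\<bar>) ` J = {0}" for g
    using \<open>J \<noteq> {}\<close> by (auto simp: image_iff)
  then show ?thesis by simp
next
  case False
  with \<open>0 \<le> \<rho>\<close> have "0 < \<rho>" by simp
  interpret prob_space "gauss_vec \<sigma> I" using assms(1) by (rule prob_space_gauss_vec)
  \<comment> \<open>The exponential parameter for which \<open>l\<^sup>2 \<sigma>\<^sup>2 \<rho>\<^sup>2 / 2 = B\<close>; the bound \<open>pt\<close> is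
    \<open>1 + y \<le> exp y\<close> at \<open>y = l \<bar>L\<bar> - 2 B\<close> and replaces Jensen's inequality.\<close>
  define l where "l = sqrt (2 * B) / (\<sigma> * \<rho>)"
  have l: "0 < l" using assms \<open>0 < \<rho>\<close> by (simp add: l_def)
  define c where "c = 1 / (l * exp (2 * B))"
  have c: "0 \<le> c" using l by (simp add: c_def)
  define L where "L = (\<lambda>j g. \<Sum>x\<in>I. a j x * g x)"
  have Lm: "L j \<in> borel_measurable (gauss_vec \<sigma> I)" for j
    unfolding L_def by (rule gauss_vec_linear_measurable)
  define e where "e = (\<lambda>j g. ennreal c * (ennreal (exp (l * L j g)) + ennreal (exp (- l * L j g))))"
  have em: "e j \<in> borel_measurable (gauss_vec \<sigma> I)" for j
    using Lm[of j] by (simp add: e_def)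
  have pt: "\<bar>L j g\<bar> \<le> (2 * B - 1) / l + c * (exp (l * L j g) + exp (- l * L j g))" for j g
  proof -
    have "1 + (l * \<bar>L j g\<bar> - 2 * B) \<le> exp (l * \<bar>L j g\<bar> - 2 * B)" by (rule exp_ge_add_one_self)
    also have "\<dots> = exp (l * \<bar>L j g\<bar>) / exp (2 * B)" by (simp add: exp_diff)
    also have "\<dots> \<le> (exp (l * L j g) + exp (- l * L j g)) / exp (2 * B)"
      by (intro divide_right_mono) (auto simp: abs_if)
    finally have "l * \<bar>L j g\<bar> \<le> 2 * B - 1 + (exp (l * L j g) + exp (- l * L j g)) / exp (2 * B)"
      by simp
    then have "\<bar>L j g\<bar> \<le> (2 * B - 1 + (exp (l * L j g) + exp (- l * L j g)) / exp (2 * B)) / l"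
      using l by (simp add: pos_le_divide_eq mult.commute)
    then show ?thesis by (simp add: c_def add_divide_distrib mult.commute)
  qed
  have E: "(\<integral>\<^sup>+g. ennreal (exp (s * L j g)) \<partial>gauss_vec \<sigma> I) \<le> ennreal (exp B)"
    if "j \<in> J" "s\<^sup>2 = l\<^sup>2" for j s
  proof -
    have sL: "s * L j g = (\<Sum>x\<in>I. (s * a j x) * g x)" for g
      by (simp add: L_def sum_distrib_left mult.assoc)
    have "(\<integral>\<^sup>+g. ennreal (exp (s * L j g)) \<partial>gauss_vec \<sigma> I) =
        ennreal (exp (\<sigma>\<^sup>2 * (\<Sum>x\<in>I. (s * a j x)\<^sup>2) / 2))"
      unfolding sL
      by (rule nn_integral_gauss_vec_exp[OF assms(1,2)])
    also have "\<sigma>\<^sup>2 * (\<Sum>x\<in>I. (s * a j x)\<^sup>2) / 2 = \<sigma>\<^sup>2 * l\<^sup>2 * (\<Sum>x\<in>I. (a j x)\<^sup>2) / 2"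
      by (simp add: power_mult_distrib sum_distrib_left[symmetric] that mult_ac)
    also have "\<dots> \<le> \<sigma>\<^sup>2 * l\<^sup>2 * \<rho>\<^sup>2 / 2"
      using a[OF that(1)] by (intro divide_right_mono mult_left_mono) auto
    also have "\<dots> = B"
      using assms \<open>0 < \<rho>\<close> by (simp add: l_def power_divide power_mult_distrib)
    finally show ?thesis by (simp add: ennreal_leI)
  qed
  have "(\<integral>\<^sup>+g. ennreal (Max ((\<lambda>j. \<bar>L j g\<bar>) ` J)) \<partial>gauss_vec \<sigma> I) \<le>
      (\<integral>\<^sup>+g. ennreal ((2 * B - 1) / l) + (\<Sum>j\<in>J. e j g) \<partial>gauss_vec \<sigma> I)"
  proof (rule nn_integral_mono)
    fix g
    have "Max ((\<lambda>j. \<bar>L j g\<bar>) ` J) \<in> (\<lambda>j. \<bar>L j g\<bar>) ` J"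
      using assms by (intro Max_in) auto
    then obtain j where j: "j \<in> J" "Max ((\<lambda>j. \<bar>L j g\<bar>) ` J) = \<bar>L j g\<bar>" by auto
    have "ennreal \<bar>L j g\<bar> \<le> ennreal ((2 * B - 1) / l + c * (exp (l * L j g) + exp (- l * L j g)))"
      by (rule ennreal_leI[OF pt])
    also have "\<dots> = ennreal ((2 * B - 1) / l) + e j g"
      using l c \<open>1 \<le> B\<close> by (simp add: e_def ennreal_mult ennreal_plus)
    also have "\<dots> \<le> ennreal ((2 * B - 1) / l) + (\<Sum>j\<in>J. e j g)"
      using j(1) assms(3) by (intro add_left_mono member_le_sum) auto
    finally show "ennreal (Max ((\<lambda>j. \<bar>L j g\<bar>) ` J)) \<le> ennreal ((2 * B - 1) / l) + (\<Sum>j\<in>J. e j g)"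
      by (simp add: j)
  qed
  also have "\<dots> = ennreal ((2 * B - 1) / l) + (\<Sum>j\<in>J. \<integral>\<^sup>+g. e j g \<partial>gauss_vec \<sigma> I)"
    using em by (simp add: nn_integral_add nn_integral_sum emeasure_space_1)
  also have "\<dots> \<le> ennreal ((2 * B - 1) / l) + (\<Sum>j\<in>J. ennreal (c * (exp B + exp B)))"
  proof (intro add_left_mono sum_mono)
    fix j assume j: "j \<in> J"
    have "(\<integral>\<^sup>+g. e j g \<partial>gauss_vec \<sigma> I) = ennreal c *
        ((\<integral>\<^sup>+g. ennreal (exp (l * L j g)) \<partial>gauss_vec \<sigma> I) +
         (\<integral>\<^sup>+g. ennreal (exp (- l * L j g)) \<partial>gauss_vec \<sigma> I))"
      unfolding e_def using Lm[of j] by (simp add: nn_integral_cmult nn_integral_add)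
    also have "\<dots> \<le> ennreal c * (ennreal (exp B) + ennreal (exp B))"
      by (intro mult_left_mono add_mono E j) auto
    also have "\<dots> = ennreal (c * (exp B + exp B))"
      using c by (simp only: ennreal_mult ennreal_plus exp_ge_zero add_nonneg_nonneg)
    finally show "(\<integral>\<^sup>+g. e j g \<partial>gauss_vec \<sigma> I) \<le> ennreal (c * (exp B + exp B))" .
  qed
  also have "\<dots> = ennreal ((2 * B - 1) / l + real (card J) * (c * (exp B + exp B)))"
    using l c \<open>1 \<le> B\<close> by (simp add: ennreal_plus ennreal_mult ennreal_of_nat_eq_real_of_nat)
  also have "\<dots> \<le> ennreal (\<sigma> * \<rho> * sqrt (2 * B))"
  proof (rule ennreal_leI)
    have "0 < card J" using assms by (simp add: card_gt_0_iff)
    then have "2 * real (card J) = exp (ln (2 * real (card J)))" by simp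
    also have "\<dots> \<le> exp B" using card by simp
    finally have "2 * real (card J) \<le> exp B" .
    then have "2 * real (card J) * exp B \<le> exp B * exp B" by (intro mult_right_mono) auto
    also have "\<dots> = exp (2 * B)" by (simp add: exp_add[symmetric])
    finally have "2 * real (card J) * exp B / exp (2 * B) \<le> 1" by simp
    \<comment> \<open>The sum of exponentials costs at most 1 / l, which is exactly the -1 in (2 * B
      - 1) / l.\<close>
    then have "real (card J) * (c * (exp B + exp B)) \<le> 1 / l"
      using l by (simp add: c_def field_simps)
    then have "(2 * B - 1) / l + real (card J) * (c * (exp B + exp B)) \<le> 2 * B / l"
      by (simp add: diff_divide_distrib)
    also have "2 * B / l = \<sigma> * \<rho> * sqrt (2 * B)"
      using assms \<open>0 < \<rho>\<close> real_sqrt_mult_self[of "2 * B"] by (simp add: l_def field_simps)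
    finally show "(2 * B - 1) / l + real (card J) * (c * (exp B + exp B)) \<le> \<sigma> * \<rho> * sqrt (2 * B)" .
  qed
  finally show ?thesis by (simp add: L_def)
qed

section \<open>Maurey's empirical method\<close>

text \<open>Averaged over a variable z of mean zero, the linear term vanishes and E exp z <= E exp
  (z^2) remains, without any bound on z.\<close>

lemma exp_le_add_exp_square:
  fixes x :: real
  shows "exp x \<le> x + exp (x\<^sup>2)"
proof -
  consider "x > 1" | "0 \<le> x" "x \<le> 1" | "x < 0" by linarith
  then show ?thesis
  proof cases
    case 1
    then have "x * 1 \<le> x * x" by (intro mult_left_mono) auto
    then have "exp x \<le> exp (x\<^sup>2)" by (simp add: power2_eq_square)
    with 1 show ?thesis by linarith
  next
    case 2
    then have "exp x \<le> 1 + x + x\<^sup>2" by (rule exp_bound)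
    with exp_ge_add_one_self[of "x\<^sup>2"] show ?thesis by linarith
  next
    case 3
    define y where "y = - x"
    have y: "0 < y" using 3 by (simp add: y_def)
    \<comment> \<open>The product equals 1 + y^3.\<close>
    have "1 \<le> (1 + y) * (1 - y + y\<^sup>2)" using y by (simp add: algebra_simps power2_eq_square power3_eq_cube)
    also have "\<dots> \<le> exp y * (1 - y + y\<^sup>2)"
    proof (rule mult_right_mono)
      have "0 \<le> (y - 1/2)\<^sup>2 + 3/4" by simp
      then show "0 \<le> 1 - y + y\<^sup>2" by (simp add: power2_eq_square algebra_simps)
    qed (use exp_ge_add_one_self[of y] in simp)
    finally have "1 / exp y \<le> 1 - y + y\<^sup>2" by (simp add: pos_divide_le_eq mult.commute)
    moreover have "1 / exp y = exp x" by (simp add: y_def exp_minus inverse_eq_divide)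
    ultimately have "exp x \<le> 1 - y + y\<^sup>2" by (simp only:)
    then have "exp x \<le> 1 + x + x\<^sup>2" by (simp add: y_def)
    with exp_ge_add_one_self[of "x\<^sup>2"] show ?thesis by linarith
  qed
qed

text \<open>The first moment method: it replaces sampling from the weights by the choice of one good
  index.\<close>

lemma weighted_mean_attained:
  fixes w F :: "'k \<Rightarrow> real"
  assumes "finite P" "\<And>k. k \<in> P \<Longrightarrow> 0 \<le> w k" "sum w P = 1" "(\<Sum>k\<in>P. w k * F k) \<le> C"
  shows "\<exists>k\<in>P. F k \<le> C"
proof (rule ccontr)
  assume "\<not> ?thesis"
  then have less: "k \<in> P \<Longrightarrow> C < F k" for k by auto
  have "(\<Sum>k\<in>P. w k * (F k - C)) = (\<Sum>k\<in>P. w k * F k) - C"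
    by (simp add: right_diff_distrib sum_subtractf sum_distrib_right[symmetric] assms(3))
  then have "(\<Sum>k\<in>P. w k * (F k - C)) \<le> 0" using assms(4) by simp
  moreover have nn: "k \<in> P \<Longrightarrow> 0 \<le> w k * (F k - C)" for k
    using assms(2) less by (simp add: less_imp_le)
  ultimately have "(\<Sum>k\<in>P. w k * (F k - C)) = 0" by (simp add: sum_nonneg order_antisym)
  then have "\<forall>k\<in>P. w k * (F k - C) = 0" using sum_nonneg_eq_0_iff[OF assms(1) nn] by simp
  then have "\<forall>k\<in>P. w k = 0" using less by fastforce
  then show False using assms(3) by simp
qed

lemma sum_cmod_square_add:
  fixes S Y :: "'i \<Rightarrow> complex"
  shows "(\<Sum>i\<in>I. (cmod (S i + Y i))\<^sup>2) =
    (\<Sum>i\<in>I. (cmod (S i))\<^sup>2) + 2 * (\<Sum>i\<in>I. S i \<bullet> Y i) + (\<Sum>i\<in>I. (cmod (Y i))\<^sup>2)"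
proof -
  have "(cmod (S i + Y i))\<^sup>2 = (cmod (S i))\<^sup>2 + 2 * (S i \<bullet> Y i) + (cmod (Y i))\<^sup>2" for i
    by (simp add: dot_norm field_simps)
  then show ?thesis by (simp add: sum.distrib sum_distrib_left)
qed

lemma inner_sum_square_le:
  fixes S Y :: "'i \<Rightarrow> complex"
  shows "(\<Sum>i\<in>I. S i \<bullet> Y i)\<^sup>2 \<le> (\<Sum>i\<in>I. (cmod (S i))\<^sup>2) * (\<Sum>i\<in>I. (cmod (Y i))\<^sup>2)"
proof -
  have "\<bar>\<Sum>i\<in>I. S i \<bullet> Y i\<bar> \<le> (\<Sum>i\<in>I. cmod (S i) * cmod (Y i))"
    by (rule sum_abs[THEN order_trans], rule sum_mono) (rule Cauchy_Schwarz_ineq2)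
  then have "\<bar>\<Sum>i\<in>I. S i \<bullet> Y i\<bar>\<^sup>2 \<le> (\<Sum>i\<in>I. cmod (S i) * cmod (Y i))\<^sup>2"
    by (rule power_mono) simp
  also have "\<dots> \<le> (\<Sum>i\<in>I. (cmod (S i))\<^sup>2) * (\<Sum>i\<in>I. (cmod (Y i))\<^sup>2)"
    by (rule Cauchy_Schwarz_ineq_sum)
  finally show ?thesis by simp
qed

text \<open>Expanding the square leaves a cross term \<open>z\<close> of mean zero whose square is
  at most \<open>16 * l\<^sup>2 * q\<close> by Cauchy-Schwarz. Averaging exp z <= z + exp (z^2)
  raises the exponent from l to l + 16 l^2, and the energy 4 of the new summand gives the factor exp
  (4 l).\<close>

lemma exp_potential_step:
  fixes Y :: "'k \<Rightarrow> 'w \<Rightarrow> 'i \<Rightarrow> complex" and S :: "'w \<Rightarrow> 'i \<Rightarrow> complex"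
  assumes P: "finite P" "\<And>k. k \<in> P \<Longrightarrow> 0 \<le> w k" "sum w P = 1"
    and mean: "\<And>x i. x \<in> W \<Longrightarrow> i \<in> I \<Longrightarrow> (\<Sum>k\<in>P. w k *\<^sub>R Y k x i) = 0"
    and bound: "\<And>k x. k \<in> P \<Longrightarrow> x \<in> W \<Longrightarrow> (\<Sum>i\<in>I. (cmod (Y k x i))\<^sup>2) \<le> 4"
    and l: "0 \<le> l" "l + 16 * l\<^sup>2 \<le> l'"
  shows "\<exists>k\<in>P. (\<Sum>x\<in>W. exp (l * (\<Sum>i\<in>I. (cmod (S x i + Y k x i))\<^sup>2))) \<le>
    exp (4 * l) * (\<Sum>x\<in>W. exp (l' * (\<Sum>i\<in>I. (cmod (S x i))\<^sup>2)))"
proof (rule weighted_mean_attained[OF P])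
  define q where "q = (\<lambda>x. \<Sum>i\<in>I. (cmod (S x i))\<^sup>2)"
  define z where "z = (\<lambda>k x. 2 * l * (\<Sum>i\<in>I. S x i \<bullet> Y k x i))"
  have q: "0 \<le> q x" for x by (simp add: q_def sum_nonneg)
  have zsum: "(\<Sum>k\<in>P. w k * z k x) = 0" if x: "x \<in> W" for x
  proof -
    have "(\<Sum>k\<in>P. w k * z k x) = 2 * l * (\<Sum>i\<in>I. \<Sum>k\<in>P. w k * (S x i \<bullet> Y k x i))"
      unfolding z_def by (subst sum.swap) (simp add: sum_distrib_left mult_ac)
    also have "\<dots> = 2 * l * (\<Sum>i\<in>I. S x i \<bullet> (\<Sum>k\<in>P. w k *\<^sub>R Y k x i))"
      by (simp add: inner_sum_right)
    also have "\<dots> = 0" using mean[OF x] by simp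
    finally show ?thesis .
  qed
  have step: "exp (l * (\<Sum>i\<in>I. (cmod (S x i + Y k x i))\<^sup>2)) \<le>
      exp (l * q x + 4 * l) * (z k x + exp (16 * l\<^sup>2 * q x))" if "k \<in> P" "x \<in> W" for k x
  proof -
    have "(z k x)\<^sup>2 = 4 * l\<^sup>2 * (\<Sum>i\<in>I. S x i \<bullet> Y k x i)\<^sup>2"
      by (simp add: z_def power_mult_distrib)
    also have "\<dots> \<le> 4 * l\<^sup>2 * (q x * 4)"
    proof (rule mult_left_mono)
      have "(\<Sum>i\<in>I. S x i \<bullet> Y k x i)\<^sup>2 \<le> q x * (\<Sum>i\<in>I. (cmod (Y k x i))\<^sup>2)"
        unfolding q_def by (rule inner_sum_square_le)
      also have "\<dots> \<le> q x * 4" by (intro mult_left_mono bound that q)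
      finally show "(\<Sum>i\<in>I. S x i \<bullet> Y k x i)\<^sup>2 \<le> q x * 4" .
    qed simp
    finally have z2: "(z k x)\<^sup>2 \<le> 16 * l\<^sup>2 * q x" by simp
    have "l * (\<Sum>i\<in>I. (cmod (S x i + Y k x i))\<^sup>2) =
        l * q x + z k x + l * (\<Sum>i\<in>I. (cmod (Y k x i))\<^sup>2)"
      unfolding sum_cmod_square_add q_def z_def by (simp add: algebra_simps)
    also have "\<dots> \<le> l * q x + z k x + l * 4"
      using bound[OF that] l by (simp add: mult_left_mono)
    finally have "exp (l * (\<Sum>i\<in>I. (cmod (S x i + Y k x i))\<^sup>2)) \<le> exp (l * q x + 4 * l + z k x)"
      by simp
    also have "\<dots> = exp (l * q x + 4 * l) * exp (z k x)" by (rule exp_add)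
    also have "\<dots> \<le> exp (l * q x + 4 * l) * (z k x + exp (16 * l\<^sup>2 * q x))"
      using exp_le_add_exp_square[of "z k x"] z2
      by (intro mult_left_mono) (auto intro: order_trans)
    finally show ?thesis .
  qed
  have "(\<Sum>k\<in>P. w k * (\<Sum>x\<in>W. exp (l * (\<Sum>i\<in>I. (cmod (S x i + Y k x i))\<^sup>2)))) \<le>
      (\<Sum>k\<in>P. w k * (\<Sum>x\<in>W. exp (l * q x + 4 * l) * (z k x + exp (16 * l\<^sup>2 * q x))))"
    by (intro sum_mono mult_left_mono step P(2))
  also have "\<dots> = (\<Sum>x\<in>W. exp (l * q x + 4 * l) *
      ((\<Sum>k\<in>P. w k * z k x) + (\<Sum>k\<in>P. w k) * exp (16 * l\<^sup>2 * q x)))"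
    by (simp add: sum_distrib_left sum_distrib_right sum.distrib[symmetric] distrib_left sum.swap[of _ P] mult_ac)
  also have "\<dots> = (\<Sum>x\<in>W. exp (l * q x + 4 * l) * exp (16 * l\<^sup>2 * q x))"
    by (intro sum.cong refl) (simp add: zsum P(3))
  also have "\<dots> \<le> (\<Sum>x\<in>W. exp (4 * l) * exp (l' * q x))"
  proof (intro sum_mono)
    fix x
    have "(l + 16 * l\<^sup>2) * q x \<le> l' * q x" by (intro mult_right_mono l q)
    then show "exp (l * q x + 4 * l) * exp (16 * l\<^sup>2 * q x) \<le> exp (4 * l) * exp (l' * q x)"
      by (simp add: exp_add[symmetric] algebra_simps)
  qed
  finally show "(\<Sum>k\<in>P. w k * (\<Sum>x\<in>W. exp (l * (\<Sum>i\<in>I. (cmod (S x i + Y k x i))\<^sup>2)))) \<le>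
      exp (4 * l) * (\<Sum>x\<in>W. exp (l' * (\<Sum>i\<in>I. (cmod (S x i))\<^sup>2)))"
    by (simp add: q_def sum_distrib_left)
qed

text \<open>The potential starts at \<open>card W\<close> for the empty list and grows by a bounded
  factor in each of the K greedy steps. A single term of the final potential is at most the whole,
  and taking logarithms gives the bound for every \<open>x\<close> in \<open>W\<close>.\<close>

lemma maurey_centered:
  fixes Y :: "'k \<Rightarrow> 'w \<Rightarrow> 'i \<Rightarrow> complex"
  assumes P: "finite P" "\<And>k. k \<in> P \<Longrightarrow> 0 \<le> w k" "sum w P = 1"
    and mean: "\<And>x i. x \<in> W \<Longrightarrow> i \<in> I \<Longrightarrow> (\<Sum>k\<in>P. w k *\<^sub>R Y k x i) = 0"
    and bound: "\<And>k x. k \<in> P \<Longrightarrow> x \<in> W \<Longrightarrow> (\<Sum>i\<in>I. (cmod (Y k x i))\<^sup>2) \<le> 4"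
    and W: "finite W" and K: "0 < K"
  shows "\<exists>ks. length ks = K \<and> set ks \<subseteq> P \<and>
    (\<forall>x\<in>W. (\<Sum>i\<in>I. (cmod (\<Sum>k\<leftarrow>ks. Y k x i))\<^sup>2) \<le> 64 * real K * (ln (real (card W)) + 1))"
proof -
  \<comment> \<open>The exponents fall from \<open>1 / (32 K)\<close> to \<open>1 / (64 K)\<close> in steps of \<open>1 / (64 K\<^sup>2)\<close>, which is
    just enough to absorb the loss \<open>16 l\<^sup>2\<close> of one step.\<close>
  define l where "l = (\<lambda>j::nat. (2 - real j / real K) / (64 * real K))"
  \<comment> \<open>Four times the largest exponent \<open>l 0\<close>. Over all K steps the growth
    factor is only exp (1 / 8).\<close>
  define c where "c = 1 / (8 * real K)"
  have l0: "0 \<le> l j" "4 * l j \<le> c" if "j \<le> K" for j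
    using that K by (auto simp: l_def c_def field_simps)
  have lstep: "l (Suc j) + 16 * (l (Suc j))\<^sup>2 \<le> l j" if "Suc j \<le> K" for j
  proof -
    have "l (Suc j) \<le> 2 / (64 * real K)"
      unfolding l_def by (rule divide_right_mono) auto
    then have "(l (Suc j))\<^sup>2 \<le> (2 / (64 * real K))\<^sup>2"
      using l0[OF that] by (intro power_mono) auto
    moreover have "16 * (2 / (64 * real K))\<^sup>2 = l j - l (Suc j)"
      using K by (simp add: l_def power2_eq_square field_simps)
    ultimately show ?thesis by linarith
  qed
  have "\<exists>ks. length ks = j \<and> set ks \<subseteq> P \<and>
      (\<Sum>x\<in>W. exp (l j * (\<Sum>i\<in>I. (cmod (\<Sum>k\<leftarrow>ks. Y k x i))\<^sup>2))) \<le> exp (real j * c) * real (card W)"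
    if "j \<le> K" for j
    using that
  proof (induction j)
    case 0
    show ?case by (intro exI[of _ "[]"]) simp
  next
    case (Suc j)
    then obtain ks where ks: "length ks = j" "set ks \<subseteq> P"
      "(\<Sum>x\<in>W. exp (l j * (\<Sum>i\<in>I. (cmod (\<Sum>k\<leftarrow>ks. Y k x i))\<^sup>2))) \<le> exp (real j * c) * real (card W)"
      by auto
    obtain k where k: "k \<in> P"
      "(\<Sum>x\<in>W. exp (l (Suc j) * (\<Sum>i\<in>I. (cmod ((\<Sum>k\<leftarrow>ks. Y k x i) + Y k x i))\<^sup>2))) \<le>
        exp (4 * l (Suc j)) * (\<Sum>x\<in>W. exp (l j * (\<Sum>i\<in>I. (cmod (\<Sum>k\<leftarrow>ks. Y k x i))\<^sup>2)))"
      using bexE[OF exp_potential_step[where S = "\<lambda>x i. \<Sum>k\<leftarrow>ks. Y k x i", OF P mean bound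
          l0(1)[OF Suc.prems] lstep[OF Suc.prems]]] .
    note k(2)
    also have "exp (4 * l (Suc j)) * (\<Sum>x\<in>W. exp (l j * (\<Sum>i\<in>I. (cmod (\<Sum>k\<leftarrow>ks. Y k x i))\<^sup>2))) \<le>
        exp c * (exp (real j * c) * real (card W))"
      using ks(3) l0(2)[OF Suc.prems] by (intro mult_mono) (auto intro: sum_nonneg)
    also have "\<dots> = exp (real (Suc j) * c) * real (card W)"
      by (simp add: exp_add distrib_right)
    finally show ?case using ks k(1)
      by (intro exI[of _ "k # ks"]) (simp add: add.commute)
  qed
  from this[of K] obtain ks where ks: "length ks = K" "set ks \<subseteq> P"
    "(\<Sum>x\<in>W. exp (l K * (\<Sum>i\<in>I. (cmod (\<Sum>k\<leftarrow>ks. Y k x i))\<^sup>2))) \<le> exp (real K * c) * real (card W)"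
    by auto
  have "(\<Sum>i\<in>I. (cmod (\<Sum>k\<leftarrow>ks. Y k x i))\<^sup>2) \<le> 64 * real K * (ln (real (card W)) + 1)" if x: "x \<in> W" for x
  proof -
    let ?q = "\<Sum>i\<in>I. (cmod (\<Sum>k\<leftarrow>ks. Y k x i))\<^sup>2"
    have cW: "0 < real (card W)" using W x by (auto simp: card_gt_0_iff)
    have "exp (l K * ?q) \<le> (\<Sum>x\<in>W. exp (l K * (\<Sum>i\<in>I. (cmod (\<Sum>k\<leftarrow>ks. Y k x i))\<^sup>2)))"
      by (rule member_le_sum[OF x]) (auto simp: W)
    also have "\<dots> \<le> exp 1 * real (card W)"
      using K by (intro order_trans[OF ks(3)] mult_right_mono) (auto simp: c_def)
    also have "\<dots> = exp (1 + ln (real (card W)))" using cW by (simp add: exp_add)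
    finally have "l K * ?q \<le> 1 + ln (real (card W))" by simp
    then show ?thesis using K by (simp add: l_def field_simps)
  qed
  with ks show ?thesis by blast
qed

text \<open>Maurey's empirical method, derandomised: the terms are picked greedily so as to keep an
  exponential potential small, so all the seminorms indexed by \<open>W\<close> are controlled at once.\<close>

lemma maurey:
  fixes X :: "'k \<Rightarrow> 'w \<Rightarrow> 'i \<Rightarrow> complex"
  assumes P: "finite P" "\<And>k. k \<in> P \<Longrightarrow> 0 \<le> w k" "sum w P = 1"
    and bound: "\<And>k x. k \<in> P \<Longrightarrow> x \<in> W \<Longrightarrow> (\<Sum>i\<in>I. (cmod (X k x i))\<^sup>2) \<le> 1"
    and W: "finite W" and K: "0 < K"
  shows "\<exists>ks. length ks = K \<and> set ks \<subseteq> P \<and>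
    (\<forall>x\<in>W. (\<Sum>i\<in>I. (cmod ((\<Sum>k\<leftarrow>ks. X k x i) - real K *\<^sub>R (\<Sum>k\<in>P. w k *\<^sub>R X k x i)))\<^sup>2)
      \<le> 64 * real K * (ln (real (card W)) + 1))"
proof -
  define mu where "mu = (\<lambda>x i. \<Sum>k\<in>P. w k *\<^sub>R X k x i)"
  \<comment> \<open>By convexity the mean obeys the same unit bound, so a centred summand has energy
    at most 2 + 2 = 4.\<close>
  have mu: "(\<Sum>i\<in>I. (cmod (mu x i))\<^sup>2) \<le> 1" if x: "x \<in> W" for x
  proof -
    have "(cmod (mu x i))\<^sup>2 \<le> (\<Sum>k\<in>P. w k * (cmod (X k x i))\<^sup>2)" for i
    proof -
      have "cmod (mu x i) \<le> (\<Sum>k\<in>P. sqrt (w k) * (sqrt (w k) * cmod (X k x i)))"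
        unfolding mu_def using P(2) by (intro norm_sum[THEN order_trans] sum_mono) (auto simp: mult.assoc[symmetric])
      then have "(cmod (mu x i))\<^sup>2 \<le> (\<Sum>k\<in>P. sqrt (w k) * (sqrt (w k) * cmod (X k x i)))\<^sup>2"
        by (rule power_mono) simp
      also have "\<dots> \<le> (\<Sum>k\<in>P. (sqrt (w k))\<^sup>2) * (\<Sum>k\<in>P. (sqrt (w k) * cmod (X k x i))\<^sup>2)"
        by (rule Cauchy_Schwarz_ineq_sum)
      also have "\<dots> = (\<Sum>k\<in>P. w k * (cmod (X k x i))\<^sup>2)"
        using P(2,3) by (simp add: power_mult_distrib)
      finally show ?thesis .
    qed
    then have "(\<Sum>i\<in>I. (cmod (mu x i))\<^sup>2) \<le> (\<Sum>i\<in>I. \<Sum>k\<in>P. w k * (cmod (X k x i))\<^sup>2)"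
      by (rule sum_mono)
    also have "\<dots> = (\<Sum>k\<in>P. w k * (\<Sum>i\<in>I. (cmod (X k x i))\<^sup>2))"
      by (subst sum.swap) (simp add: sum_distrib_left)
    also have "\<dots> \<le> (\<Sum>k\<in>P. w k * 1)"
      by (intro sum_mono mult_left_mono bound P x)
    finally show ?thesis by (simp add: P(3))
  qed
  have "\<exists>ks. length ks = K \<and> set ks \<subseteq> P \<and>
    (\<forall>x\<in>W. (\<Sum>i\<in>I. (cmod (\<Sum>k\<leftarrow>ks. X k x i - mu x i))\<^sup>2) \<le> 64 * real K * (ln (real (card W)) + 1))"
  proof (rule maurey_centered[OF P _ _ W K])
    fix x i
    show "(\<Sum>k\<in>P. w k *\<^sub>R (X k x i - mu x i)) = 0"
      by (simp add: scaleR_diff_right sum_subtractf scaleR_sum_left[symmetric] P(3)) (simp add: mu_def)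
  next
    fix k x assume k: "k \<in> P" "x \<in> W"
    have "(\<Sum>i\<in>I. (cmod (X k x i - mu x i))\<^sup>2) \<le> (\<Sum>i\<in>I. 2 * (cmod (X k x i))\<^sup>2 + 2 * (cmod (mu x i))\<^sup>2)"
    proof (rule sum_mono)
      fix i
      have "(cmod (X k x i - mu x i))\<^sup>2 \<le> (cmod (X k x i) + cmod (mu x i))\<^sup>2"
        by (intro power_mono norm_triangle_ineq4) simp
      also have "\<dots> \<le> 2 * (cmod (X k x i))\<^sup>2 + 2 * (cmod (mu x i))\<^sup>2"
        using sum_squares_ge_zero[of "cmod (X k x i) - cmod (mu x i)" 0] by (simp add: power2_eq_square algebra_simps)
      finally show "(cmod (X k x i - mu x i))\<^sup>2 \<le> 2 * (cmod (X k x i))\<^sup>2 + 2 * (cmod (mu x i))\<^sup>2" .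
    qed
    also have "\<dots> \<le> 4"
      using bound[OF k] mu[OF k(2)] by (simp add: sum.distrib sum_distrib_left[symmetric])
    finally show "(\<Sum>i\<in>I. (cmod (X k x i - mu x i))\<^sup>2) \<le> 4" .
  qed
  then obtain ks where ks: "length ks = K" "set ks \<subseteq> P"
    "\<forall>x\<in>W. (\<Sum>i\<in>I. (cmod (\<Sum>k\<leftarrow>ks. X k x i - mu x i))\<^sup>2) \<le> 64 * real K * (ln (real (card W)) + 1)"
    by (elim exE conjE)
  have "(\<Sum>k\<leftarrow>ks. X k x i - mu x i) = (\<Sum>k\<leftarrow>ks. X k x i) - real K *\<^sub>R mu x i" for x i
    using ks(1) by (simp add: sum_list_subtractf sum_list_triv scaleR_conv_of_real)
  with ks show ?thesis by (intro exI[of _ ks]) (simp add: mu_def)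
qed

section \<open>Circulant matrices and the discrete Fourier transform\<close>

definition root_of_unity :: "nat \<Rightarrow> int \<Rightarrow> complex" where
  "root_of_unity m k = cis (2 * pi * real_of_int k / real m)"

lemma norm_root_of_unity[simp]: "cmod (root_of_unity m k) = 1"
  by (simp add: root_of_unity_def)

lemma root_of_unity_add: "root_of_unity m (k + l) = root_of_unity m k * root_of_unity m l"
  by (simp add: root_of_unity_def cis_mult add_divide_distrib distrib_left)

lemma cnj_root_of_unity: "cnj (root_of_unity m k) = root_of_unity m (- k)"
  by (simp add: root_of_unity_def cis_cnj)

lemma root_of_unity_power: "root_of_unity m (int j * k) = root_of_unity m k ^ j"
  by (simp add: root_of_unity_def Complex.DeMoivre mult_ac)

lemma root_of_unity_eq_1_iff:
  assumes "0 < m"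
  shows "root_of_unity m k = 1 \<longleftrightarrow> int m dvd k"
proof -
  have "root_of_unity m k = 1 \<longleftrightarrow> (\<exists>x::int. 2 * pi * real_of_int k / real m = 2 * pi * real_of_int x)"
  proof -
    have s: "sin t = 0" if "cos t = 1" for t :: real
      using sin_cos_squared_add[of t] that by simp
    have c: "cos t = 1 \<longleftrightarrow> (\<exists>x::int. t = 2 * pi * real_of_int x)" for t :: real
      by (simp add: cos_one_2pi_int mult_ac)
    show ?thesis
      unfolding root_of_unity_def c[symmetric] using s by (auto simp: complex_eq_iff)
  qed
  also have "\<dots> \<longleftrightarrow> (\<exists>x::int. real_of_int k = real_of_int (int m * x))"
    using assms by (simp add: field_simps)
  also have "\<dots> \<longleftrightarrow> int m dvd k" by (simp only: of_int_eq_iff dvd_def)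
  finally show ?thesis .
qed

lemma root_of_unity_cong:
  assumes "0 < m" "int m dvd k - l"
  shows "root_of_unity m k = root_of_unity m l"
  using root_of_unity_add[of m "k - l" l] assms by (simp add: root_of_unity_eq_1_iff)

lemma sum_root_of_unity:
  assumes "0 < m"
  shows "(\<Sum>x<m. root_of_unity m (int x * k)) = (if int m dvd k then of_nat m else 0)"
proof (cases "int m dvd k")
  case True
  then have "root_of_unity m (int x * k) = 1" for x
    using assms by (simp add: root_of_unity_eq_1_iff)
  then show ?thesis using True by simp
next
  case False
  then have ne: "root_of_unity m k \<noteq> 1" using assms by (simp add: root_of_unity_eq_1_iff)
  have "(\<Sum>x<m. root_of_unity m (int x * k)) = (root_of_unity m k ^ m - 1) / (root_of_unity m k - 1)"
    unfolding root_of_unity_power by (rule geometric_sum[OF ne])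
  also have "root_of_unity m k ^ m = root_of_unity m (int m * k)" by (rule root_of_unity_power[symmetric])
  also have "\<dots> = 1" using assms by (simp add: root_of_unity_eq_1_iff)
  finally show ?thesis using False by simp
qed

text \<open>Times run over 1..m and frequencies over 0..m-1. Both are complete residue systems, and
  |t - s| < m makes congruent times equal.\<close>

lemma parseval:
  fixes a :: "nat \<Rightarrow> real"
  assumes "0 < m"
  shows "(\<Sum>x<m. (cmod (\<Sum>t\<in>{1..m}. of_real (a t) * root_of_unity m (int x * int t)))\<^sup>2) =
    real m * (\<Sum>t\<in>{1..m}. (a t)\<^sup>2)"
proof -
  have "complex_of_real (\<Sum>x<m. (cmod (\<Sum>t\<in>{1..m}. of_real (a t) * root_of_unity m (int x * int t)))\<^sup>2) =
      (\<Sum>x<m. \<Sum>t\<in>{1..m}. \<Sum>s\<in>{1..m}. of_real (a t * a s) * root_of_unity m (int x * (int t - int s)))"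
  proof (simp only: of_real_sum, intro sum.cong refl)
    fix x
    have "complex_of_real ((cmod (\<Sum>t\<in>{1..m}. of_real (a t) * root_of_unity m (int x * int t)))\<^sup>2) =
        (\<Sum>t\<in>{1..m}. of_real (a t) * root_of_unity m (int x * int t)) *
        (\<Sum>s\<in>{1..m}. of_real (a s) * root_of_unity m (- (int x * int s)))"
      by (simp only: complex_norm_square cnj_sum complex_cnj_mult complex_cnj_complex_of_real cnj_root_of_unity)
    also have "\<dots> = (\<Sum>t\<in>{1..m}. \<Sum>s\<in>{1..m}. of_real (a t * a s) * root_of_unity m (int x * (int t - int s)))"
      unfolding sum_product
    proof (intro sum.cong refl)
      fix t s
      have "int x * (int t - int s) = int x * int t + - (int x * int s)" by (simp add: algebra_simps)
      then show "of_real (a t) * root_of_unity m (int x * int t) *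
          (of_real (a s) * root_of_unity m (- (int x * int s))) =
        of_real (a t * a s) * root_of_unity m (int x * (int t - int s))"
        by (simp only: root_of_unity_add of_real_mult mult_ac)
    qed
    finally show "complex_of_real ((cmod (\<Sum>t\<in>{1..m}. of_real (a t) * root_of_unity m (int x * int t)))\<^sup>2) =
        (\<Sum>t\<in>{1..m}. \<Sum>s\<in>{1..m}. of_real (a t * a s) * root_of_unity m (int x * (int t - int s)))" .
  qed
  also have "\<dots> = (\<Sum>t\<in>{1..m}. \<Sum>s\<in>{1..m}. \<Sum>x<m. of_real (a t * a s) * root_of_unity m (int x * (int t - int s)))"
    by (rule trans[OF sum.swap], rule sum.cong[OF refl], rule sum.swap)
  also have "\<dots> = (\<Sum>t\<in>{1..m}. \<Sum>s\<in>{1..m}. of_real (a t * a s) * (if t = s then of_nat m else 0))"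
  proof (intro sum.cong refl)
    fix t s assume "t \<in> {1..m}" "s \<in> {1..m}"
    then have ts: "\<bar>int t - int s\<bar> < int m" by auto
    have "int m dvd int t - int s \<longleftrightarrow> t = s"
      using dvd_imp_le_int[of "int t - int s" "int m"] ts by auto
    then show "(\<Sum>x<m. of_real (a t * a s) * root_of_unity m (int x * (int t - int s))) =
        of_real (a t * a s) * (if t = s then of_nat m else 0)"
      by (simp only: sum_distrib_left[symmetric] sum_root_of_unity[OF assms])
  qed
  also have "\<dots> = of_real (real m * (\<Sum>t\<in>{1..m}. (a t)\<^sup>2))"
    by (simp add: sum.delta' sum_distrib_left power2_eq_square mult_ac if_distrib cong: if_cong)
  finally show ?thesis by (simp only: of_real_eq_iff)
qed

section \<open>The multichannel circulant matrix and its Fourier diagonalisation\<close>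

definition block :: "nat \<Rightarrow> nat \<Rightarrow> nat" where
  "block n col = (col - 1) div n + 1"

definition offset :: "nat \<Rightarrow> nat \<Rightarrow> nat" where
  "offset n col = (col - 1) mod n + 1"

definition tap :: "nat \<Rightarrow> nat \<Rightarrow> nat \<Rightarrow> nat \<Rightarrow> nat \<times> nat" where
  "tap n m r col = (block n col, nat ((int n + int r - int (offset n col) - 1) mod int m) + 1)"

lemma Phi_entry_tap: "Phi_entry n m phi r col = phi (tap n m r col)"
  by (simp add: Phi_entry_def tap_def block_def offset_def Let_def)

lemma block_range: "col \<in> {1..n * p} \<Longrightarrow> block n col \<in> {1..p}"
  by (cases "n = 0") (auto simp: block_def less_mult_imp_div_less mult.commute Suc_le_eq)

lemma offset_range: "0 < n \<Longrightarrow> offset n col \<in> {1..n}"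
  by (simp add: offset_def Suc_le_eq)

lemma tap_range:
  assumes "0 < m" "col \<in> {1..n * p}"
  shows "tap n m r col \<in> {1..p} \<times> {1..m}"
proof -
  have "0 \<le> (int n + int r - int (offset n col) - 1) mod int m"
    "(int n + int r - int (offset n col) - 1) mod int m < int m" using assms(1) by auto
  then have "nat ((int n + int r - int (offset n col) - 1) mod int m) + 1 \<in> {1..m}" by auto
  with block_range[OF assms(2)] show ?thesis by (simp add: tap_def)
qed

text \<open>Characters see the time index only modulo m; the -1 and +1 in \<open>tap\<close> merely
  select the representative in 1..m.\<close>

lemma tap_cong:
  assumes "0 < m"
  shows "int m dvd int (snd (tap n m r col)) - (int n + int r - int (offset n col))"
proof -
  have "int (snd (tap n m r col)) = (int n + int r - int (offset n col) - 1) mod int m + 1"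
    using assms by (simp add: tap_def)
  then show ?thesis by (simp add: mod_eq_dvd_iff[symmetric] mod_simps)
qed

text \<open>Within a row no probe variable occurs twice, since the offsets of a channel fill an
  interval of length n <= m. Hence the variance of a row of \<Phi> u is the squared norm of u over
  m.\<close>

lemma tap_inj:
  assumes "0 < n" "n \<le> m"
  shows "inj_on (tap n m r) {1..n * p}"
proof (rule inj_onI)
  fix c d assume c: "c \<in> {1..n * p}" and d: "d \<in> {1..n * p}" and eq: "tap n m r c = tap n m r d"
  have m: "0 < m" using assms by simp
  from eq have b: "block n c = block n d" by (simp add: tap_def)
  have "int m dvd (int n + int r - int (offset n d)) - (int n + int r - int (offset n c))"
    using dvd_diff[OF tap_cong[OF m, of n r c] tap_cong[OF m, of n r d]] eq by (simp add: algebra_simps)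
  then have "int m dvd int (offset n c) - int (offset n d)" by simp
  moreover have "\<bar>int (offset n c) - int (offset n d)\<bar> < int m"
    using offset_range[OF assms(1), of c] offset_range[OF assms(1), of d] assms(2) by auto
  ultimately have "offset n c = offset n d"
    using dvd_imp_le_int[of "int (offset n c) - int (offset n d)" "int m"] by auto
  with b have "c - 1 = d - 1"
    unfolding block_def offset_def by (metis add_right_cancel mult_div_mod_eq)
  with c d show "c = d" by auto
qed

definition Phi_apply :: "nat \<Rightarrow> nat \<Rightarrow> nat \<Rightarrow> (nat \<times> nat \<Rightarrow> real) \<Rightarrow> (nat \<Rightarrow> real) \<Rightarrow> nat \<Rightarrow> real" where
  "Phi_apply n m p phi w r = (\<Sum>col\<in>{1..n * p}. phi (tap n m r col) * w col)"

text \<open>\<open>adj w z\<close> collects the coefficients of the probe variables in the inner product of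
  \<open>\<Phi> w\<close> with \<open>z\<close>; the maximum of \<open>energy w\<close> over the \<open>m\<close> frequencies is the squared operator norm
  of the linear map \<open>phi \<mapsto> \<Phi> w\<close>.\<close>

definition adj :: "nat \<Rightarrow> nat \<Rightarrow> nat \<Rightarrow> (nat \<Rightarrow> real) \<Rightarrow> (nat \<Rightarrow> real) \<Rightarrow> nat \<times> nat \<Rightarrow> real" where
  "adj n m p w z x = (\<Sum>r\<in>{1..m}. \<Sum>col\<in>{1..n * p}. if tap n m r col = x then z r * w col else 0)"

text \<open>The Fourier transform of \<open>w\<close>, channel by channel, written as a combination
  of the transforms of the unit vectors, which is the form that Maurey's method
  approximates.\<close>

definition spectrum :: "nat \<Rightarrow> nat \<Rightarrow> nat \<Rightarrow> (nat \<Rightarrow> real) \<Rightarrow> nat \<Rightarrow> nat \<Rightarrow> complex" where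
  "spectrum n m p w x i =
    (\<Sum>col\<in>{1..n * p}. w col *\<^sub>R (if block n col = i then root_of_unity m (- (int x * int (offset n col))) else 0))"

definition energy :: "nat \<Rightarrow> nat \<Rightarrow> nat \<Rightarrow> (nat \<Rightarrow> real) \<Rightarrow> nat \<Rightarrow> real" where
  "energy n m p w x = (\<Sum>i\<in>{1..p}. (cmod (spectrum n m p w x i))\<^sup>2)"

lemma adj_duality:
  assumes "0 < m"
  shows "(\<Sum>r\<in>{1..m}. z r * Phi_apply n m p phi w r) = (\<Sum>x\<in>{1..p} \<times> {1..m}. adj n m p w z x * phi x)"
proof -
  have "(\<Sum>x\<in>{1..p} \<times> {1..m}. adj n m p w z x * phi x) = (\<Sum>x\<in>{1..p} \<times> {1..m}. \<Sum>r\<in>{1..m}. \<Sum>col\<in>{1..n * p}.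
      if tap n m r col = x then z r * w col * phi x else 0)"
    by (simp add: adj_def sum_distrib_right if_distrib[of "\<lambda>y. y * _"] cong: if_cong)
  also have "\<dots> = (\<Sum>r\<in>{1..m}. \<Sum>x\<in>{1..p} \<times> {1..m}. \<Sum>col\<in>{1..n * p}.
      if tap n m r col = x then z r * w col * phi x else 0)"
    by (rule sum.swap)
  also have "\<dots> = (\<Sum>r\<in>{1..m}. \<Sum>col\<in>{1..n * p}. \<Sum>x\<in>{1..p} \<times> {1..m}.
      if tap n m r col = x then z r * w col * phi x else 0)"
    by (intro sum.cong refl sum.swap)
  also have "\<dots> = (\<Sum>r\<in>{1..m}. \<Sum>col\<in>{1..n * p}. z r * w col * phi (tap n m r col))"
    using tap_range[OF assms] by (intro sum.cong refl) (simp add: sum.delta')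
  also have "\<dots> = (\<Sum>r\<in>{1..m}. z r * Phi_apply n m p phi w r)"
    by (simp add: Phi_apply_def sum_distrib_left mult_ac)
  finally show ?thesis ..
qed

text \<open>The convolution theorem: \<open>adj\<close> is a cyclic correlation of \<open>z\<close>
  with each channel of \<open>w\<close>, so its transform is a product. The factor from the shift by
  \<open>n\<close> has modulus one.\<close>

lemma adj_dft:
  assumes "0 < m"
  shows "(\<Sum>t\<in>{1..m}. of_real (adj n m p w z (i, t)) * root_of_unity m (int x * int t)) =
    root_of_unity m (int x * int n) * (\<Sum>r\<in>{1..m}. of_real (z r) * root_of_unity m (int x * int r)) *
    spectrum n m p w x i"
proof -
  have "(\<Sum>t\<in>{1..m}. of_real (adj n m p w z (i, t)) * root_of_unity m (int x * int t)) =
      (\<Sum>t\<in>{1..m}. \<Sum>r\<in>{1..m}. \<Sum>col\<in>{1..n * p}. if tap n m r col = (i, t)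
        then of_real (z r * w col) * root_of_unity m (int x * int t) else 0)"
    unfolding adj_def of_real_sum sum_distrib_right
    by (intro sum.cong refl) simp
  also have "\<dots> = (\<Sum>r\<in>{1..m}. \<Sum>t\<in>{1..m}. \<Sum>col\<in>{1..n * p}. if tap n m r col = (i, t)
        then of_real (z r * w col) * root_of_unity m (int x * int t) else 0)"
    by (rule sum.swap)
  also have "\<dots> = (\<Sum>r\<in>{1..m}. \<Sum>col\<in>{1..n * p}. \<Sum>t\<in>{1..m}. if tap n m r col = (i, t)
        then of_real (z r * w col) * root_of_unity m (int x * int t) else 0)"
    by (intro sum.cong refl sum.swap)
  also have "\<dots> = (\<Sum>r\<in>{1..m}. \<Sum>col\<in>{1..n * p}. root_of_unity m (int x * int n) *
      (of_real (z r) * root_of_unity m (int x * int r)) *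
      (w col *\<^sub>R (if block n col = i then root_of_unity m (- (int x * int (offset n col))) else 0)))"
  proof (intro sum.cong refl)
    fix r col assume col: "col \<in> {1..n * p}"
    let ?t = "snd (tap n m r col)"
    have t: "?t \<in> {1..m}" using tap_range[OF assms col, of r] by (auto simp: mem_Times_iff)
    have tap: "tap n m r col = (i, t) \<longleftrightarrow> block n col = i \<and> ?t = t" for t
      by (auto simp: tap_def)
    have "int m dvd int x * int ?t - (int x * int n + int x * int r + - (int x * int (offset n col)))"
      using dvd_mult[OF tap_cong[OF assms, of n r col], of "int x"] by (simp add: algebra_simps)
    then have root: "root_of_unity m (int x * int ?t) = root_of_unity m (int x * int n) *
        root_of_unity m (int x * int r) * root_of_unity m (- (int x * int (offset n col)))"
      by (simp only: root_of_unity_cong[OF assms] root_of_unity_add)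
    show "(\<Sum>t\<in>{1..m}. if tap n m r col = (i, t)
        then of_real (z r * w col) * root_of_unity m (int x * int t) else 0) =
      root_of_unity m (int x * int n) * (of_real (z r) * root_of_unity m (int x * int r)) *
      (w col *\<^sub>R (if block n col = i then root_of_unity m (- (int x * int (offset n col))) else 0))"
    proof (cases "block n col = i")
      case True
      then have "(\<Sum>t\<in>{1..m}. if tap n m r col = (i, t)
          then of_real (z r * w col) * root_of_unity m (int x * int t) else 0) =
          of_real (z r * w col) * root_of_unity m (int x * int ?t)"
        using t by (simp add: tap sum.delta')
      with True show ?thesis by (simp add: root scaleR_conv_of_real mult_ac)
    qed (simp add: tap)
  qed
  also have "\<dots> = root_of_unity m (int x * int n) *
      (\<Sum>r\<in>{1..m}. of_real (z r) * root_of_unity m (int x * int r)) * spectrum n m p w x i"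
    unfolding spectrum_def sum_distrib_left sum_distrib_right by (subst sum.swap) simp
  finally show ?thesis .
qed

text \<open>Parseval is applied to \<open>adj\<close> and to \<open>z\<close>. In between, frequency
  x is multiplied by the squared spectra of all channels, whose sum is the
  \<open>energy\<close>.\<close>

lemma adj_bound:
  assumes "0 < m" and e: "\<And>x. x < m \<Longrightarrow> energy n m p w x \<le> t"
  shows "(\<Sum>x\<in>{1..p} \<times> {1..m}. (adj n m p w z x)\<^sup>2) \<le> t * (\<Sum>r\<in>{1..m}. (z r)\<^sup>2)"
proof -
  define Z where "Z = (\<lambda>x. (cmod (\<Sum>r\<in>{1..m}. of_real (z r) * root_of_unity m (int x * int r)))\<^sup>2)"
  have "real m * (\<Sum>x\<in>{1..p} \<times> {1..m}. (adj n m p w z x)\<^sup>2) =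
      (\<Sum>i\<in>{1..p}. real m * (\<Sum>t\<in>{1..m}. (adj n m p w z (i, t))\<^sup>2))"
    by (simp add: sum.cartesian_product' sum_distrib_left)
  also have "\<dots> = (\<Sum>i\<in>{1..p}. \<Sum>x<m. Z x * (cmod (spectrum n m p w x i))\<^sup>2)"
    unfolding parseval[OF assms(1), symmetric] adj_dft[OF assms(1)]
    by (simp add: Z_def norm_mult power_mult_distrib)
  also have "\<dots> = (\<Sum>x<m. Z x * energy n m p w x)"
    by (subst sum.swap) (simp add: energy_def sum_distrib_left)
  also have "\<dots> \<le> (\<Sum>x<m. Z x * t)"
    by (intro sum_mono mult_left_mono e) (auto simp: Z_def)
  also have "\<dots> = real m * (t * (\<Sum>r\<in>{1..m}. (z r)\<^sup>2))"
    using parseval[OF assms(1), of z] by (simp add: Z_def sum_distrib_right[symmetric])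
  finally show ?thesis using assms(1) by simp
qed

lemma spectrum_diff: "spectrum n m p (\<lambda>c. u c - v c) x i = spectrum n m p u x i - spectrum n m p v x i"
  by (simp add: spectrum_def scaleR_diff_left sum_subtractf)

lemma energy_diff_le: "energy n m p (\<lambda>c. u c - v c) x \<le> 2 * energy n m p u x + 2 * energy n m p v x"
proof -
  have "(cmod (a - b))\<^sup>2 \<le> 2 * (cmod a)\<^sup>2 + 2 * (cmod b)\<^sup>2" for a b
  proof -
    have "(cmod (a - b))\<^sup>2 \<le> (cmod a + cmod b)\<^sup>2" by (intro power_mono norm_triangle_ineq4) simp
    also have "\<dots> \<le> 2 * (cmod a)\<^sup>2 + 2 * (cmod b)\<^sup>2"
      using zero_le_power2[of "cmod a - cmod b"] by (simp add: power2_eq_square algebra_simps)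
    finally show ?thesis .
  qed
  then show ?thesis
    unfolding energy_def spectrum_diff sum_distrib_left sum.distrib[symmetric] by (intro sum_mono)
qed

lemma energy_triangle:
  "energy n m p (\<lambda>c. u c - v c) x \<le> 2 * energy n m p (\<lambda>c. a c - u c) x + 2 * energy n m p (\<lambda>c. a c - v c) x"
  using energy_diff_le[of n m p "\<lambda>c. a c - v c" "\<lambda>c. a c - u c" x] by (simp add: algebra_simps)


section \<open>Reduction to a finite grid\<close>

definition bilinear :: "nat \<Rightarrow> (nat \<Rightarrow> nat \<Rightarrow> real) \<Rightarrow> (nat \<Rightarrow> real) \<Rightarrow> (nat \<Rightarrow> real) \<Rightarrow> real" where
  "bilinear N A y x = (\<Sum>j\<in>{1..N}. \<Sum>k\<in>{1..N}. y j * A j k * x k)"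

lemma bilinear_add_left: "bilinear N A (\<lambda>j. y j + y' j) x = bilinear N A y x + bilinear N A y' x"
  by (simp add: bilinear_def distrib_right sum.distrib)

lemma bilinear_add_right: "bilinear N A y (\<lambda>j. x j + x' j) = bilinear N A y x + bilinear N A y x'"
  by (simp add: bilinear_def distrib_left sum.distrib)

lemma bilinear_scale: "bilinear N A (\<lambda>j. a * y j) (\<lambda>j. b * x j) = a * b * bilinear N A y x"
  by (simp add: bilinear_def sum_distrib_left mult_ac)

lemma bilinear_commute:
  assumes "\<And>j k. A j k = A k j"
  shows "bilinear N A y x = bilinear N A x y"
  unfolding bilinear_def by (subst sum.swap) (simp add: assms[of _ "_::nat"] mult_ac)

definition sparse_on :: "nat \<Rightarrow> nat \<Rightarrow> nat set \<Rightarrow> (nat \<Rightarrow> real) \<Rightarrow> bool" where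
  "sparse_on N s S x \<longleftrightarrow> S \<subseteq> {1..N} \<and> card S \<le> s \<and> (\<forall>j. j \<notin> S \<longrightarrow> x j = 0)"

lemma sparse_sum:
  assumes "sparse_on N s S x" "f 0 = 0"
  shows "(\<Sum>j\<in>S. f (x j)) = (\<Sum>j\<in>{1..N}. f (x j) :: real)"
  using assms by (intro sum.mono_neutral_left) (auto simp: sparse_on_def)

lemma snorm_bound:
  assumes "\<And>S x y. sparse_on N s S x \<Longrightarrow> sparse_on N s S y \<Longrightarrow>
      (\<Sum>j\<in>S. (x j)\<^sup>2) = 1 \<Longrightarrow> (\<Sum>j\<in>S. (y j)\<^sup>2) = 1 \<Longrightarrow> \<bar>bilinear N A y x\<bar> \<le> C"
    and "0 < N" "0 < s"
  shows "snorm N s A \<le> C"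
  unfolding snorm_def
proof (rule cSup_least)
  \<comment> \<open>\<open>Sup\<close> of an empty set of reals is unspecified, so the first unit
    vector serves as a competitor.\<close>
  let ?e = "\<lambda>j::nat. if j = 1 then 1 else (0::real)"
  have "\<bar>\<Sum>j\<in>{1..N}. \<Sum>k\<in>{1..N}. ?e j * A j k * ?e k\<bar> \<in>
      {\<bar>\<Sum>j\<in>{1..N}. \<Sum>k\<in>{1..N}. y j * A j k * x k\<bar> | \<Gamma> x y.
       \<Gamma> \<subseteq> {1..N} \<and> card \<Gamma> \<le> s \<and>
       (\<forall>j. j \<notin> \<Gamma> \<longrightarrow> x j = 0) \<and> (\<forall>j. j \<notin> \<Gamma> \<longrightarrow> y j = 0) \<and>
       sqrt (\<Sum>j\<in>\<Gamma>. (x j)\<^sup>2) = 1 \<and> sqrt (\<Sum>j\<in>\<Gamma>. (y j)\<^sup>2) = 1}"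
    using assms(2,3) by (intro CollectI exI[of _ "{1}"] exI[of _ ?e]) auto
  then show "{\<bar>\<Sum>j\<in>{1..N}. \<Sum>k\<in>{1..N}. y j * A j k * x k\<bar> | \<Gamma> x y.
       \<Gamma> \<subseteq> {1..N} \<and> card \<Gamma> \<le> s \<and>
       (\<forall>j. j \<notin> \<Gamma> \<longrightarrow> x j = 0) \<and> (\<forall>j. j \<notin> \<Gamma> \<longrightarrow> y j = 0) \<and>
       sqrt (\<Sum>j\<in>\<Gamma>. (x j)\<^sup>2) = 1 \<and> sqrt (\<Sum>j\<in>\<Gamma>. (y j)\<^sup>2) = 1} \<noteq> {}" by blast
qed (use assms(1) in \<open>auto simp: sparse_on_def bilinear_def\<close>)

lemma bilinear_le_snorm_unit:
  assumes "sparse_on N s S x" "sparse_on N s S y"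
    "(\<Sum>j\<in>S. (x j)\<^sup>2) = 1" "(\<Sum>j\<in>S. (y j)\<^sup>2) = 1"
  shows "\<bar>bilinear N A y x\<bar> \<le> snorm N s A"
  unfolding snorm_def
proof (rule cSup_upper)
  show "\<bar>bilinear N A y x\<bar> \<in> {\<bar>\<Sum>j\<in>{1..N}. \<Sum>k\<in>{1..N}. y j * A j k * x k\<bar> | \<Gamma> x y.
       \<Gamma> \<subseteq> {1..N} \<and> card \<Gamma> \<le> s \<and>
       (\<forall>j. j \<notin> \<Gamma> \<longrightarrow> x j = 0) \<and> (\<forall>j. j \<notin> \<Gamma> \<longrightarrow> y j = 0) \<and>
       sqrt (\<Sum>j\<in>\<Gamma>. (x j)\<^sup>2) = 1 \<and> sqrt (\<Sum>j\<in>\<Gamma>. (y j)\<^sup>2) = 1}"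
    using assms unfolding bilinear_def sparse_on_def
    by (intro CollectI exI[of _ S] exI[of _ x] exI[of _ y]) auto
  show "bdd_above {\<bar>\<Sum>j\<in>{1..N}. \<Sum>k\<in>{1..N}. y j * A j k * x k\<bar> | \<Gamma> x y.
       \<Gamma> \<subseteq> {1..N} \<and> card \<Gamma> \<le> s \<and>
       (\<forall>j. j \<notin> \<Gamma> \<longrightarrow> x j = 0) \<and> (\<forall>j. j \<notin> \<Gamma> \<longrightarrow> y j = 0) \<and>
       sqrt (\<Sum>j\<in>\<Gamma>. (x j)\<^sup>2) = 1 \<and> sqrt (\<Sum>j\<in>\<Gamma>. (y j)\<^sup>2) = 1}"
  \<comment> \<open>Entries of a unit vector have modulus at most 1.\<close>
  proof (rule bdd_aboveI[of _ "\<Sum>j\<in>{1..N}. \<Sum>k\<in>{1..N}. \<bar>A j k\<bar>"], clarify)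
    fix G :: "nat set" and x y :: "nat \<Rightarrow> real"
    assume G: "G \<subseteq> {1..N}" "\<forall>j. j \<notin> G \<longrightarrow> x j = 0" "\<forall>j. j \<notin> G \<longrightarrow> y j = 0"
      "sqrt (\<Sum>j\<in>G. (x j)\<^sup>2) = 1" "sqrt (\<Sum>j\<in>G. (y j)\<^sup>2) = 1"
    have fin: "finite G" using G(1) finite_subset by blast
    have le1: "\<bar>z j\<bar> \<le> 1" if "\<forall>j. j \<notin> G \<longrightarrow> z j = 0" "sqrt (\<Sum>j\<in>G. (z j)\<^sup>2) = 1" for z :: "nat \<Rightarrow> real" and j
    proof (cases "j \<in> G")
      case True
      then have "(z j)\<^sup>2 \<le> (\<Sum>j\<in>G. (z j)\<^sup>2)" using fin by (intro member_le_sum) auto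
      also have "\<dots> = 1" using that(2) by simp
      finally show ?thesis by (simp add: abs_square_le_1)
    qed (use that in simp)
    show "\<bar>\<Sum>j\<in>{1..N}. \<Sum>k\<in>{1..N}. y j * A j k * x k\<bar> \<le> (\<Sum>j\<in>{1..N}. \<Sum>k\<in>{1..N}. \<bar>A j k\<bar>)"
    proof (intro sum_abs[THEN order_trans] sum_mono)
      fix j k
      have "\<bar>y j\<bar> * \<bar>A j k\<bar> * \<bar>x k\<bar> \<le> 1 * \<bar>A j k\<bar> * 1"
        by (intro mult_mono le1 G) auto
      then show "\<bar>y j * A j k * x k\<bar> \<le> \<bar>A j k\<bar>" by (simp add: abs_mult)
    qed
  qed
qed

lemma snorm_nonneg:
  assumes "0 < N" "0 < s"
  shows "0 \<le> snorm N s A"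
proof -
  have "sparse_on N s {1} (\<lambda>i. if i = 1 then 1 else 0)"
    using assms by (auto simp: sparse_on_def)
  from bilinear_le_snorm_unit[OF this this, of A] show ?thesis by simp
qed

text \<open>Homogeneity. Only upper bounds on the norms are asked for, since rounding errors come
  with nothing more; a zero vector cannot be normalised and is treated apart.\<close>

lemma bilinear_le_snorm:
  assumes x: "sparse_on N s S x" and y: "sparse_on N s S y"
    and a: "(\<Sum>j\<in>S. (x j)\<^sup>2) \<le> a\<^sup>2" "0 \<le> a" and b: "(\<Sum>j\<in>S. (y j)\<^sup>2) \<le> b\<^sup>2" "0 \<le> b"
    and pos: "0 < N" "0 < s"
  shows "\<bar>bilinear N A y x\<bar> \<le> a * b * snorm N s A"
proof -
  define p where "p = sqrt (\<Sum>j\<in>S. (x j)\<^sup>2)"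
  define q where "q = sqrt (\<Sum>j\<in>S. (y j)\<^sup>2)"
  have p: "0 \<le> p" "p \<le> a" using a by (auto simp: p_def sum_nonneg real_le_lsqrt)
  have q: "0 \<le> q" "q \<le> b" using b by (auto simp: q_def sum_nonneg real_le_lsqrt)
  have fin: "finite S" using x finite_subset by (auto simp: sparse_on_def)
  have zero: "z = (\<lambda>_. 0)" if "sparse_on N s S z" "sqrt (\<Sum>j\<in>S. (z j)\<^sup>2) = 0" for z
    using that fin by (auto simp: sparse_on_def sum_nonneg_eq_0_iff)
  show ?thesis
  proof (cases "p = 0 \<or> q = 0")
    case True
    from True have "bilinear N A y x = 0"
      using zero[OF x] zero[OF y] by (auto simp: p_def q_def bilinear_def)
    then show ?thesis using snorm_nonneg[OF pos] a b by simp
  next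
    case False
    with p q have pq: "0 < p" "0 < q" by auto
    have unit: "sparse_on N s S (\<lambda>j. 1 / t * z j)" "(\<Sum>j\<in>S. (1 / t * z j)\<^sup>2) = 1"
      if "sparse_on N s S z" "t = sqrt (\<Sum>j\<in>S. (z j)\<^sup>2)" "0 < t" for z t
    proof -
      show "sparse_on N s S (\<lambda>j. 1 / t * z j)" using that by (auto simp: sparse_on_def)
      have "t\<^sup>2 = (\<Sum>j\<in>S. (z j)\<^sup>2)" using that by (simp add: sum_nonneg)
      from this[symmetric] show "(\<Sum>j\<in>S. (1 / t * z j)\<^sup>2) = 1"
        using that(3) by (simp add: power_mult_distrib power_divide sum_divide_distrib[symmetric])
    qed
    have "\<bar>bilinear N A (\<lambda>j. 1 / q * y j) (\<lambda>j. 1 / p * x j)\<bar> \<le> snorm N s A"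
      by (rule bilinear_le_snorm_unit[OF unit(1)[OF x] unit(1)[OF y] unit(2)[OF x] unit(2)[OF y]])
        (use pq in \<open>auto simp: p_def q_def\<close>)
    then have "\<bar>bilinear N A y x\<bar> \<le> p * q * snorm N s A"
      using pq unfolding bilinear_scale by (simp add: abs_mult field_simps)
    moreover have "0 \<le> snorm N s A" by (rule snorm_nonneg[OF pos])
    moreover have "p * q \<le> a * b" using p q by (intro mult_mono) auto
    ultimately show ?thesis by (meson mult_right_mono order_trans)
  qed
qed

text \<open>The spacing \<open>1 / (8 s)\<close> makes room for the half-sums and half-differences, used for
  polarisation, of vectors rounded to multiples of \<open>1 / (4 s)\<close>.\<close>

definition grid :: "nat \<Rightarrow> nat \<Rightarrow> (nat \<Rightarrow> real) set" where
  "grid N s = {u. (\<exists>S. sparse_on N s S u) \<and> (\<Sum>j\<in>{1..N}. (u j)\<^sup>2) \<le> 1 \<and>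
     (\<forall>j. \<exists>k\<in>{- int (8 * s)..int (8 * s)}. u j = of_int k / real (8 * s))}"

lemma zero_in_grid: "(\<lambda>_. 0) \<in> grid N s"
  by (auto simp: grid_def sparse_on_def intro!: exI[of _ "{}"] bexI[of _ 0])

lemma grid_l1:
  assumes "u \<in> grid N s"
  shows "(\<Sum>j\<in>{1..N}. \<bar>u j\<bar>) \<le> sqrt (real s)"
proof -
  obtain S where S: "sparse_on N s S u" using assms by (auto simp: grid_def)
  have "(\<Sum>j\<in>{1..N}. \<bar>u j\<bar>) = (\<Sum>j\<in>S. 1 * \<bar>u j\<bar>)"
    using sparse_sum[OF S, of abs] by simp
  moreover have "(\<Sum>j\<in>S. 1 * \<bar>u j\<bar>)\<^sup>2 \<le> (\<Sum>j\<in>S. 1\<^sup>2) * (\<Sum>j\<in>S. \<bar>u j\<bar>\<^sup>2)"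
    by (rule Cauchy_Schwarz_ineq_sum)
  moreover have "(\<Sum>j\<in>S. 1\<^sup>2) * (\<Sum>j\<in>S. \<bar>u j\<bar>\<^sup>2) \<le> real s * 1"
    using assms sparse_sum[OF S, of "\<lambda>t. t\<^sup>2"] S
    by (intro mult_mono) (auto simp: grid_def sparse_on_def sum_nonneg)
  ultimately show ?thesis by (intro real_le_rsqrt) simp
qed

text \<open>A grid vector is coded by s pairs (position, numerator), padded with (1, 0), which
  contributes zero. There are N * (16 s + 1) <= 32 N^2 <= N^7 pairs because N >= 2.\<close>

lemma grid_card:
  assumes "0 < s" "s \<le> N" "2 \<le> N"
  shows "finite (grid N s)" "card (grid N s) \<le> N ^ (7 * s)"
proof -
  define X where "X = {1..N} \<times> {- int (8 * s)..int (8 * s)}"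
  define L where "L = {xs. set xs \<subseteq> X \<and> length xs = s}"
  define f where "f = (\<lambda>xs::(nat \<times> int) list. \<lambda>j. \<Sum>x\<leftarrow>xs. if fst x = j then of_int (snd x) / real (8 * s) else 0 :: real)"
  have finX: "finite X" by (simp add: X_def)
  have finL: "finite L" unfolding L_def by (rule finite_lists_length_eq[OF finX])
  have sub: "grid N s \<subseteq> f ` L"
  proof
    fix u assume u: "u \<in> grid N s"
    then obtain S where S: "sparse_on N s S u" by (auto simp: grid_def)
    from u have "\<forall>j. \<exists>k. k \<in> {- int (8 * s)..int (8 * s)} \<and> u j = of_int k / real (8 * s)"
      unfolding grid_def by blast
    then obtain k where "\<forall>j. k j \<in> {- int (8 * s)..int (8 * s)} \<and> u j = of_int (k j) / real (8 * s)"
      by (rule choice[THEN exE])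
    then have k: "\<And>j. k j \<in> {- int (8 * s)..int (8 * s)}" "\<And>j. u j = of_int (k j) / real (8 * s)"
      by blast+
    have fin: "finite S" using S finite_subset by (auto simp: sparse_on_def)
    obtain ys where ys: "set ys = S" "distinct ys" using finite_distinct_list[OF fin] by blast
    have len: "length ys \<le> s" using S ys distinct_card[OF ys(2)] by (simp add: sparse_on_def)
    define xs where "xs = map (\<lambda>j. (j, k j)) ys @ replicate (s - length ys) (1, 0)"
    have "xs \<in> L"
      using len k(1) S ys assms by (auto simp: L_def xs_def X_def sparse_on_def)
    moreover have "f xs j = u j" for j
    proof -
      have "f xs j = (\<Sum>i\<leftarrow>ys. if i = j then u i else 0)"
        by (simp add: f_def xs_def o_def sum_list_replicate if_distrib k(2) cong: if_cong)
      also have "\<dots> = (\<Sum>i\<in>S. if i = j then u i else 0)"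
        using ys by (simp add: sum_list_distinct_conv_sum_set)
      also have "\<dots> = u j" using fin S by (auto simp: sparse_on_def)
      finally show ?thesis .
    qed
    ultimately show "u \<in> f ` L" by (auto intro!: image_eqI[of _ _ xs])
  qed
  show "finite (grid N s)" by (rule finite_subset[OF sub]) (simp add: finL)
  have "card (grid N s) \<le> card L"
    using card_mono[OF _ sub] card_image_le[OF finL, of f] finL by fastforce
  also have "\<dots> = card X ^ s" unfolding L_def by (rule card_lists_length_eq[OF finX])
  also have "\<dots> \<le> (N ^ 7) ^ s"
  proof (rule power_mono)
    have "nat (16 * int s + 1) = 16 * s + 1" by (simp only: nat_eq_iff) simp
    then have "card X = N * (16 * s + 1)" by (simp add: X_def)
    also have "\<dots> \<le> N * (2 ^ 5 * N)" using assms by (intro mult_left_mono) auto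
    also have "\<dots> \<le> N * (N ^ 5 * N)"
      using assms by (intro mult_left_mono mult_right_mono power_mono) auto
    also have "\<dots> = N ^ 7" by (simp add: eval_nat_numeral)
    finally show "card X \<le> N ^ 7" .
  qed simp
  also have "\<dots> = N ^ (7 * s)" by (simp add: power_mult)
  finally show "card (grid N s) \<le> N ^ (7 * s)" .
qed

text \<open>Rounding a unit vector on its support costs at most sqrt s / (4 s) <= 1 / 4 in norm.
  Polarisation bounds the rounded form by 2 M and the two error terms give a quarter of
  \<open>snorm\<close> each; absorbing the resulting half yields the factor 4.\<close>

lemma snorm_le_grid:
  assumes sym: "\<And>j k. A j k = A k j" and s: "0 < s" "s \<le> N" "2 \<le> N"
  shows "snorm N s A \<le> 4 * Max ((\<lambda>u. \<bar>bilinear N A u u\<bar>) ` grid N s)"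
proof -
  define M where "M = Max ((\<lambda>u. \<bar>bilinear N A u u\<bar>) ` grid N s)"
  have M: "\<bar>bilinear N A u u\<bar> \<le> M" if "u \<in> grid N s" for u
    unfolding M_def using that grid_card(1)[OF s] by (intro Max_ge) auto
  \<comment> \<open>Rounding is towards zero, so that no entry grows in modulus and the norm stays
    at most 1.\<close>
  define r where "r = (\<lambda>t::real. if 0 \<le> t then \<lfloor>real (4 * s) * t\<rfloor> else - \<lfloor>real (4 * s) * - t\<rfloor>)"
  define g where "g = (\<lambda>t. of_int (r t) / real (4 * s) :: real)"
  have s4: "0 < real (4 * s)" using s by simp
  have r0: "0 \<le> of_int \<lfloor>real (4 * s) * t\<rfloor> / real (4 * s) \<and> of_int \<lfloor>real (4 * s) * t\<rfloor> / real (4 * s) \<le> t \<and>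
      t - of_int \<lfloor>real (4 * s) * t\<rfloor> / real (4 * s) \<le> 1 / real (4 * s)" if "0 \<le> t" for t
  proof -
    have "0 \<le> \<lfloor>real (4 * s) * t\<rfloor>" using that s by simp
    moreover have "of_int \<lfloor>real (4 * s) * t\<rfloor> / real (4 * s) \<le> (real (4 * s) * t) / real (4 * s)"
      by (intro divide_right_mono) auto
    moreover have "(real (4 * s) * t - 1) / real (4 * s) \<le> of_int \<lfloor>real (4 * s) * t\<rfloor> / real (4 * s)"
      by (intro divide_right_mono) linarith+
    moreover have "(real (4 * s) * t) / real (4 * s) = t" "(real (4 * s) * t - 1) / real (4 * s) = t - 1 / real (4 * s)"
      using s4 by (simp_all add: diff_divide_distrib)
    ultimately show ?thesis using s4 by (auto simp del: of_nat_mult)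
  qed
  have g: "\<bar>g t\<bar> \<le> \<bar>t\<bar>" "\<bar>t - g t\<bar> \<le> 1 / real (4 * s)" for t
    using r0[of t] r0[of "- t"] by (cases "0 \<le> t"; simp add: g_def r_def; linarith)+
  have g0: "g 0 = 0" by (simp add: g_def r_def)
  have "snorm N s A \<le> 2 * M + snorm N s A / 2"
  proof (rule snorm_bound)
    fix S x y
    assume x: "sparse_on N s S x" and y: "sparse_on N s S y"
      and nx: "(\<Sum>j\<in>S. (x j)\<^sup>2) = 1" and ny: "(\<Sum>j\<in>S. (y j)\<^sup>2) = 1"
    have fin: "finite S" using x finite_subset by (auto simp: sparse_on_def)
    have sp: "sparse_on N s S (\<lambda>j. g (z j))" "sparse_on N s S (\<lambda>j. z j - g (z j))"
      "(\<Sum>j\<in>S. (g (z j))\<^sup>2) \<le> 1\<^sup>2" "(\<Sum>j\<in>S. (z j - g (z j))\<^sup>2) \<le> (1/4)\<^sup>2"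
      if z: "sparse_on N s S z" "(\<Sum>j\<in>S. (z j)\<^sup>2) = 1" for z
    proof -
      show "sparse_on N s S (\<lambda>j. g (z j))" "sparse_on N s S (\<lambda>j. z j - g (z j))"
        using z(1) by (auto simp: sparse_on_def g0)
      have "(\<Sum>j\<in>S. (g (z j))\<^sup>2) \<le> (\<Sum>j\<in>S. (z j)\<^sup>2)"
        using g(1) by (intro sum_mono) (simp add: abs_le_square_iff)
      then show "(\<Sum>j\<in>S. (g (z j))\<^sup>2) \<le> 1\<^sup>2" by (simp add: z(2))
      have "(\<Sum>j\<in>S. (z j - g (z j))\<^sup>2) \<le> (\<Sum>j\<in>S. (1 / real (4 * s))\<^sup>2)"
        using power_mono[OF g(2), of _ 2] by (intro sum_mono) simp
      also have "\<dots> \<le> real s * (1 / real (4 * s))\<^sup>2"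
        using z(1) by (simp add: sparse_on_def mult_right_mono)
      also have "\<dots> \<le> (1/4)\<^sup>2" using s by (simp add: power2_eq_square field_simps)
      finally show "(\<Sum>j\<in>S. (z j - g (z j))\<^sup>2) \<le> (1/4)\<^sup>2" .
    qed
    define a where "a = (\<lambda>j. g (x j))"
    define b where "b = (\<lambda>j. g (y j))"
    have ab: "(\<lambda>j. (a j + e * b j) / 2) \<in> grid N s" if e: "e = 1 \<or> e = -1" for e
    proof -
      have 1: "sparse_on N s S (\<lambda>j. (a j + e * b j) / 2)"
        using sp(1)[OF x nx] sp(1)[OF y ny] by (auto simp: sparse_on_def a_def b_def)
      have "((a j + e * b j) / 2)\<^sup>2 \<le> ((a j)\<^sup>2 + (b j)\<^sup>2) / 2" for j
        using e zero_le_power2[of "a j - b j"] zero_le_power2[of "a j + b j"]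
        by (auto simp: power2_eq_square field_simps)
      then have "(\<Sum>j\<in>S. ((a j + e * b j) / 2)\<^sup>2) \<le> (\<Sum>j\<in>S. ((a j)\<^sup>2 + (b j)\<^sup>2) / 2)"
        by (intro sum_mono)
      also have "\<dots> \<le> 1"
        using sp(3)[OF x nx] sp(3)[OF y ny] by (simp add: a_def b_def sum.distrib sum_divide_distrib[symmetric])
      finally have 2: "(\<Sum>j\<in>{1..N}. ((a j + e * b j) / 2)\<^sup>2) \<le> 1"
        using sparse_sum[OF 1, of "\<lambda>t. t\<^sup>2"] by simp
      have rb: "\<bar>r (z j)\<bar> \<le> int (4 * s)" if "sparse_on N s S z" "(\<Sum>j\<in>S. (z j)\<^sup>2) = 1" for z j
      proof -
        have "\<bar>z j\<bar> \<le> 1"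
        proof (cases "j \<in> S")
          case True
          then have "(z j)\<^sup>2 \<le> (\<Sum>j\<in>S. (z j)\<^sup>2)" using fin by (intro member_le_sum) auto
          then show ?thesis using that(2) by (simp add: abs_square_le_1)
        qed (use that in \<open>simp add: sparse_on_def\<close>)
        with g(1)[of "z j"] have "\<bar>g (z j)\<bar> \<le> 1" by linarith
        then have "real_of_int \<bar>r (z j)\<bar> \<le> real (4 * s)"
          using s4 by (simp add: g_def abs_divide)
        then show ?thesis by linarith
      qed
      have "(a j + e * b j) / 2 = of_int (r (x j) + (if e = 1 then r (y j) else - r (y j))) / real (8 * s)" for j
        using e s by (auto simp: a_def b_def g_def field_simps)
      moreover have "r (x j) + (if e = 1 then r (y j) else - r (y j)) \<in> {- int (8 * s)..int (8 * s)}" for j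
        using rb[OF x nx, of j] rb[OF y ny, of j] by auto
      ultimately have 3: "\<forall>j. \<exists>k\<in>{- int (8 * s)..int (8 * s)}. (a j + e * b j) / 2 = of_int k / real (8 * s)"
        by blast
      from 1 2 3 show ?thesis unfolding grid_def by blast
    qed
    \<comment> \<open>Polarisation, which relies on the symmetry of \<open>A\<close>.\<close>
    have "bilinear N A (\<lambda>j. (a j + 1 * b j) / 2) (\<lambda>j. (a j + 1 * b j) / 2) -
        bilinear N A (\<lambda>j. (a j + -1 * b j) / 2) (\<lambda>j. (a j + -1 * b j) / 2) = (bilinear N A b a + bilinear N A a b) / 2"
      by (simp add: bilinear_def sum_subtractf[symmetric] sum.distrib[symmetric] sum_divide_distrib algebra_simps
          add_divide_distrib diff_divide_distrib)
    also have "\<dots> = bilinear N A b a" using bilinear_commute[of A N a b, OF sym] by simp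
    finally have "\<bar>bilinear N A b a\<bar> \<le> 2 * M" using M[OF ab[of 1]] M[OF ab[of "-1"]] by simp
    moreover have "\<bar>bilinear N A (\<lambda>j. y j - b j) x\<bar> \<le> 1 * (1/4) * snorm N s A"
      unfolding b_def
      by (rule bilinear_le_snorm[OF x sp(2)[OF y ny] _ _ sp(4)[OF y ny]]) (use nx s in auto)
    moreover have "\<bar>bilinear N A b (\<lambda>j. x j - a j)\<bar> \<le> (1/4) * 1 * snorm N s A"
      unfolding a_def b_def
      by (rule bilinear_le_snorm[OF sp(2)[OF x nx] sp(1)[OF y ny] sp(4)[OF x nx] _ sp(3)[OF y ny]]) (use s in auto)
    moreover have "bilinear N A y x = bilinear N A b a + bilinear N A b (\<lambda>j. x j - a j) + bilinear N A (\<lambda>j. y j - b j) x"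
      using bilinear_add_left[of N A b "\<lambda>j. y j - b j" x] bilinear_add_right[of N A b a "\<lambda>j. x j - a j"] by simp
    ultimately show "\<bar>bilinear N A y x\<bar> \<le> 2 * M + snorm N s A / 2" by linarith
  qed (use s in auto)
  then show ?thesis by (simp add: M_def)
qed

section \<open>Covering numbers\<close>

text \<open>The Maurey sums used as centres need not lie in \<open>T\<close>. Points assigned to the
  same centre share one representative in \<open>T\<close>, at the price of comparing distances
  through that centre.\<close>

lemma finite_covering:
  assumes T: "finite T" and C: "finite C" and R: "\<And>u. u \<in> T \<Longrightarrow> \<exists>c\<in>C. R u c"
  shows "\<exists>\<pi>. (\<forall>u\<in>T. \<pi> u \<in> T \<and> (\<exists>c\<in>C. R u c \<and> R (\<pi> u) c)) \<and> card (\<pi> ` T) \<le> card C"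
proof -
  obtain f where f: "\<And>u. u \<in> T \<Longrightarrow> f u \<in> C \<and> R u (f u)"
    using bchoice[of T "\<lambda>u c. c \<in> C \<and> R u c"] R by blast
  define \<pi> where "\<pi> = inv_into T f \<circ> f"
  have \<pi>: "\<pi> u \<in> T" "f (\<pi> u) = f u" if "u \<in> T" for u
    using that by (auto simp: \<pi>_def inv_into_into f_inv_into_f)
  have "card (\<pi> ` T) \<le> card (f ` T)"
    unfolding \<pi>_def image_comp[symmetric] by (rule card_image_le) (simp add: T)
  also have "\<dots> \<le> card C" using f C by (intro card_mono) auto
  finally show ?thesis using \<pi> f by (metis (no_types))
qed

text \<open>u / sqrt s lies in the l1 ball, the convex hull of the signed unit vectors, and the
  spectrum of each of these has energy at most 1. The frequencies are the index set of the
  seminorms, whence ln m.\<close>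

lemma maurey_spec:
  assumes "0 < m" "0 < s" "0 < n * p" "0 < K" and l1: "(\<Sum>j\<in>{1..n * p}. \<bar>u j\<bar>) \<le> sqrt (real s)"
  defines "E \<equiv> \<lambda>k x i. if block n k = i then root_of_unity m (- (int x * int (offset n k))) else 0"
  shows "\<exists>ks. length ks = K \<and> set ks \<subseteq> {1..n * p} \<times> {-1, 1} \<and>
    (\<forall>x<m. (\<Sum>i\<in>{1..p}. (cmod ((sqrt (real s) / real K) *\<^sub>R (\<Sum>(k, e)\<leftarrow>ks. e *\<^sub>R E k x i) - spectrum n m p u x i))\<^sup>2)
      \<le> 64 * real s * (ln (real m) + 1) / real K)"
proof -
  define N where "N = n * p"
  define t where "t = sqrt (real s)"
  have t: "0 < t" "t\<^sup>2 = real s" using assms by (auto simp: t_def)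
  have N: "0 < real N" using assms by (simp add: N_def)
  \<comment> \<open>The missing mass is spread evenly over all signed unit vectors: the weights then
    sum to 1, and opposite signs cancel in the mean.\<close>
  define d where "d = (1 - (\<Sum>j\<in>{1..N}. \<bar>u j\<bar>) / t) / (2 * real N)"
  have d: "0 \<le> d" using l1 t N by (simp add: d_def N_def t_def)
  define w where "w = (\<lambda>(k, e). (\<bar>u k\<bar> + e * u k) / (2 * t) + d)"
  define X where "X = (\<lambda>(k, e) x i. e *\<^sub>R E k x i)"
  define Q where "Q = {1..N} \<times> {-1, 1 :: real}"
  have sumQ: "(\<Sum>z\<in>Q. f z) = (\<Sum>k\<in>{1..N}. f (k, -1) + f (k, 1))" for f :: "nat \<times> real \<Rightarrow> 'z::comm_monoid_add"
    unfolding Q_def by (simp add: sum.cartesian_product')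
  have "\<exists>ks. length ks = K \<and> set ks \<subseteq> Q \<and>
    (\<forall>x\<in>{..<m}. (\<Sum>i\<in>{1..p}. (cmod ((\<Sum>z\<leftarrow>ks. X z x i) - real K *\<^sub>R (\<Sum>z\<in>Q. w z *\<^sub>R X z x i)))\<^sup>2)
      \<le> 64 * real K * (ln (real (card {..<m})) + 1))"
  proof (rule maurey)
    show "finite Q" by (simp add: Q_def)
    show "0 \<le> w z" if "z \<in> Q" for z
    proof -
      obtain k e where z: "z = (k, e)" "e = -1 \<or> e = 1" using \<open>z \<in> Q\<close> by (auto simp: Q_def)
      then have "0 \<le> \<bar>u k\<bar> + e * u k" by (auto simp: abs_if)
      then have "0 \<le> (\<bar>u k\<bar> + e * u k) / (2 * t)" using t by (intro divide_nonneg_pos) auto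
      then show ?thesis unfolding w_def z(1) using d by simp
    qed
    have "sum w Q = (\<Sum>k\<in>{1..N}. \<bar>u k\<bar> / t + 2 * d)"
      unfolding sumQ w_def using t by (intro sum.cong refl) (simp add: field_simps)
    also have "\<dots> = (\<Sum>j\<in>{1..N}. \<bar>u j\<bar>) / t + real N * (2 * d)"
      by (simp add: sum.distrib sum_divide_distrib)
    also have "real N * (2 * d) = 1 - (\<Sum>j\<in>{1..N}. \<bar>u j\<bar>) / t"
      unfolding d_def using N by simp
    also have "(\<Sum>j\<in>{1..N}. \<bar>u j\<bar>) / t + (1 - (\<Sum>j\<in>{1..N}. \<bar>u j\<bar>) / t) = 1" by simp
    finally show "sum w Q = 1" .
    show "(\<Sum>i\<in>{1..p}. (cmod (X z x i))\<^sup>2) \<le> 1" if "z \<in> Q" for z x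
    proof -
      obtain k e where z: "z = (k, e)" "\<bar>e\<bar> = 1" using \<open>z \<in> Q\<close> by (auto simp: Q_def)
      have "(cmod (X z x i))\<^sup>2 = (if block n k = i then 1 else 0)" for i
        using z by (simp add: X_def E_def)
      then show ?thesis by simp
    qed
  qed (use assms in auto)
  then obtain ks where ks: "length ks = K" "set ks \<subseteq> Q"
    "\<And>x. x < m \<Longrightarrow> (\<Sum>i\<in>{1..p}. (cmod ((\<Sum>z\<leftarrow>ks. X z x i) - real K *\<^sub>R (\<Sum>z\<in>Q. w z *\<^sub>R X z x i)))\<^sup>2)
      \<le> 64 * real K * (ln (real m) + 1)" by auto
  have mean: "(\<Sum>z\<in>Q. w z *\<^sub>R X z x i) = (1 / t) *\<^sub>R spectrum n m p u x i" for x i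
  proof -
    have "(\<Sum>z\<in>Q. w z *\<^sub>R X z x i) = (\<Sum>k\<in>{1..N}. (w (k, 1) - w (k, -1)) *\<^sub>R E k x i)"
      unfolding sumQ X_def by (intro sum.cong refl) (simp add: scaleR_diff_left)
    also have "\<dots> = (\<Sum>k\<in>{1..N}. (1 / t) *\<^sub>R (u k *\<^sub>R E k x i))"
      using t by (intro sum.cong refl) (simp add: w_def field_simps)
    also have "\<dots> = (1 / t) *\<^sub>R spectrum n m p u x i"
      by (simp add: spectrum_def E_def N_def scaleR_sum_right)
    finally show ?thesis .
  qed
  have "(\<Sum>i\<in>{1..p}. (cmod ((t / real K) *\<^sub>R (\<Sum>z\<leftarrow>ks. X z x i) - spectrum n m p u x i))\<^sup>2)
      \<le> 64 * real s * (ln (real m) + 1) / real K" if x: "x < m" for x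
  proof -
    have "(t / real K) *\<^sub>R (\<Sum>z\<leftarrow>ks. X z x i) - spectrum n m p u x i =
        (t / real K) *\<^sub>R ((\<Sum>z\<leftarrow>ks. X z x i) - real K *\<^sub>R (\<Sum>z\<in>Q. w z *\<^sub>R X z x i))" for i
      using t assms unfolding mean by (simp add: scaleR_diff_right)
    then have "(\<Sum>i\<in>{1..p}. (cmod ((t / real K) *\<^sub>R (\<Sum>z\<leftarrow>ks. X z x i) - spectrum n m p u x i))\<^sup>2) =
        (t / real K)\<^sup>2 * (\<Sum>i\<in>{1..p}. (cmod ((\<Sum>z\<leftarrow>ks. X z x i) - real K *\<^sub>R (\<Sum>z\<in>Q. w z *\<^sub>R X z x i)))\<^sup>2)"
      by (simp only: norm_scaleR power_mult_distrib sum_distrib_left power2_abs)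
    also have "\<dots> \<le> (t / real K)\<^sup>2 * (64 * real K * (ln (real m) + 1))"
      by (intro mult_left_mono ks(3) x) simp
    also have "\<dots> = 64 * real s * (ln (real m) + 1) / real K"
      using t assms by (simp add: power_divide power2_eq_square)
    finally show ?thesis .
  qed
  with ks(1,2) show ?thesis
    unfolding X_def t_def Q_def N_def by (intro exI[of _ ks]) (simp add: case_prod_unfold)
qed

text \<open>The centres are words of length K over the 2 n p signed unit vectors. Passing to
  representatives inside \<open>T\<close> turns 64 into 2 * 64 + 2 * 64 = 256.\<close>

lemma energy_covering:
  assumes "0 < m" "0 < s" "0 < n * p" "0 < K" "finite T"
    and l1: "\<And>u. u \<in> T \<Longrightarrow> (\<Sum>j\<in>{1..n * p}. \<bar>u j\<bar>) \<le> sqrt (real s)"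
  shows "\<exists>\<pi>. (\<forall>u\<in>T. \<pi> u \<in> T \<and>
      (\<forall>x<m. energy n m p (\<lambda>c. u c - \<pi> u c) x \<le> 256 * real s * (ln (real m) + 1) / real K)) \<and>
    card (\<pi> ` T) \<le> (2 * (n * p)) ^ K"
proof -
  let ?X = "\<lambda>ks x i. (sqrt (real s) / real K) *\<^sub>R (\<Sum>(k, e)\<leftarrow>ks. e *\<^sub>R
      (if block n k = i then root_of_unity m (- (int x * int (offset n k))) else 0))"
  define R where "R = (\<lambda>u ks. \<forall>x<m. (\<Sum>i\<in>{1..p}. (cmod (?X ks x i - spectrum n m p u x i))\<^sup>2)
      \<le> 64 * real s * (ln (real m) + 1) / real K)"
  define C where "C = {ks. set ks \<subseteq> {1..n * p} \<times> {-1, 1 :: real} \<and> length ks = K}"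
  have finC: "finite C" unfolding C_def by (rule finite_lists_length_eq) simp
  have "card C = card ({1..n * p} \<times> {-1, 1 :: real}) ^ K"
    unfolding C_def by (rule card_lists_length_eq) simp
  also have "card ({1..n * p} \<times> {-1, 1 :: real}) = 2 * (n * p)" by (simp add: card_cartesian_product)
  finally have cardC: "card C = (2 * (n * p)) ^ K" .
  have "\<exists>c\<in>C. R u c" if "u \<in> T" for u
    using maurey_spec[OF assms(1-4) l1[OF that]] unfolding C_def R_def by blast
  from finite_covering[OF assms(5) finC, where R = R, OF this] obtain \<pi> where
    \<pi>: "\<And>u. u \<in> T \<Longrightarrow> \<pi> u \<in> T \<and> (\<exists>c\<in>C. R u c \<and> R (\<pi> u) c)" "card (\<pi> ` T) \<le> card C"
    by blast
  have "energy n m p (\<lambda>c. u c - \<pi> u c) x \<le> 256 * real s * (ln (real m) + 1) / real K"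
    if uT: "u \<in> T" and xm: "x < m" for u x
  proof -
    obtain ks where ks: "R u ks" "R (\<pi> u) ks" using \<pi>(1)[OF uT] by blast
    have "energy n m p (\<lambda>c. u c - \<pi> u c) x \<le> (\<Sum>i\<in>{1..p}.
        2 * (cmod (?X ks x i - spectrum n m p u x i))\<^sup>2 + 2 * (cmod (?X ks x i - spectrum n m p (\<pi> u) x i))\<^sup>2)"
      unfolding energy_def spectrum_diff
    proof (rule sum_mono)
      fix i
      have "(cmod (a - b))\<^sup>2 \<le> 2 * (cmod (c - a))\<^sup>2 + 2 * (cmod (c - b))\<^sup>2" for a b c
      proof -
        have "cmod (a - b) \<le> cmod (c - a) + cmod (c - b)"
          using norm_triangle_ineq4[of "c - b" "c - a"] by (simp add: algebra_simps)
        then have "(cmod (a - b))\<^sup>2 \<le> (cmod (c - a) + cmod (c - b))\<^sup>2" by (rule power_mono) simp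
        also have "\<dots> \<le> 2 * (cmod (c - a))\<^sup>2 + 2 * (cmod (c - b))\<^sup>2"
          using zero_le_power2[of "cmod (c - a) - cmod (c - b)"] by (simp add: power2_eq_square algebra_simps)
        finally show ?thesis .
      qed
      then show "(cmod (spectrum n m p u x i - spectrum n m p (\<pi> u) x i))\<^sup>2 \<le>
        2 * (cmod (?X ks x i - spectrum n m p u x i))\<^sup>2 + 2 * (cmod (?X ks x i - spectrum n m p (\<pi> u) x i))\<^sup>2" .
    qed
    also have "\<dots> = 2 * (\<Sum>i\<in>{1..p}. (cmod (?X ks x i - spectrum n m p u x i))\<^sup>2) +
        2 * (\<Sum>i\<in>{1..p}. (cmod (?X ks x i - spectrum n m p (\<pi> u) x i))\<^sup>2)"
      by (simp only: sum.distrib sum_distrib_left)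
    also have "\<dots> \<le> 2 * (64 * real s * (ln (real m) + 1) / real K) + 2 * (64 * real s * (ln (real m) + 1) / real K)"
      using ks xm unfolding R_def by (intro add_mono mult_left_mono) auto
    finally show ?thesis by simp
  qed
  with \<pi> show ?thesis unfolding cardC by blast
qed

text \<open>Every column meets a single channel, with a coefficient of modulus one. This bounds the
  coarsest scale, where the approximation is the zero vector.\<close>

lemma energy_le_l1:
  assumes "0 \<le> b" "(\<Sum>j\<in>{1..n * p}. \<bar>u j\<bar>) \<le> b"
  shows "energy n m p u x \<le> b\<^sup>2"
proof -
  define E where "E = (\<lambda>k i. if block n k = i then root_of_unity m (- (int x * int (offset n k))) else 0)"
  have "energy n m p u x \<le> (\<Sum>i\<in>{1..p}. (\<Sum>k\<in>{1..n * p}. \<bar>u k\<bar> * cmod (E k i))\<^sup>2)"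
    unfolding energy_def spectrum_def
    by (intro sum_mono power_mono norm_sum[THEN order_trans] sum_mono) (auto simp: E_def)
  also have "\<dots> \<le> (\<Sum>i\<in>{1..p}. b * (\<Sum>k\<in>{1..n * p}. \<bar>u k\<bar> * cmod (E k i)))"
  proof (intro sum_mono)
    fix i
    have "(\<Sum>k\<in>{1..n * p}. \<bar>u k\<bar> * cmod (E k i)) \<le> (\<Sum>k\<in>{1..n * p}. \<bar>u k\<bar> * 1)"
      by (intro sum_mono mult_left_mono) (auto simp: E_def)
    then have "(\<Sum>k\<in>{1..n * p}. \<bar>u k\<bar> * cmod (E k i)) \<le> b" using assms(2) by simp
    then show "(\<Sum>k\<in>{1..n * p}. \<bar>u k\<bar> * cmod (E k i))\<^sup>2 \<le> b * (\<Sum>k\<in>{1..n * p}. \<bar>u k\<bar> * cmod (E k i))"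
      unfolding power2_eq_square by (intro mult_right_mono sum_nonneg) auto
  qed
  also have "\<dots> = b * (\<Sum>k\<in>{1..n * p}. \<bar>u k\<bar> * (\<Sum>i\<in>{1..p}. cmod (E k i)))"
    unfolding sum_distrib_left[symmetric] by (subst sum.swap) (simp add: sum_distrib_left)
  also have "\<dots> \<le> b * (\<Sum>k\<in>{1..n * p}. \<bar>u k\<bar> * 1)"
    by (intro mult_left_mono sum_mono assms) (auto simp: E_def if_distrib[of cmod] cong: if_cong)
  also have "\<dots> \<le> b * b" using assms by (intro mult_left_mono) auto
  finally show ?thesis by (simp add: power2_eq_square)
qed

section \<open>Chaining for the decoupled chaos\<close>

definition Phi_form :: "nat \<Rightarrow> nat \<Rightarrow> nat \<Rightarrow> (nat \<Rightarrow> real) \<Rightarrow> (nat \<Rightarrow> real) \<Rightarrow>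
    (nat \<times> nat \<Rightarrow> real) \<Rightarrow> (nat \<times> nat \<Rightarrow> real) \<Rightarrow> real" where
  "Phi_form n m p w v g h = (\<Sum>r\<in>{1..m}. Phi_apply n m p g w r * Phi_apply n m p h v r)"

lemma Phi_apply_diff: "Phi_apply n m p g (\<lambda>c. u c - v c) r = Phi_apply n m p g u r - Phi_apply n m p g v r"
  by (simp add: Phi_apply_def right_diff_distrib sum_subtractf)

text \<open>Both terms carry the increment in the first slot; the second has the probes exchanged.
  Each is thus a Gaussian linear form in the probe attached to the increment, given the other
  one.\<close>

lemma Phi_form_telescope: "Phi_form n m p b b g h - Phi_form n m p a a g h =
    Phi_form n m p (\<lambda>c. b c - a c) b g h + Phi_form n m p (\<lambda>c. b c - a c) a h g"
  by (simp add: Phi_form_def Phi_apply_diff sum_subtractf[symmetric] sum.distrib[symmetric] algebra_simps)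

lemma Phi_form_zero: "Phi_form n m p (\<lambda>_. 0) v g h = 0"
  by (simp add: Phi_form_def Phi_apply_def)

lemma Phi_form_adj: "0 < m \<Longrightarrow>
    Phi_form n m p w v g h = (\<Sum>x\<in>{1..p} \<times> {1..m}. adj n m p w (Phi_apply n m p h v) x * g x)"
  by (subst adj_duality[symmetric]) (simp_all add: Phi_form_def mult.commute)

lemma Phi_apply_restrict:
  assumes "0 < m"
  shows "Phi_apply n m p (\<lambda>i\<in>{1..p} \<times> {1..m}. g i) u r = Phi_apply n m p g u r"
  unfolding Phi_apply_def using tap_range[OF assms, of _ n p r]
  by (intro sum.cong refl) (auto simp: restrict_def)

text \<open>Difference of squares, a^2 - b^2 = 2 * ((a - b) / sqrt 2) * ((a + b) / sqrt 2), row by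
  row.\<close>

lemma Phi_form_rotate:
  assumes "0 < m"
  shows "Phi_form n m p u u g g - Phi_form n m p u u h h = 2 * Phi_form n m p u u
    (\<lambda>i\<in>{1..p} \<times> {1..m}. (g i - h i) / sqrt 2) (\<lambda>i\<in>{1..p} \<times> {1..m}. (g i + h i) / sqrt 2)"
proof -
  have 1: "Phi_apply n m p (\<lambda>i. (g i - h i) / sqrt 2) u r =
      (Phi_apply n m p g u r - Phi_apply n m p h u r) / sqrt 2"
    and 2: "Phi_apply n m p (\<lambda>i. (g i + h i) / sqrt 2) u r =
      (Phi_apply n m p g u r + Phi_apply n m p h u r) / sqrt 2" for r
    by (simp_all add: Phi_apply_def sum_divide_distrib sum_subtractf[symmetric] sum.distrib[symmetric]
        left_diff_distrib distrib_right diff_divide_distrib add_divide_distrib)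
  have "2 * ((a - b) / sqrt 2 * ((a + b) / sqrt 2)) = a * a - b * b" for a b :: real
    by (simp add: field_simps)
  then show ?thesis
    unfolding Phi_form_def Phi_apply_restrict[OF assms] 1 2 sum_subtractf[symmetric] sum_distrib_left by (simp only:)
qed

lemma Phi_apply_measurable:
  assumes "0 < m"
  shows "(\<lambda>g. Phi_apply n m p g u r) \<in> borel_measurable (gauss_vec \<sigma> ({1..p} \<times> {1..m}))"
  unfolding Phi_apply_def
  by (intro borel_measurable_sum borel_measurable_times borel_measurable_const gauss_vec_component
      tap_range[OF assms])

lemma Phi_form_measurable:
  fixes n m p :: nat and \<sigma> :: real
  assumes "0 < m"
  defines "G \<equiv> gauss_vec \<sigma> ({1..p} \<times> {1..m})"
  shows "(\<lambda>g. Phi_form n m p u v g g) \<in> borel_measurable G"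
    and "(\<lambda>z. Phi_form n m p u v (fst z) (snd z)) \<in> borel_measurable (G \<Otimes>\<^sub>M G)"
    and "(\<lambda>z. Phi_form n m p u v (snd z) (fst z)) \<in> borel_measurable (G \<Otimes>\<^sub>M G)"
    and "(\<lambda>z. Phi_form n m p u v (fst z) (fst z)) \<in> borel_measurable (G \<Otimes>\<^sub>M G)"
    and "(\<lambda>z. Phi_form n m p u v (snd z) (snd z)) \<in> borel_measurable (G \<Otimes>\<^sub>M G)"
  unfolding Phi_form_def G_def
  by (intro borel_measurable_sum borel_measurable_times Phi_apply_measurable[OF assms(1)]
      measurable_compose[OF measurable_fst Phi_apply_measurable[OF assms(1)]]
      measurable_compose[OF measurable_snd Phi_apply_measurable[OF assms(1)]])+

text \<open>By \<open>tap_inj\<close> the squared coefficients of each row sum to the squared norm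
  of \<open>u\<close>; there are m rows and each variable has variance 1 / m.\<close>

lemma Phi_form_expectation:
  fixes n m p :: nat
  assumes "0 < n" "n \<le> m"
  defines "G \<equiv> gauss_vec (1 / sqrt (real m)) ({1..p} \<times> {1..m})"
  shows "integrable G (\<lambda>g. Phi_form n m p u u g g)"
    and "(\<integral>g. Phi_form n m p u u g g \<partial>G) = (\<Sum>j\<in>{1..n * p}. (u j)\<^sup>2)"
proof -
  have m: "0 < m" using assms by simp
  let ?I = "{1..p} \<times> {1..m}"
  define b where "b = (\<lambda>r x. \<Sum>col\<in>{1..n * p}. if tap n m r col = x then u col else 0)"
  have Phi: "Phi_apply n m p g u r = (\<Sum>x\<in>?I. b r x * g x)" for g r
  proof -
    have "(\<Sum>x\<in>?I. b r x * g x) = (\<Sum>x\<in>?I. \<Sum>col\<in>{1..n * p}. if tap n m r col = x then g x * u col else 0)"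
      unfolding b_def sum_distrib_right by (intro sum.cong refl) simp
    also have "\<dots> = (\<Sum>col\<in>{1..n * p}. \<Sum>x\<in>?I. if tap n m r col = x then g x * u col else 0)"
      by (rule sum.swap)
    also have "\<dots> = (\<Sum>col\<in>{1..n * p}. g (tap n m r col) * u col)"
      using tap_range[OF m, of _ n p r] by (intro sum.cong refl) (simp add: sum.delta')
    finally show ?thesis by (simp add: Phi_apply_def)
  qed
  have b2: "(\<Sum>x\<in>?I. (b r x)\<^sup>2) = (\<Sum>j\<in>{1..n * p}. (u j)\<^sup>2)" for r
  proof -
    note inj = tap_inj[OF assms(1,2), of r p]
    have "(\<Sum>x\<in>?I. (b r x)\<^sup>2) = (\<Sum>x\<in>tap n m r ` {1..n * p}. (b r x)\<^sup>2)"
    proof (rule sum.mono_neutral_right)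
      show "tap n m r ` {1..n * p} \<subseteq> ?I" using tap_range[OF m, of _ n p r] by blast
      show "\<forall>x\<in>?I - tap n m r ` {1..n * p}. (b r x)\<^sup>2 = 0"
      proof
        fix x assume "x \<in> ?I - tap n m r ` {1..n * p}"
        then have "tap n m r col \<noteq> x" if "col \<in> {1..n * p}" for col using that by blast
        then show "(b r x)\<^sup>2 = 0" unfolding b_def by simp
      qed
    qed simp
    also have "\<dots> = (\<Sum>j\<in>{1..n * p}. (b r (tap n m r j))\<^sup>2)"
      by (rule sum.reindex_cong[OF inj refl refl])
    also have "\<dots> = (\<Sum>j\<in>{1..n * p}. (u j)\<^sup>2)"
    proof (intro sum.cong refl)
      fix j assume j: "j \<in> {1..n * p}"
      have "b r (tap n m r j) = (\<Sum>col\<in>{1..n * p}. if col = j then u col else 0)"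
        unfolding b_def using inj_onD[OF inj _ _ j] by (intro sum.cong refl) auto
      then show "(b r (tap n m r j))\<^sup>2 = (u j)\<^sup>2" using j by simp
    qed
    finally show ?thesis .
  qed
  have sm: "0 < 1 / sqrt (real m)" and fin: "finite ?I" using m by auto
  note sq = gauss_vec_square[OF sm fin, folded G_def]
  have Phi_form: "Phi_form n m p u u g g = (\<Sum>r\<in>{1..m}. (\<Sum>x\<in>?I. b r x * g x)\<^sup>2)" for g
    by (simp add: Phi_form_def Phi power2_eq_square)
  show "integrable G (\<lambda>g. Phi_form n m p u u g g)"
    unfolding Phi_form by (intro Bochner_Integration.integrable_sum sq)
  have "(\<integral>g. Phi_form n m p u u g g \<partial>G) = (\<Sum>r\<in>{1..m}. (1 / sqrt (real m))\<^sup>2 * (\<Sum>j\<in>{1..n * p}. (u j)\<^sup>2))"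
    unfolding Phi_form by (subst Bochner_Integration.integral_sum[OF sq(1)]) (simp only: sq(2) b2)
  also have "\<dots> = (\<Sum>j\<in>{1..n * p}. (u j)\<^sup>2)" using m by (simp add: power_divide)
  finally show "(\<integral>g. Phi_form n m p u u g g \<partial>G) = (\<Sum>j\<in>{1..n * p}. (u j)\<^sup>2)" .
qed

lemma bilinear_gram_dev:
  "bilinear (n * p) (gram_dev n m phi) u u = (\<Sum>j\<in>{1..n * p}. (u j)\<^sup>2) - Phi_form n m p u u phi phi"
proof -
  have "bilinear (n * p) (gram_dev n m phi) u u =
      (\<Sum>j\<in>{1..n * p}. \<Sum>k\<in>{1..n * p}. if j = k then u j * u k else 0) -
      (\<Sum>j\<in>{1..n * p}. \<Sum>k\<in>{1..n * p}. \<Sum>r\<in>{1..m}. phi (tap n m r j) * u j * (phi (tap n m r k) * u k))"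
    unfolding bilinear_def gram_dev_def Phi_entry_tap sum_subtractf[symmetric]
    by (intro sum.cong refl) (simp add: algebra_simps sum_distrib_left sum_distrib_right)
  also have "(\<Sum>j\<in>{1..n * p}. \<Sum>k\<in>{1..n * p}. if j = k then u j * u k else 0) = (\<Sum>j\<in>{1..n * p}. (u j)\<^sup>2)"
    by (intro sum.cong refl) (simp add: sum.delta power2_eq_square)
  also have "(\<Sum>j\<in>{1..n * p}. \<Sum>k\<in>{1..n * p}. \<Sum>r\<in>{1..m}. phi (tap n m r j) * u j * (phi (tap n m r k) * u k)) =
      (\<Sum>r\<in>{1..m}. \<Sum>j\<in>{1..n * p}. \<Sum>k\<in>{1..n * p}. phi (tap n m r j) * u j * (phi (tap n m r k) * u k))"
    by (rule trans[OF sum.cong[OF refl sum.swap] sum.swap])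
  also have "\<dots> = Phi_form n m p u u phi phi"
    by (simp add: Phi_form_def Phi_apply_def sum_product)
  finally show ?thesis .
qed

lemma gram_dev_commute: "gram_dev n m phi j k = gram_dev n m phi k j"
  by (simp add: gram_dev_def mult.commute)

text \<open>The quantity D of the overview, for a finite set \<open>T\<close> in place of the
  grid.\<close>

definition defect :: "nat \<Rightarrow> nat \<Rightarrow> nat \<Rightarrow> (nat \<Rightarrow> real) set \<Rightarrow> (nat \<times> nat \<Rightarrow> real) \<Rightarrow> real" where
  "defect n m p T g = Max ((\<lambda>u. \<bar>(\<Sum>j\<in>{1..n * p}. (u j)\<^sup>2) - Phi_form n m p u u g g\<bar>) ` T)"

lemma defect_measurable:
  assumes "0 < m" "finite T"
  shows "defect n m p T \<in> borel_measurable (gauss_vec \<sigma> ({1..p} \<times> {1..m}))"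
  unfolding defect_def
  by (intro borel_measurable_Max assms borel_measurable_abs borel_measurable_diff borel_measurable_const
      Phi_form_measurable(1))

text \<open>With \<open>h\<close> frozen, the coefficient vector in \<open>g\<close> has squared
  norm at most t times that of \<Phi>(h) v, which is at most 1 + D(h). The Gaussian maximal
  inequality is then integrated over \<open>h\<close>.\<close>

lemma link_bound:
  fixes n m p :: nat
  assumes "0 < m" and T: "finite T" "\<And>u. u \<in> T \<Longrightarrow> (\<Sum>j\<in>{1..n * p}. (u j)\<^sup>2) \<le> 1"
    and L: "finite L" "L \<noteq> {}"
      "\<And>w v. (w, v) \<in> L \<Longrightarrow> v \<in> T \<and> (\<forall>x<m. energy n m p w x \<le> t)"
    and t: "0 \<le> t" and B: "1 \<le> B" "ln (2 * real (card L)) \<le> B"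
  defines "G \<equiv> gauss_vec (1 / sqrt (real m)) ({1..p} \<times> {1..m})"
  shows "(\<integral>\<^sup>+h. \<integral>\<^sup>+g. ennreal (Max ((\<lambda>(w, v). \<bar>Phi_form n m p w v g h\<bar>) ` L)) \<partial>G \<partial>G) \<le>
    ennreal (sqrt (2 * B * t / real m)) * (1 + (\<integral>\<^sup>+g. ennreal (defect n m p T g / 2) \<partial>G))"
proof -
  let ?I = "{1..p} \<times> {1..m}"
  have sm: "0 < 1 / sqrt (real m)" and fin: "finite ?I" using assms(1) by auto
  interpret prob_space G unfolding G_def by (rule prob_space_gauss_vec[OF sm])
  have T0: "T \<noteq> {}" using L(2,3) by fastforce
  define D where "D = defect n m p T"
  have Dge: "\<bar>(\<Sum>j\<in>{1..n * p}. (v j)\<^sup>2) - Phi_form n m p v v h h\<bar> \<le> D h" if "v \<in> T" for v h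
    unfolding D_def defect_def using that T(1) by (intro Max_ge) auto
  have D0: "0 \<le> D h" for h using Dge[of _ h] T0 by fastforce
  have Dm: "D \<in> borel_measurable G" unfolding D_def G_def by (rule defect_measurable[OF assms(1) T(1)])
  have "(\<integral>\<^sup>+g. ennreal (Max ((\<lambda>(w, v). \<bar>Phi_form n m p w v g h\<bar>) ` L)) \<partial>G) \<le>
      ennreal (sqrt (2 * B * t / real m)) * (1 + ennreal (D h / 2))" for h
  proof -
    have "(\<integral>\<^sup>+g. ennreal (Max ((\<lambda>j. \<bar>\<Sum>x\<in>?I. adj n m p (fst j) (Phi_apply n m p h (snd j)) x * g x\<bar>) ` L))
        \<partial>gauss_vec (1 / sqrt (real m)) ?I) \<le>
      ennreal (1 / sqrt (real m) * (sqrt t * (1 + D h / 2)) * sqrt (2 * B))"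
    proof (rule gauss_vec_maximal[OF sm fin L(1,2) _ B])
      show "0 \<le> sqrt t * (1 + D h / 2)" using t D0[of h] by simp
      fix j assume "j \<in> L"
      then obtain w v where j: "j = (w, v)" "(w, v) \<in> L" by (cases j) auto
      have "(\<Sum>x\<in>?I. (adj n m p w (Phi_apply n m p h v) x)\<^sup>2) \<le> t * (\<Sum>r\<in>{1..m}. (Phi_apply n m p h v r)\<^sup>2)"
        using L(3)[OF j(2)] by (intro adj_bound[OF assms(1)]) auto
      also have "(\<Sum>r\<in>{1..m}. (Phi_apply n m p h v r)\<^sup>2) = Phi_form n m p v v h h"
        by (simp add: Phi_form_def power2_eq_square)
      also have "t * Phi_form n m p v v h h \<le> t * (1 + D h / 2)\<^sup>2"
      proof (rule mult_left_mono[OF _ t])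
        have "Phi_form n m p v v h h \<le> 1 + D h"
          using Dge[of v h] T(2)[of v] L(3)[OF j(2)] by auto
        \<comment> \<open>A perfect square makes the conditional bound affine in D(h), so E D
          appears directly and Jensen's inequality for the root is avoided.\<close>
        also have "\<dots> \<le> (1 + D h / 2)\<^sup>2"
          by (simp add: power2_eq_square algebra_simps)
        finally show "Phi_form n m p v v h h \<le> (1 + D h / 2)\<^sup>2" .
      qed
      also have "\<dots> = (sqrt t * (1 + D h / 2))\<^sup>2" using t by (simp add: power_mult_distrib)
      finally show "(\<Sum>x\<in>?I. (adj n m p (fst j) (Phi_apply n m p h (snd j)) x)\<^sup>2) \<le>
          (sqrt t * (1 + D h / 2))\<^sup>2" by (simp add: j)
    qed
    also have "1 / sqrt (real m) * (sqrt t * (1 + D h / 2)) * sqrt (2 * B) =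
        sqrt (2 * B * t / real m) * (1 + D h / 2)"
      by (simp add: real_sqrt_mult real_sqrt_divide)
    also have "ennreal \<dots> = ennreal (sqrt (2 * B * t / real m)) * (1 + ennreal (D h / 2))"
      using D0[of h] t B by (simp add: ennreal_mult ennreal_plus)
    finally show ?thesis
      unfolding G_def by (simp only: Phi_form_adj[OF assms(1)] case_prod_unfold)
  qed
  then have "(\<integral>\<^sup>+h. \<integral>\<^sup>+g. ennreal (Max ((\<lambda>(w, v). \<bar>Phi_form n m p w v g h\<bar>) ` L)) \<partial>G \<partial>G) \<le>
      (\<integral>\<^sup>+h. ennreal (sqrt (2 * B * t / real m)) * (1 + ennreal (D h / 2)) \<partial>G)"
    by (intro nn_integral_mono)
  also have "\<dots> = ennreal (sqrt (2 * B * t / real m)) * (1 + (\<integral>\<^sup>+g. ennreal (D g / 2) \<partial>G))"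
    using Dm by (simp add: nn_integral_cmult nn_integral_add emeasure_space_1)
  finally show ?thesis by (simp add: D_def)
qed

text \<open>Each of the J links yields two conditionally Gaussian maxima, hence the factor 2 J. The
  links of level j are determined by pairs of neighbouring projections, so their number is at most
  the product of the two cardinalities.\<close>

lemma chaining:
  fixes n m p J :: nat
  assumes "0 < m" and T: "finite T" "T \<noteq> {}" "\<And>u. u \<in> T \<Longrightarrow> (\<Sum>j\<in>{1..n * p}. (u j)\<^sup>2) \<le> 1"
    and \<pi>: "\<And>j u. j \<le> J \<Longrightarrow> u \<in> T \<Longrightarrow> \<pi> j u \<in> T"
    and \<pi>0: "\<And>u. u \<in> T \<Longrightarrow> \<pi> 0 u = (\<lambda>_. 0)" and \<pi>J: "\<And>u. u \<in> T \<Longrightarrow> \<pi> J u = u"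
    and en: "\<And>j u x. j < J \<Longrightarrow> u \<in> T \<Longrightarrow> x < m \<Longrightarrow>
      energy n m p (\<lambda>c. \<pi> (Suc j) u c - \<pi> j u c) x \<le> t j"
    and t: "\<And>j. j < J \<Longrightarrow> 0 \<le> t j" and B: "\<And>j. j < J \<Longrightarrow> 1 \<le> B j"
    and card: "\<And>j. j < J \<Longrightarrow> ln (2 * real (card (\<pi> j ` T) * card (\<pi> (Suc j) ` T))) \<le> B j"
    and c: "\<And>j. j < J \<Longrightarrow> sqrt (2 * B j * t j / real m) \<le> c"
  defines "G \<equiv> gauss_vec (1 / sqrt (real m)) ({1..p} \<times> {1..m})"
  shows "(\<integral>\<^sup>+z. ennreal (Max ((\<lambda>u. \<bar>Phi_form n m p u u (fst z) (snd z)\<bar>) ` T)) \<partial>(G \<Otimes>\<^sub>M G)) \<le>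
    ennreal (2 * real J * c) * (1 + (\<integral>\<^sup>+g. ennreal (defect n m p T g / 2) \<partial>G))"
proof (cases "J = 0")
  \<comment> \<open>Here \<open>T\<close> is the zero vector alone; without a level nothing would
    force \<open>c\<close> to be nonnegative.\<close>
  case True
  then have "T = {\<lambda>_. 0}" using \<pi>0 \<pi>J T(2) by fastforce
  then show ?thesis by (simp add: Phi_form_zero)
next
  case False
  have sm: "0 < 1 / sqrt (real m)" using assms(1) by auto
  interpret G: prob_space G unfolding G_def by (rule prob_space_gauss_vec[OF sm])
  interpret GG: pair_prob_space G G ..
  note fm = Phi_form_measurable[OF assms(1), where n = n and p = p and \<sigma> = "1 / sqrt (real m)", folded G_def]
  \<comment> \<open>The index i selects the partner of the increment: 1 for the finer point, 0 for
    the coarser one.\<close>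
  define L where "L = (\<lambda>i j. (\<lambda>u. (\<lambda>c. \<pi> (Suc j) u c - \<pi> j u c, \<pi> (j + i) u)) ` T)"
  define M1 where "M1 = (\<lambda>j z. Max ((\<lambda>(w, v). \<bar>Phi_form n m p w v (fst z) (snd z)\<bar>) ` L 1 j))"
  define M2 where "M2 = (\<lambda>j z. Max ((\<lambda>(w, v). \<bar>Phi_form n m p w v (snd z) (fst z)\<bar>) ` L 0 j))"
  define E where "E = 1 + (\<integral>\<^sup>+g. ennreal (defect n m p T g / 2) \<partial>G)"
  have finL: "finite (L i j)" for i j using T by (simp add: L_def)
  have M1m: "M1 j \<in> borel_measurable (G \<Otimes>\<^sub>M G)" for j
    unfolding M1_def case_prod_unfold by (intro borel_measurable_Max borel_measurable_abs fm finL)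
  have M2m: "M2 j \<in> borel_measurable (G \<Otimes>\<^sub>M G)" for j
    unfolding M2_def case_prod_unfold by (intro borel_measurable_Max borel_measurable_abs fm finL)
  have link: "(\<integral>\<^sup>+h. \<integral>\<^sup>+g. ennreal (Max ((\<lambda>(w, v). \<bar>Phi_form n m p w v g h\<bar>) ` L i j)) \<partial>G \<partial>G) \<le> ennreal c * E"
    if j: "j < J" and i: "i \<le> 1" for i j
  proof -
    have "(\<integral>\<^sup>+h. \<integral>\<^sup>+g. ennreal (Max ((\<lambda>(w, v). \<bar>Phi_form n m p w v g h\<bar>) ` L i j)) \<partial>G \<partial>G) \<le>
        ennreal (sqrt (2 * B j * t j / real m)) * E"
      unfolding G_def E_def
    proof (rule link_bound[OF assms(1) T(1,3) finL])
      show "L i j \<noteq> {}" using T by (simp add: L_def)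
      show "v \<in> T \<and> (\<forall>x<m. energy n m p w x \<le> t j)" if "(w, v) \<in> L i j" for w v
        using that j i \<pi> en by (auto simp: L_def)
      define K where "K = \<pi> j ` T \<times> \<pi> (Suc j) ` T"
      have finK: "finite K" using T by (simp add: K_def)
      have "L i j \<subseteq> (\<lambda>(a, b). (\<lambda>c. b c - a c, if i = 0 then a else b)) ` K"
      proof
        fix l assume "l \<in> L i j"
        then obtain u where u: "u \<in> T" "l = (\<lambda>c. \<pi> (Suc j) u c - \<pi> j u c, \<pi> (j + i) u)"
          by (auto simp: L_def)
        moreover have "(\<pi> j u, \<pi> (Suc j) u) \<in> K" using u by (simp add: K_def)
        moreover have "\<pi> (j + i) u = (if i = 0 then \<pi> j u else \<pi> (Suc j) u)"
          using i by (cases i) auto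
        ultimately show "l \<in> (\<lambda>(a, b). (\<lambda>c. b c - a c, if i = 0 then a else b)) ` K"
          by (intro image_eqI[of _ _ "(\<pi> j u, \<pi> (Suc j) u)"]) auto
      qed
      then have "card (L i j) \<le> card ((\<lambda>(a, b). (\<lambda>c. b c - a c, if i = 0 then a else b)) ` K)"
        using finK by (intro card_mono) auto
      also have "\<dots> \<le> card K" by (rule card_image_le[OF finK])
      also have "\<dots> = card (\<pi> j ` T) * card (\<pi> (Suc j) ` T)" by (simp add: K_def card_cartesian_product)
      finally have le: "card (L i j) \<le> card (\<pi> j ` T) * card (\<pi> (Suc j) ` T)" .
      have "0 < card (L i j)" using T finL by (simp add: card_gt_0_iff L_def)
      with le have "ln (2 * real (card (L i j))) \<le> ln (2 * real (card (\<pi> j ` T) * card (\<pi> (Suc j) ` T)))"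
        using of_nat_mono[OF le, where ?'a = real] by (intro ln_le_cancel_iff[THEN iffD2]) linarith+
      with card[OF j] show "ln (2 * real (card (L i j))) \<le> B j" by linarith
    qed (use j t B in auto)
    also have "\<dots> \<le> ennreal c * E" by (intro mult_right_mono ennreal_leI c j) simp
    finally show ?thesis .
  qed
  \<comment> \<open>The inner integral has to run over the probe attached to the increment: the
    first component for \<open>M1\<close>, the second for \<open>M2\<close>.\<close>
  have I1: "(\<integral>\<^sup>+z. ennreal (M1 j z) \<partial>(G \<Otimes>\<^sub>M G)) \<le> ennreal c * E" if "j < J" for j
    using link[OF that, of 1] M1m[of j] by (simp add: GG.nn_integral_snd[symmetric] M1_def)
  have I2: "(\<integral>\<^sup>+z. ennreal (M2 j z) \<partial>(G \<Otimes>\<^sub>M G)) \<le> ennreal c * E" if "j < J" for j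
    using link[OF that, of 0] M2m[of j] by (simp add: G.nn_integral_fst[symmetric] M2_def)
  have M1ge: "\<bar>Phi_form n m p (\<lambda>c. \<pi> (Suc j) u c - \<pi> j u c) (\<pi> (Suc j) u) (fst z) (snd z)\<bar> \<le> M1 j z"
    if "u \<in> T" for u j z
    unfolding M1_def
    by (rule Max_ge[OF finite_imageI[OF finL]],
        rule image_eqI[of _ _ "(\<lambda>c. \<pi> (Suc j) u c - \<pi> j u c, \<pi> (Suc j) u)"]) (use that in \<open>auto simp: L_def\<close>)
  have M2ge: "\<bar>Phi_form n m p (\<lambda>c. \<pi> (Suc j) u c - \<pi> j u c) (\<pi> j u) (snd z) (fst z)\<bar> \<le> M2 j z"
    if "u \<in> T" for u j z
    unfolding M2_def
    by (rule Max_ge[OF finite_imageI[OF finL]],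
        rule image_eqI[of _ _ "(\<lambda>c. \<pi> (Suc j) u c - \<pi> j u c, \<pi> j u)"]) (use that in \<open>auto simp: L_def\<close>)
  have "(\<integral>\<^sup>+z. ennreal (Max ((\<lambda>u. \<bar>Phi_form n m p u u (fst z) (snd z)\<bar>) ` T)) \<partial>(G \<Otimes>\<^sub>M G)) \<le>
      (\<integral>\<^sup>+z. (\<Sum>j<J. ennreal (M1 j z) + ennreal (M2 j z)) \<partial>(G \<Otimes>\<^sub>M G))"
  proof (rule nn_integral_mono)
    fix z :: "(nat \<times> nat \<Rightarrow> real) \<times> (nat \<times> nat \<Rightarrow> real)"
    obtain g h where z: "z = (g, h)" by (cases z)
    have "Max ((\<lambda>u. \<bar>Phi_form n m p u u (fst z) (snd z)\<bar>) ` T) \<in> (\<lambda>u. \<bar>Phi_form n m p u u (fst z) (snd z)\<bar>) ` T"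
      using T by (intro Max_in) auto
    then obtain u where u: "u \<in> T"
      "Max ((\<lambda>u. \<bar>Phi_form n m p u u (fst z) (snd z)\<bar>) ` T) = \<bar>Phi_form n m p u u g h\<bar>" by (auto simp: z)
    have "Phi_form n m p u u g h = (\<Sum>j<J. Phi_form n m p (\<pi> (Suc j) u) (\<pi> (Suc j) u) g h - Phi_form n m p (\<pi> j u) (\<pi> j u) g h)"
      by (subst sum_lessThan_telescope) (simp add: \<pi>0[OF u(1)] \<pi>J[OF u(1)] Phi_form_zero)
    also have "\<bar>\<dots>\<bar> \<le> (\<Sum>j<J. M1 j z + M2 j z)"
    proof (rule sum_abs[THEN order_trans], rule sum_mono)
      fix j
      show "\<bar>Phi_form n m p (\<pi> (Suc j) u) (\<pi> (Suc j) u) g h - Phi_form n m p (\<pi> j u) (\<pi> j u) g h\<bar> \<le> M1 j z + M2 j z"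
        unfolding Phi_form_telescope
        using M1ge[OF u(1), of j z] M2ge[OF u(1), of j z] by (simp add: z)
    qed
    finally have "ennreal (Max ((\<lambda>u. \<bar>Phi_form n m p u u (fst z) (snd z)\<bar>) ` T)) \<le> ennreal (\<Sum>j<J. M1 j z + M2 j z)"
      unfolding u(2) by (rule ennreal_leI)
    also have "\<dots> = (\<Sum>j<J. ennreal (M1 j z) + ennreal (M2 j z))"
      using order_trans[OF abs_ge_zero M1ge[OF u(1)]] order_trans[OF abs_ge_zero M2ge[OF u(1)]]
      by (subst sum_ennreal[symmetric]) (auto simp: ennreal_plus)
    finally show "ennreal (Max ((\<lambda>u. \<bar>Phi_form n m p u u (fst z) (snd z)\<bar>) ` T)) \<le>
        (\<Sum>j<J. ennreal (M1 j z) + ennreal (M2 j z))" .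
  qed
  also have "\<dots> = (\<Sum>j<J. (\<integral>\<^sup>+z. ennreal (M1 j z) \<partial>(G \<Otimes>\<^sub>M G)) + (\<integral>\<^sup>+z. ennreal (M2 j z) \<partial>(G \<Otimes>\<^sub>M G)))"
    using M1m M2m by (simp add: nn_integral_sum nn_integral_add)
  also have "\<dots> \<le> (\<Sum>j<J. ennreal c * E + ennreal c * E)"
    by (intro sum_mono add_mono I1 I2) auto
  also have "\<dots> = ennreal (2 * real J * c) * E"
  proof -
    have "0 \<le> c" using c[of 0] t[of 0] B[of 0] False by (auto intro: order_trans[rotated])
    then show ?thesis
      by (simp add: ennreal_mult ennreal_of_nat_eq_real_of_nat mult_2[symmetric] mult_ac)
  qed
  finally show ?thesis unfolding E_def .
qed

section \<open>Decoupling and finiteness of the defect\<close>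

text \<open>The squared norm of \<open>u\<close> is the mean of the form over an independent copy.
  Jensen's inequality takes this mean out of the maximum, and rotation invariance replaces the
  rotated pair by a fresh one.\<close>

lemma defect_decoupling:
  fixes n m p :: nat
  assumes "0 < n" "n \<le> m" and T: "finite T" "T \<noteq> {}"
  defines "G \<equiv> gauss_vec (1 / sqrt (real m)) ({1..p} \<times> {1..m})"
  shows "(\<integral>\<^sup>+g. ennreal (defect n m p T g) \<partial>G) \<le>
    2 * (\<integral>\<^sup>+z. ennreal (Max ((\<lambda>u. \<bar>Phi_form n m p u u (fst z) (snd z)\<bar>) ` T)) \<partial>(G \<Otimes>\<^sub>M G))"
proof -
  have m: "0 < m" using assms by simp
  have sm: "0 < 1 / sqrt (real m)" using m by auto
  let ?I = "{1..p} \<times> {1..m}"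
  interpret G: prob_space G unfolding G_def by (rule prob_space_gauss_vec[OF sm])
  interpret GG: pair_prob_space G G ..
  note fm = Phi_form_measurable[OF m, where n = n and p = p and \<sigma> = "1 / sqrt (real m)", folded G_def]
  note fe = Phi_form_expectation[OF assms(1,2), where p = p, folded G_def]
  define F where "F = (\<lambda>z. Max ((\<lambda>u. \<bar>Phi_form n m p u u (fst z) (snd z)\<bar>) ` T))"
  define H where "H = (\<lambda>z. Max ((\<lambda>u. \<bar>Phi_form n m p u u (fst z) (fst z) - Phi_form n m p u u (snd z) (snd z)\<bar>) ` T))"
  have Fm: "F \<in> borel_measurable (G \<Otimes>\<^sub>M G)"
    unfolding F_def by (intro borel_measurable_Max borel_measurable_abs fm T)
  have Hm: "H \<in> borel_measurable (G \<Otimes>\<^sub>M G)"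
    unfolding H_def by (intro borel_measurable_Max borel_measurable_abs borel_measurable_diff fm T)
  have F0: "0 \<le> F z" for z
    unfolding F_def using T by (subst Max_ge_iff) auto
  have "ennreal (defect n m p T g) \<le> (\<integral>\<^sup>+h. ennreal (H (h, g)) \<partial>G)" for g
  proof -
    have "defect n m p T g \<in> (\<lambda>u. \<bar>(\<Sum>j\<in>{1..n * p}. (u j)\<^sup>2) - Phi_form n m p u u g g\<bar>) ` T"
      unfolding defect_def using T by (intro Max_in) auto
    then obtain u where u: "u \<in> T" "defect n m p T g = \<bar>(\<Sum>j\<in>{1..n * p}. (u j)\<^sup>2) - Phi_form n m p u u g g\<bar>"
      by auto
    \<comment> \<open>The maximiser \<open>u\<close> depends on \<open>g\<close> alone, so it stays
      fixed while the copy \<open>h\<close> is integrated.\<close>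
    have "(\<Sum>j\<in>{1..n * p}. (u j)\<^sup>2) - Phi_form n m p u u g g = (\<integral>h. Phi_form n m p u u h h - Phi_form n m p u u g g \<partial>G)"
      using fe[of u] by (simp add: G.prob_space)
    then have "ennreal (defect n m p T g) \<le> ennreal (\<integral>h. \<bar>Phi_form n m p u u h h - Phi_form n m p u u g g\<bar> \<partial>G)"
      unfolding u(2) by (intro ennreal_leI) (simp only: integral_abs_bound)
    also have "\<dots> = (\<integral>\<^sup>+h. ennreal \<bar>Phi_form n m p u u h h - Phi_form n m p u u g g\<bar> \<partial>G)"
      using fe[of u] by (intro nn_integral_eq_integral[symmetric]) auto
    also have "\<dots> \<le> (\<integral>\<^sup>+h. ennreal (H (h, g)) \<partial>G)"
      unfolding H_def using u(1) T by (intro nn_integral_mono ennreal_leI Max_ge) auto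
    finally show ?thesis .
  qed
  then have "(\<integral>\<^sup>+g. ennreal (defect n m p T g) \<partial>G) \<le> (\<integral>\<^sup>+g. \<integral>\<^sup>+h. ennreal (H (h, g)) \<partial>G \<partial>G)"
    by (intro nn_integral_mono)
  also have "\<dots> = (\<integral>\<^sup>+z. ennreal (H z) \<partial>(G \<Otimes>\<^sub>M G))"
    by (rule GG.nn_integral_snd) (use Hm in simp)
  also have "\<dots> = (\<integral>\<^sup>+z. ennreal (2 * F (\<lambda>i\<in>?I. (fst z i - snd z i) / sqrt 2,
      \<lambda>i\<in>?I. (fst z i + snd z i) / sqrt 2)) \<partial>(G \<Otimes>\<^sub>M G))"
  proof (intro nn_integral_cong arg_cong[where f = ennreal])
    fix z
    have "H z = Max ((*) 2 ` (\<lambda>u. \<bar>Phi_form n m p u u (\<lambda>i\<in>?I. (fst z i - snd z i) / sqrt 2)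
        (\<lambda>i\<in>?I. (fst z i + snd z i) / sqrt 2)\<bar>) ` T)"
      unfolding H_def Phi_form_rotate[OF m] image_image abs_mult by simp
    also have "\<dots> = 2 * F (\<lambda>i\<in>?I. (fst z i - snd z i) / sqrt 2, \<lambda>i\<in>?I. (fst z i + snd z i) / sqrt 2)"
      unfolding F_def fst_conv snd_conv
      by (rule mono_Max_commute[symmetric]) (use T in \<open>auto simp: mono_def\<close>)
    finally show "H z = 2 * F (\<lambda>i\<in>?I. (fst z i - snd z i) / sqrt 2, \<lambda>i\<in>?I. (fst z i + snd z i) / sqrt 2)" .
  qed
  also have "\<dots> = (\<integral>\<^sup>+z. ennreal (2 * F z) \<partial>(G \<Otimes>\<^sub>M G))"
    unfolding G_def
    by (rule gauss_vec_rotation[OF sm, where F = "\<lambda>z. ennreal (2 * F z)"])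
       (use Fm in \<open>simp_all add: G_def\<close>)
  also have "\<dots> = 2 * (\<integral>\<^sup>+z. ennreal (F z) \<partial>(G \<Otimes>\<^sub>M G))"
    using Fm F0 by (simp add: ennreal_mult nn_integral_cmult)
  finally show ?thesis by (simp add: F_def)
qed

text \<open>A crude bound by the sum over \<open>T\<close>. Finiteness is required before a multiple
  of E D can be moved to the other side.\<close>

lemma defect_finite:
  fixes n m p :: nat
  assumes "0 < n" "n \<le> m" and T: "finite T" "T \<noteq> {}"
  defines "G \<equiv> gauss_vec (1 / sqrt (real m)) ({1..p} \<times> {1..m})"
  shows "(\<integral>\<^sup>+g. ennreal (defect n m p T g) \<partial>G) < \<infinity>"
proof -
  have sm: "0 < 1 / sqrt (real m)" using assms by auto
  interpret G: prob_space G unfolding G_def by (rule prob_space_gauss_vec[OF sm])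
  note fe = Phi_form_expectation[OF assms(1,2), where p = p, folded G_def]
  define f where "f = (\<lambda>u g. \<bar>(\<Sum>j\<in>{1..n * p}. (u j)\<^sup>2) - Phi_form n m p u u g g\<bar>)"
  have int: "integrable G (\<lambda>g. \<Sum>u\<in>T. f u g)"
    unfolding f_def
    by (intro Bochner_Integration.integrable_sum integrable_abs Bochner_Integration.integrable_diff fe(1)) simp
  have "(\<integral>\<^sup>+g. ennreal (defect n m p T g) \<partial>G) \<le> (\<integral>\<^sup>+g. ennreal (\<Sum>u\<in>T. f u g) \<partial>G)"
  proof (intro nn_integral_mono ennreal_leI)
    fix g
    have "defect n m p T g \<in> (\<lambda>u. f u g) ` T"
      unfolding defect_def f_def using T by (intro Max_in) auto
    then show "defect n m p T g \<le> (\<Sum>u\<in>T. f u g)"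
      using T by (auto intro!: member_le_sum simp: f_def)
  qed
  also have "\<dots> < \<infinity>"
    using int by (subst nn_integral_eq_integral) (auto intro!: sum_nonneg simp: f_def)
  finally show ?thesis .
qed

section \<open>Choice of the scales and conclusion\<close>

lemma half_le_ln:
  assumes "2 \<le> x"
  shows "1 / 2 \<le> ln (real x)"
proof -
  have "ln 2 \<le> ln (real x)" using assms by (intro ln_le_cancel_iff[THEN iffD2]) auto
  with ln2_ge_two_thirds show ?thesis by linarith
qed

lemma probe_measure_eq: "probe_measure m p = gauss_vec (1 / sqrt (real m)) ({1..p} \<times> {1..m})"
  by (simp add: probe_measure_def gauss_vec_def gauss_def)

text \<open>Level j uses words of length \<open>K * 4 ^ j\<close>, and the choice of K cancels the
  factor 64 (ln m + 1). The end levels are replaced by the zero vector and by the identity; the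
  latter fits the cardinality budget because 7 s <= K * 4 ^ J.\<close>

lemma multiscale_projections:
  fixes n m p s J K :: nat
  assumes "0 < m" "0 < s" "s \<le> n * p" "2 \<le> n * p" "0 < J" "real s \<le> 4 ^ J"
    and K: "64 * (ln (real m) + 1) \<le> real K"
  defines "T \<equiv> grid (n * p) s"
  shows "\<exists>\<pi>. (\<forall>j\<le>J. \<forall>u\<in>T. \<pi> j u \<in> T \<and> (\<forall>x<m. energy n m p (\<lambda>c. u c - \<pi> j u c) x \<le> 4 * real s / 4 ^ j)) \<and>
    (\<forall>u\<in>T. \<pi> 0 u = (\<lambda>_. 0) \<and> \<pi> J u = u) \<and>
    (\<forall>j\<le>J. card (\<pi> j ` T) \<le> (2 * (n * p)) ^ (K * 4 ^ j))"
proof -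
  have lm: "0 \<le> ln (real m)" using assms(1) by simp
  then have "64 * (0 + 1) \<le> 64 * (ln (real m) + 1)" by (intro mult_left_mono add_right_mono) auto
  with K have "64 \<le> real K" by (simp only: add_0 mult_1_right)
  then have K64: "64 \<le> K" by simp
  have N: "0 < n * p" using assms(4) by linarith
  note grid = grid_card[OF assms(2-4)]
  have l1: "(\<Sum>j\<in>{1..n * p}. \<bar>u j\<bar>) \<le> sqrt (real s)" if "u \<in> T" for u
    using grid_l1 that by (simp add: T_def)
  define R where "R = (\<lambda>j P. (\<forall>u\<in>T. P u \<in> T \<and>
      (\<forall>x<m. energy n m p (\<lambda>c. u c - P u c) x \<le> 256 * real s * (ln (real m) + 1) / real (K * 4 ^ j))) \<and>
    card (P ` T) \<le> (2 * (n * p)) ^ (K * 4 ^ j))"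
  have "\<exists>P. R j P" for j
    unfolding R_def
    by (rule energy_covering[OF assms(1,2) N _ _ l1]) (use K64 grid in \<open>auto simp: T_def\<close>)
  then have "\<forall>j. \<exists>P. R j P" by blast
  then obtain P where P: "\<And>j. R j (P j)" by (rule choice[THEN exE]) blast
  define \<pi> where "\<pi> = (\<lambda>j u. if j = 0 then (\<lambda>_. 0) else if j = J then u else P j u)"
  have "\<pi> j u \<in> T" if "u \<in> T" for j u
    using that P[of j] zero_in_grid by (auto simp: \<pi>_def R_def T_def)
  moreover have "energy n m p (\<lambda>c. u c - \<pi> j u c) x \<le> 4 * real s / 4 ^ j" if "u \<in> T" "x < m" for j u x
  proof -
    consider "j = 0" | "j \<noteq> 0" "j = J" | "j \<noteq> 0" "j \<noteq> J" by blast
    then show ?thesis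
    proof cases
      case 1
      have "energy n m p u x \<le> (sqrt (real s))\<^sup>2" by (rule energy_le_l1[OF _ l1[OF that(1)]]) simp
      with 1 show ?thesis by (simp add: \<pi>_def)
    next
      case 2
      have "energy n m p (\<lambda>c. 0) x \<le> 0\<^sup>2" by (rule energy_le_l1) auto
      also have "0\<^sup>2 \<le> 4 * real s / 4 ^ j" by simp
      finally show ?thesis using 2 by (simp add: \<pi>_def)
    next
      case 3
      have "energy n m p (\<lambda>c. u c - \<pi> j u c) x \<le> 256 * real s * (ln (real m) + 1) / real (K * 4 ^ j)"
        using 3 P[of j] that by (auto simp: \<pi>_def R_def)
      also have "\<dots> = 4 * real s * (64 * (ln (real m) + 1)) / (real K * 4 ^ j)" by simp
      also have "\<dots> \<le> 4 * real s * real K / (real K * 4 ^ j)"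
        by (intro divide_right_mono mult_left_mono K) auto
      also have "\<dots> = 4 * real s / 4 ^ j" using K64 by simp
      finally show ?thesis .
    qed
  qed
  moreover have "\<pi> 0 u = (\<lambda>_. 0)" "\<pi> J u = u" for u
    using assms(5) by (auto simp: \<pi>_def)
  moreover have "card (\<pi> j ` T) \<le> (2 * (n * p)) ^ (K * 4 ^ j)" for j
  proof -
    consider "j = 0" | "j \<noteq> 0" "j = J" | "j \<noteq> 0" "j \<noteq> J" by blast
    then show ?thesis
    proof cases
      case 1
      then have "\<pi> j ` T \<subseteq> {\<lambda>_. 0}" by (auto simp: \<pi>_def)
      from card_mono[OF _ this] have "card (\<pi> j ` T) \<le> 1" by simp
      also have "1 \<le> (2 * (n * p)) ^ (K * 4 ^ j)" by (rule one_le_power) (use N in linarith)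
      finally show ?thesis .
    next
      case 2
      have "real s \<le> real (4 ^ J)" using assms(6) by simp
      then have "s \<le> 4 ^ J" by (simp only: of_nat_le_iff)
      then have "7 * s \<le> K * 4 ^ J" using K64 by (intro mult_mono) auto
      then have "(n * p) ^ (7 * s) \<le> (n * p) ^ (K * 4 ^ J)" using N by (intro power_increasing) auto
      also have "\<dots> \<le> (2 * (n * p)) ^ (K * 4 ^ J)" by (intro power_mono) auto
      finally show ?thesis using 2 grid(2) by (simp add: \<pi>_def T_def)
    next
      case 3
      then show ?thesis using P[of j] by (simp add: \<pi>_def R_def)
    qed
  qed
  ultimately show ?thesis by blast
qed

lemma expected_snorm_bound:
  fixes n p m s :: nat
  assumes "1 \<le> n" "1 \<le> p" "n \<le> m" "2 \<le> s" "s \<le> n * p"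
  defines "X \<equiv> real s * (ln (real s))\<^sup>2 * (ln (real (m * p)))\<^sup>2 * ln (real (n * p))"
  assumes X: "12291840 * X \<le> real m"
  shows "(\<integral>\<^sup>+ phi. ennreal (snorm (n * p) s (gram_dev n m phi)) \<partial>probe_measure m p) \<le>
    ennreal (8 * sqrt (12291840 * X / real m))"
proof -
  have m: "0 < m" and n: "0 < n" and N: "2 \<le> n * p" and s: "0 < s" using assms by auto
  have "n * p \<le> m * p" using assms(3) by simp
  with N have mp: "2 \<le> m * p" by linarith
  define lN where "lN = ln (real (n * p))"
  define lM where "lM = ln (real (m * p))"
  define ls where "ls = ln (real s)"
  have l: "1 / 2 \<le> lN" "1 / 2 \<le> lM" "1 / 2 \<le> ls"
    using half_le_ln N mp assms(4) by (auto simp: lN_def lM_def ls_def simp del: of_nat_mult)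
  have "m * 1 \<le> m * p" using assms(2) by (intro mult_left_mono) auto
  then have "real m \<le> real (m * p)" by (simp only: of_nat_le_iff mult_1_right)
  define l0 where "l0 = ln (real m)"
  from \<open>real m \<le> real (m * p)\<close> have lm: "0 \<le> l0" "l0 \<le> lM"
    using m unfolding lM_def l0_def by (simp, intro ln_le_cancel_iff[THEN iffD2]) auto
  have nat_ceiling_le: "real (nat \<lceil>x\<rceil>) \<le> x + 1" if "0 \<le> x" for x :: real
    using that by linarith
  define K where "K = nat \<lceil>64 * (l0 + 1)\<rceil>"
  have K: "64 * (l0 + 1) \<le> real K" "real K \<le> 64 * (l0 + 1) + 1"
    unfolding K_def by (rule real_nat_ceiling_ge, rule nat_ceiling_le) (use lm(1) in simp)
  have K1: "1 \<le> real K" using K(1) lm(1) unfolding distrib_left by linarith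
  \<comment> \<open>About ln s levels are enough, since 4 > e gives s <= 4 ^ J.\<close>
  define J where "J = nat \<lceil>ls\<rceil>"
  have J: "ls \<le> real J" "real J \<le> ls + 1"
    unfolding J_def by (rule real_nat_ceiling_ge, rule nat_ceiling_le) (use l(3) in simp)
  have J0: "0 < J" using J(1) l(3) by (cases J) auto
  have "real s = exp ls" using s by (simp add: ls_def)
  also have "\<dots> \<le> exp (real J)" using J by simp
  also have "\<dots> = exp 1 ^ J" by (simp add: exp_of_nat_mult[symmetric])
  also have "\<dots> \<le> 4 ^ J" using exp_le by (intro power_mono) auto
  finally have s4: "real s \<le> 4 ^ J" .
  define T where "T = grid (n * p) s"
  have T: "finite T" "T \<noteq> {}" "\<And>u. u \<in> T \<Longrightarrow> (\<Sum>j\<in>{1..n * p}. (u j)\<^sup>2) \<le> 1"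
  proof -
    show "finite T" unfolding T_def by (rule grid_card(1)[OF s assms(5) N])
    show "T \<noteq> {}" unfolding T_def using zero_in_grid by blast
    show "(\<Sum>j\<in>{1..n * p}. (u j)\<^sup>2) \<le> 1" if "u \<in> T" for u
      using that unfolding T_def grid_def by blast
  qed
  obtain \<pi> where \<pi>: "\<And>j u. j \<le> J \<Longrightarrow> u \<in> T \<Longrightarrow> \<pi> j u \<in> T"
    "\<And>j u x. j \<le> J \<Longrightarrow> u \<in> T \<Longrightarrow> x < m \<Longrightarrow> energy n m p (\<lambda>c. u c - \<pi> j u c) x \<le> 4 * real s / 4 ^ j"
    "\<And>u. u \<in> T \<Longrightarrow> \<pi> 0 u = (\<lambda>_. 0)" "\<And>u. u \<in> T \<Longrightarrow> \<pi> J u = u"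
    "\<And>j. j \<le> J \<Longrightarrow> card (\<pi> j ` T) \<le> (2 * (n * p)) ^ (K * 4 ^ j)"
    using multiscale_projections[OF m s assms(5) N J0 s4 K(1)[unfolded l0_def]] unfolding T_def by blast
  define G where "G = gauss_vec (1 / sqrt (real m)) ({1..p} \<times> {1..m})"
  \<comment> \<open>Neighbouring levels combine to 2 * 4 / 4 + 2 * 4 = 10.\<close>
  define t where "t = (\<lambda>j::nat. 10 * real s / 4 ^ j)"
  \<comment> \<open>Neighbouring word lengths add up to 5 K 4^j, and ln (2 n p) <= 2
    \<open>lN\<close>; this makes 10, and one more pays for the leading ln 2.\<close>
  define B where "B = (\<lambda>j::nat. 11 * 4 ^ j * real K * lN)"
  \<comment> \<open>220 = 2 * 11 * 10. The powers of 4 in \<open>B\<close> and \<open>t\<close>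
    cancel, so all levels share this constant.\<close>
  define c where "c = sqrt (220 * real s * real K * lN / real m)"
  define d where "d = defect n m p T"
  have c0: "0 \<le> c" using l by (simp add: c_def)
  have one_le: "1 \<le> 4 ^ j * real K" for j :: nat
    using mult_mono[of 1 "4 ^ j" 1 "real K"] K1 by simp
  have "(\<integral>\<^sup>+z. ennreal (Max ((\<lambda>u. \<bar>Phi_form n m p u u (fst z) (snd z)\<bar>) ` T)) \<partial>(G \<Otimes>\<^sub>M G)) \<le>
    ennreal (2 * real J * c) * (1 + (\<integral>\<^sup>+g. ennreal (d g / 2) \<partial>G))"
    unfolding G_def d_def
  proof (rule chaining[OF m T \<pi>(1) \<pi>(3,4), where t = t and B = B])
    fix j assume j: "j < J"
    show "0 \<le> t j" by (simp add: t_def)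
    have "1 \<le> 11 * 1 * (1 / 2 :: real)" by simp
    also have "\<dots> \<le> 11 * (4 ^ j * real K) * lN"
      using one_le[of j] l(1) by (intro mult_mono) auto
    also have "\<dots> = B j" by (simp add: B_def)
    finally show "1 \<le> B j" .
    show "sqrt (2 * B j * t j / real m) \<le> c"
      by (simp add: B_def t_def c_def mult_ac)
    show "energy n m p (\<lambda>c. \<pi> (Suc j) u c - \<pi> j u c) x \<le> t j" if "u \<in> T" "x < m" for u x
    proof -
      have "energy n m p (\<lambda>c. \<pi> (Suc j) u c - \<pi> j u c) x \<le>
          2 * energy n m p (\<lambda>c. u c - \<pi> (Suc j) u c) x + 2 * energy n m p (\<lambda>c. u c - \<pi> j u c) x"
        by (rule energy_triangle)
      also have "\<dots> \<le> 2 * (4 * real s / 4 ^ Suc j) + 2 * (4 * real s / 4 ^ j)"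
        using j that by (intro add_mono mult_left_mono \<pi>(2)) auto
      also have "\<dots> = t j" by (simp add: t_def)
      finally show ?thesis .
    qed
    have pos: "0 < card (\<pi> i ` T)" for i using T by (simp add: card_gt_0_iff)
    have "card (\<pi> j ` T) * card (\<pi> (Suc j) ` T) \<le>
        (2 * (n * p)) ^ (K * 4 ^ j) * (2 * (n * p)) ^ (K * 4 ^ Suc j)"
      using j by (intro mult_mono \<pi>(5)) auto
    also have "\<dots> = (2 * (n * p)) ^ (5 * K * 4 ^ j)"
      unfolding power_add[symmetric] by (rule arg_cong[where f = "(^) _"]) simp
    finally have "real (card (\<pi> j ` T) * card (\<pi> (Suc j) ` T)) \<le> real ((2 * (n * p)) ^ (5 * K * 4 ^ j))"
      by (simp only: of_nat_le_iff)
    also have "\<dots> = (2 * real (n * p)) ^ (5 * K * 4 ^ j)" by simp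
    finally have le: "real (card (\<pi> j ` T) * card (\<pi> (Suc j) ` T)) \<le> (2 * real (n * p)) ^ (5 * K * 4 ^ j)" .
    have Np: "0 < real (n * p)" using N by linarith
    have cp: "0 < real (card (\<pi> j ` T) * card (\<pi> (Suc j) ` T))" using pos by simp
    have "ln (2 * real (card (\<pi> j ` T) * card (\<pi> (Suc j) ` T))) \<le> ln (2 * (2 * real (n * p)) ^ (5 * K * 4 ^ j))"
      using le cp by (intro ln_le_cancel_iff[THEN iffD2]) linarith+
    also have "\<dots> = ln 2 + ln ((2 * real (n * p)) ^ (5 * K * 4 ^ j))"
      by (rule ln_mult_pos) (use Np in \<open>auto intro!: zero_less_power\<close>)
    also have "ln ((2 * real (n * p)) ^ (5 * K * 4 ^ j)) = real (5 * K * 4 ^ j) * ln (2 * real (n * p))"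
      by (rule ln_realpow)
    also have "ln (2 * real (n * p)) = ln 2 + lN"
      unfolding lN_def by (rule ln_mult_pos) (use Np in linarith)+
    also have "ln 2 + real (5 * K * 4 ^ j) * (ln 2 + lN) \<le> lN + real (5 * K * 4 ^ j) * (lN + lN)"
    proof -
      have "ln 2 \<le> lN" unfolding lN_def using N by (intro ln_le_cancel_iff[THEN iffD2]) linarith+
      then show ?thesis by (intro add_mono mult_left_mono) auto
    qed
    also have "\<dots> \<le> B j"
    proof -
      have "1 * lN \<le> (4 ^ j * real K) * lN" using one_le[of j] l(1) by (intro mult_right_mono) auto
      then show ?thesis by (simp add: B_def algebra_simps)
    qed
    finally show "ln (2 * real (card (\<pi> j ` T) * card (\<pi> (Suc j) ` T))) \<le> B j" .
  qed
  note chain = this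
  have bound: "(\<integral>\<^sup>+g. ennreal (d g) \<partial>G) \<le> 2 * (ennreal (2 * real J * c) * (1 + (\<integral>\<^sup>+g. ennreal (d g / 2) \<partial>G)))"
    by (rule order_trans[OF defect_decoupling[OF n assms(3) T(1,2), of p, folded G_def d_def]
          mult_left_mono[OF chain]]) simp
  \<comment> \<open>By finiteness the expectation is a real number, and the inequality can be
    rearranged.\<close>
  define e where "e = enn2real (\<integral>\<^sup>+g. ennreal (d g) \<partial>G)"
  have e: "(\<integral>\<^sup>+g. ennreal (d g) \<partial>G) = ennreal e" "0 \<le> e"
    using defect_finite[OF n assms(3) T(1,2), of p, folded G_def d_def] by (auto simp: e_def)
  have dm: "d \<in> borel_measurable G" unfolding d_def G_def by (rule defect_measurable[OF m T(1)])
  have "(\<integral>\<^sup>+g. ennreal (d g / 2) \<partial>G) = (\<integral>\<^sup>+g. ennreal (1 / 2) * ennreal (d g) \<partial>G)"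
    by (intro nn_integral_cong, subst ennreal_mult'[symmetric]) auto
  also have "\<dots> = ennreal (1 / 2) * ennreal e"
    unfolding e(1)[symmetric] using dm by (intro nn_integral_cmult) simp
  also have "\<dots> = ennreal (e / 2)" by (subst ennreal_mult'[symmetric]) auto
  finally have half: "(\<integral>\<^sup>+g. ennreal (d g / 2) \<partial>G) = ennreal (e / 2)" .
  have "ennreal e \<le> 2 * (ennreal (2 * real J * c) * (1 + ennreal (e / 2)))"
    using bound unfolding e(1) half .
  also have "1 + ennreal (e / 2) = ennreal (1 + e / 2)" using e(2) by simp
  also have "ennreal (2 * real J * c) * \<dots> = ennreal (2 * real J * c * (1 + e / 2))"
    using e(2) c0 by (intro ennreal_mult[symmetric]) auto
  also have "2 * \<dots> = ennreal (2 * (2 * real J * c * (1 + e / 2)))"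
    using ennreal_mult'[of 2] by (simp only: ennreal_numeral zero_le_numeral)
  finally have e1: "e \<le> 4 * real J * c * (1 + e / 2)"
    using e(2) c0 by (simp add: ennreal_le_iff mult.assoc)
  \<comment> \<open>The 4 is the factor 2 of decoupling times the two halves of each link.\<close>
  define \<alpha> where "\<alpha> = 4 * real J * c"
  have \<alpha>: "\<alpha> \<le> sqrt (12291840 * X / real m)"
  proof (rule real_le_rsqrt)
    have K': "real K \<le> 388 * lM\<^sup>2"
    proof -
      \<comment> \<open>The bound 64 x + 65 <= 388 x^2 is an equality at x = 1 / 2, the lower bound
        for \<open>lM\<close>. The product here is twice the difference of the two sides.\<close>
      have "0 \<le> (lM - 1 / 2) * (128 * lM + 130 + 260 * lM)" using l(2) by (intro mult_nonneg_nonneg) auto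
      then have "64 * lM + 65 \<le> 388 * lM\<^sup>2" by (simp add: power2_eq_square algebra_simps)
      then show ?thesis using K(2) lm unfolding distrib_left by linarith
    qed
    have "real J \<le> 3 * ls" using J l(3) by linarith
    then have "(real J)\<^sup>2 \<le> (3 * ls)\<^sup>2" by (intro power_mono) auto
    then have J2: "(real J)\<^sup>2 \<le> 9 * ls\<^sup>2" by (simp add: power_mult_distrib)
    \<comment> \<open>3520 = 4^2 * 220.\<close>
    have "\<alpha>\<^sup>2 = 3520 * ((real J)\<^sup>2 * real K) * (real s * lN / real m)"
      using l(1) by (simp add: \<alpha>_def c_def power_mult_distrib)
    also have "\<dots> \<le> 3520 * ((9 * ls\<^sup>2) * (388 * lM\<^sup>2)) * (real s * lN / real m)"
      using l(1) by (intro mult_right_mono mult_left_mono mult_mono J2 K') auto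
    also have "\<dots> = 12291840 * X / real m"
      by (simp add: X_def ls_def lM_def lN_def)
    finally show "\<alpha>\<^sup>2 \<le> 12291840 * X / real m" .
  qed
  also have "\<dots> \<le> sqrt 1" using X m by (intro real_sqrt_le_mono) simp
  finally have "\<alpha> \<le> 1" by simp
  \<comment> \<open>With \<alpha> <= 1 the term \<alpha> * e / 2 is at most e / 2 and is absorbed on
    the left.\<close>
  then have "\<alpha> * e \<le> e" using mult_right_mono[OF _ e(2), of \<alpha> 1] by simp
  then have e2: "e \<le> 2 * \<alpha>" using e1 by (simp add: \<alpha>_def algebra_simps)
  \<comment> \<open>Monotonicity of the integral holds for arbitrary functions, so the pointwise
    comparison with the grid is enough for \<open>snorm\<close>.\<close>
  have "(\<integral>\<^sup>+ phi. ennreal (snorm (n * p) s (gram_dev n m phi)) \<partial>G) \<le> (\<integral>\<^sup>+ phi. 4 * ennreal (d phi) \<partial>G)"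
  proof (rule nn_integral_mono)
    fix phi
    have "snorm (n * p) s (gram_dev n m phi) \<le> 4 * d phi"
      using snorm_le_grid[of "gram_dev n m phi", OF gram_dev_commute s assms(5) N]
      unfolding d_def defect_def bilinear_gram_dev T_def .
    then have "ennreal (snorm (n * p) s (gram_dev n m phi)) \<le> ennreal (4 * d phi)" by (rule ennreal_leI)
    then show "ennreal (snorm (n * p) s (gram_dev n m phi)) \<le> 4 * ennreal (d phi)"
      by (simp add: ennreal_mult')
  qed
  also have "\<dots> = 4 * ennreal e"
    unfolding e(1)[symmetric] using dm by (intro nn_integral_cmult) simp
  also have "\<dots> = ennreal (4 * e)" by (simp add: ennreal_mult')
  also have "\<dots> \<le> ennreal (8 * sqrt (12291840 * X / real m))"
    using e2 \<alpha> by (intro ennreal_leI) linarith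
  finally show ?thesis by (simp add: probe_measure_eq G_def)
qed

theorem theorem1:
  shows "\<exists>C5 > 0. \<exists>C6 > 0. \<forall>n p m s :: nat.
    1 \<le> n \<longrightarrow> 1 \<le> p \<longrightarrow> n \<le> m \<longrightarrow> 2 \<le> s \<longrightarrow> s \<le> n * p \<longrightarrow>
    real m \<ge> C6 * real s * (ln (real s))\<^sup>2 * (ln (real (m * p)))\<^sup>2 * ln (real (n * p)) \<longrightarrow>
    (\<integral>\<^sup>+ phi. ennreal (snorm (n * p) s (gram_dev n m phi)) \<partial>probe_measure m p)
      \<le> ennreal (sqrt (C5 * real s * (ln (real s))\<^sup>2 * (ln (real (m * p)))\<^sup>2
                        * ln (real (n * p)) / real m))"
proof (rule exI[of _ 786677760], rule conjI, simp, rule exI[of _ 12291840], rule conjI, simp,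
    intro allI impI)
  fix n p m s :: nat
  assume A: "1 \<le> n" "1 \<le> p" "n \<le> m" "2 \<le> s" "s \<le> n * p"
    and C: "12291840 * real s * (ln (real s))\<^sup>2 * (ln (real (m * p)))\<^sup>2 * ln (real (n * p)) \<le> real m"
  let ?X = "real s * (ln (real s))\<^sup>2 * (ln (real (m * p)))\<^sup>2 * ln (real (n * p))"
  have "(\<integral>\<^sup>+ phi. ennreal (snorm (n * p) s (gram_dev n m phi)) \<partial>probe_measure m p)
      \<le> ennreal (8 * sqrt (12291840 * ?X / real m))"
    by (rule expected_snorm_bound[OF A]) (use C in \<open>simp only: mult.assoc\<close>)
  \<comment> \<open>The 8 is the grid factor 4 times the 2 from absorption; squared, it gives the 64
    in the first constant.\<close>
  also have "8 * sqrt (12291840 * ?X / real m) = sqrt (64 * (12291840 * ?X / real m))"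
    unfolding real_sqrt_mult by simp
  also have "64 * (12291840 * ?X / real m) = 786677760 * real s * (ln (real s))\<^sup>2 * (ln (real (m * p)))\<^sup>2
      * ln (real (n * p)) / real m" by simp
  finally show "(\<integral>\<^sup>+ phi. ennreal (snorm (n * p) s (gram_dev n m phi)) \<partial>probe_measure m p)
      \<le> ennreal (sqrt (786677760 * real s * (ln (real s))\<^sup>2 * (ln (real (m * p)))\<^sup>2
                        * ln (real (n * p)) / real m))" .
qed

end
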